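(* Let $\Omega$ be a compact topological space and $\{T_\omega\}_{\omega\in\Omega}$ a family of contractive $C_0$-semigroups on a Hilbert space $\mathcal{H}$. There exists a free unitary dilation $(\mathcal{H}',r,\{U_\omega\}_{\omega\in\Omega})$ of $(\mathcal{H},\{T_\omega\}_{\omega\in\Omega})$ such that: $\{U_\omega\}_{\omega\in\Omega}$ is $k_{\mathrm{SOT}}$-continuous in $\Omega$ if and only if $\{T_\omega\}_{\omega\in\Omega}$ is $k_{\mathrm{SOT}^\star}$-continuous in $\Omega$.
   Context: Hilbert spaces are complex; $\mathcal{L}(\mathcal{H})$ denotes the bounded operators on $\mathcal{H}$. Free unitary dilation: a triple $(\mathcal{H}',r,\{U_\omega\}_{\omega\in\Omega})$ consisting of a Hilbert space $\mathcal{H}'$, an isometry $r:\mathcal{H}\to\mathcal{H}'$, and strongly continuous unitary representations $U_\omega$ of $(\mathbb{R},+)$ on $\mathcal{H}'$ such that $\prod_{k=1}^{N}T_{\omega_k}(t_k)=r^{*}\big(\prod_{k=1}^{N}U_{\omega_k}(t_k)\big)r$ for all $N\in\mathbb{N}$, all $(\omega_k)_{k=1}^N\subseteq\Omega$, and all $(t_k)_{k=1}^N\subseteq\mathbb{R}_{\ge 0}$ (products ordered left to right). Topologies: let $X$ be a topological space. On the set of functions $X\to\mathcal{L}(\mathcal{H})$, the topology $k_{\mathrm{SOT}}$ is defined by: $f^{(\alpha)}\to f$ iff $\sup_{x\in K}\|(f^{(\alpha)}(x)-f(x))\xi\|\to 0$ for every compact $K\subseteq X$ and every $\xi\in\mathcal{H}$.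 The topology $k_{\mathrm{SOT}^\star}$ is defined by: $f^{(\alpha)}\to f$ iff both $f^{(\alpha)}\to f$ and $f^{(\alpha)}(\cdot)^*\to f(\cdot)^*$ in $k_{\mathrm{SOT}}$. A family $\{F_\omega\}_{\omega\in\Omega}$ of functions $X\to\mathcal{L}(\mathcal{H})$ is called $k_{\mathrm{SOT}}$- (resp. $k_{\mathrm{SOT}^\star}$-) continuous in $\Omega$ if the map $\omega\mapsto F_\omega$ is continuous into the function space with that topology. Here $X=\mathbb{R}_{\ge 0}$ for the semigroups $T_\omega$ and $X=\mathbb{R}$ for the representations $U_\omega$ (on $\mathcal{H}'$). *)

theory Defs
  imports "HOL-Analysis.Analysis"
begin

section \<open>Complex Hilbert spaces\<close>

text \<open>
  The given Hilbert space is a type of the following class. The inner product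
  \<open>cinner\<close> is linear in its first argument; its real part is the inner product of
  \<open>real_inner\<close>, so that norm, distance and completeness are those of the library.
\<close>

class complex_hilbert = real_inner + complete_space +
  fixes scaleC :: "complex \<Rightarrow> 'a \<Rightarrow> 'a"
    and cinner :: "'a \<Rightarrow> 'a \<Rightarrow> complex"
  assumes scaleC_add_right: "scaleC a (x + y) = scaleC a x + scaleC a y"
    and scaleC_add_left: "scaleC (a + b) x = scaleC a x + scaleC b x"
    and scaleC_scaleC: "scaleC a (scaleC b x) = scaleC (a * b) x"
    and scaleC_of_real: "scaleC (complex_of_real r) x = r *\<^sub>R x"
    and cinner_commute: "cinner x y = cnj (cinner y x)"
    and cinner_add_left: "cinner (x + y) z = cinner x z + cinner y z"
    and cinner_scaleC_left: "cinner (scaleC a x) y = a * cinner x y"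
    and Re_cinner: "Re (cinner x y) = inner x y"

instantiation complex :: complex_hilbert
begin

definition scaleC_complex :: "complex \<Rightarrow> complex \<Rightarrow> complex" where
  "scaleC_complex a x = a * x"

definition cinner_complex :: "complex \<Rightarrow> complex \<Rightarrow> complex" where
  "cinner_complex x y = x * cnj y"

instance
  by standard
    (auto simp: scaleC_complex_def cinner_complex_def algebra_simps scaleR_conv_of_real
      inner_complex_def)

end

text \<open>
  The dilation space is existentially quantified and can therefore not be a type. It is a
  Hilbert space on a carrier set. All notions below are defined for such spaces, and
  \<open>space_of_type\<close> views a type of class \<open>complex_hilbert\<close> as one.
\<close>

record 'a cspace =
  vecs :: "'a set"
  vadd :: "'a \<Rightarrow> 'a \<Rightarrow> 'a"
  vzero :: 'a
  vscale :: "complex \<Rightarrow> 'a \<Rightarrow> 'a"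
  vinner :: "'a \<Rightarrow> 'a \<Rightarrow> complex"

definition vnorm :: "'a cspace \<Rightarrow> 'a \<Rightarrow> real" where
  "vnorm H x = sqrt (Re (vinner H x x))"

definition vdist :: "'a cspace \<Rightarrow> 'a \<Rightarrow> 'a \<Rightarrow> real" where
  "vdist H x y = vnorm H (vadd H x (vscale H (-1) y))"

locale complex_hilbert_space =
  fixes H :: "'a cspace"
  assumes zero_closed: "vzero H \<in> vecs H"
    and add_closed: "\<lbrakk>x \<in> vecs H; y \<in> vecs H\<rbrakk> \<Longrightarrow> vadd H x y \<in> vecs H"
    and scale_closed: "x \<in> vecs H \<Longrightarrow> vscale H a x \<in> vecs H"
    and add_assoc: "\<lbrakk>x \<in> vecs H; y \<in> vecs H; z \<in> vecs H\<rbrakk> \<Longrightarrow>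
          vadd H (vadd H x y) z = vadd H x (vadd H y z)"
    and add_commute: "\<lbrakk>x \<in> vecs H; y \<in> vecs H\<rbrakk> \<Longrightarrow> vadd H x y = vadd H y x"
    and add_zero: "x \<in> vecs H \<Longrightarrow> vadd H x (vzero H) = x"
    and add_inverse: "x \<in> vecs H \<Longrightarrow> \<exists>y\<in>vecs H. vadd H x y = vzero H"
    and scale_add_right: "\<lbrakk>x \<in> vecs H; y \<in> vecs H\<rbrakk> \<Longrightarrow>
          vscale H a (vadd H x y) = vadd H (vscale H a x) (vscale H a y)"
    and scale_add_left: "x \<in> vecs H \<Longrightarrow>
          vscale H (a + b) x = vadd H (vscale H a x) (vscale H b x)"
    and scale_scale: "x \<in> vecs H \<Longrightarrow> vscale H a (vscale H b x) = vscale H (a * b) x"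
    and scale_one: "x \<in> vecs H \<Longrightarrow> vscale H 1 x = x"
    and inner_commute: "\<lbrakk>x \<in> vecs H; y \<in> vecs H\<rbrakk> \<Longrightarrow> vinner H x y = cnj (vinner H y x)"
    and inner_add_left: "\<lbrakk>x \<in> vecs H; y \<in> vecs H; z \<in> vecs H\<rbrakk> \<Longrightarrow>
          vinner H (vadd H x y) z = vinner H x z + vinner H y z"
    and inner_scale_left: "\<lbrakk>x \<in> vecs H; y \<in> vecs H\<rbrakk> \<Longrightarrow>
          vinner H (vscale H a x) y = a * vinner H x y"
    and inner_nonneg: "x \<in> vecs H \<Longrightarrow> 0 \<le> Re (vinner H x x)"
    and inner_eq_zero: "\<lbrakk>x \<in> vecs H; vinner H x x = 0\<rbrakk> \<Longrightarrow> x = vzero H"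
    and complete: "\<lbrakk>\<And>n::nat. \<sigma> n \<in> vecs H;
          \<And>e. e > 0 \<Longrightarrow> \<exists>N. \<forall>m\<ge>N. \<forall>n\<ge>N. vdist H (\<sigma> m) (\<sigma> n) < e\<rbrakk> \<Longrightarrow>
          \<exists>x\<in>vecs H. (\<lambda>n. vdist H (\<sigma> n) x) \<longlonglongrightarrow> 0"

definition space_of_type :: "'h::complex_hilbert cspace" where
  "space_of_type = \<lparr>vecs = UNIV, vadd = (+), vzero = 0, vscale = scaleC, vinner = cinner\<rparr>"

lemma vnorm_space_of_type: "vnorm space_of_type x = norm x"
  by (simp add: vnorm_def space_of_type_def Re_cinner norm_eq_sqrt_inner)

lemma scaleC_minus_one: "scaleC (-1) x = - (x::'h::complex_hilbert)"
  using scaleC_of_real[of "-1" x] by simp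

lemma vdist_space_of_type: "vdist space_of_type x y = dist x y"
  by (simp add: vdist_def vnorm_space_of_type dist_norm)
    (simp add: space_of_type_def scaleC_minus_one)

lemma complex_hilbert_space_space_of_type:
  "complex_hilbert_space (space_of_type :: 'h::complex_hilbert cspace)"
proof
  fix \<sigma> :: "nat \<Rightarrow> 'h"
  assume *: "\<And>e. e > 0 \<Longrightarrow>
    \<exists>N. \<forall>m\<ge>N. \<forall>n\<ge>N. vdist (space_of_type :: 'h cspace) (\<sigma> m) (\<sigma> n) < e"
  have "Cauchy \<sigma>"
    unfolding Cauchy_def using * by (simp add: vdist_space_of_type)
  then obtain x where "\<sigma> \<longlonglongrightarrow> x"
    using Cauchy_convergent convergent_def by blast
  then show "\<exists>x\<in>vecs (space_of_type :: 'h cspace).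
      (\<lambda>n. vdist (space_of_type :: 'h cspace) (\<sigma> n) x) \<longlonglongrightarrow> 0"
    unfolding vdist_space_of_type
    by (auto simp: tendsto_dist_iff[symmetric] space_of_type_def)
next
  fix x y :: 'h and a
  show "vinner space_of_type x y = cnj (vinner space_of_type y x)"
    using cinner_commute[of x y] by (simp add: space_of_type_def)
  show "\<exists>y\<in>vecs space_of_type. vadd space_of_type x y = vzero space_of_type"
    by (auto simp: space_of_type_def intro: exI[of _ "- x"])
  show "vscale space_of_type 1 x = x"
    using scaleC_of_real[of 1 x] by (simp add: space_of_type_def)
  assume "vinner space_of_type x x = 0"
  then have "inner x x = 0"
    by (simp add: space_of_type_def flip: Re_cinner)
  then show "x = vzero space_of_type"
    by (simp add: space_of_type_def)
qed (auto simp: space_of_type_def add_ac scaleC_add_right scaleC_add_left scaleC_scaleC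
       cinner_add_left cinner_scaleC_left Re_cinner)


section \<open>Operators\<close>

text \<open>
  Operators are functions on the ambient type; only their values on the carrier matter.
  \<open>bounded_ops H K\<close> consists of the bounded linear operators from \<open>H\<close> to \<open>K\<close>.
\<close>

definition bounded_ops :: "'a cspace \<Rightarrow> 'b cspace \<Rightarrow> ('a \<Rightarrow> 'b) set" where
  "bounded_ops H K = {A.
     (\<forall>x\<in>vecs H. A x \<in> vecs K) \<and>
     (\<forall>x\<in>vecs H. \<forall>y\<in>vecs H. A (vadd H x y) = vadd K (A x) (A y)) \<and>
     (\<forall>a. \<forall>x\<in>vecs H. A (vscale H a x) = vscale K a (A x)) \<and>
     (\<exists>c. \<forall>x\<in>vecs H. vnorm K (A x) \<le> c * vnorm H x)}"

definition adj :: "'a cspace \<Rightarrow> 'b cspace \<Rightarrow> ('a \<Rightarrow> 'b) \<Rightarrow> 'b \<Rightarrow> 'a" where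
  "adj H K A y = (THE z. z \<in> vecs H \<and> (\<forall>x\<in>vecs H. vinner K (A x) y = vinner H x z))"

definition isometry_op :: "'a cspace \<Rightarrow> 'b cspace \<Rightarrow> ('a \<Rightarrow> 'b) \<Rightarrow> bool" where
  "isometry_op H K r \<longleftrightarrow> r \<in> bounded_ops H K \<and> (\<forall>x\<in>vecs H. vnorm K (r x) = vnorm H x)"

definition unitary_op :: "'a cspace \<Rightarrow> ('a \<Rightarrow> 'a) \<Rightarrow> bool" where
  "unitary_op H V \<longleftrightarrow> V \<in> bounded_ops H H \<and>
     (\<forall>x\<in>vecs H. adj H H V (V x) = x \<and> V (adj H H V x) = x)"

definition strongly_continuous_on :: "real set \<Rightarrow> 'a cspace \<Rightarrow> (real \<Rightarrow> 'a \<Rightarrow> 'a) \<Rightarrow> bool" where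
  "strongly_continuous_on I H T \<longleftrightarrow>
     (\<forall>x\<in>vecs H. \<forall>t\<in>I. ((\<lambda>s. vdist H (T s x) (T t x)) \<longlongrightarrow> 0) (at t within I))"

definition contractive_C0_semigroup :: "'a cspace \<Rightarrow> (real \<Rightarrow> 'a \<Rightarrow> 'a) \<Rightarrow> bool" where
  "contractive_C0_semigroup H T \<longleftrightarrow>
     (\<forall>t\<ge>0. T t \<in> bounded_ops H H) \<and>
     (\<forall>x\<in>vecs H. T 0 x = x) \<and>
     (\<forall>s\<ge>0. \<forall>t\<ge>0. \<forall>x\<in>vecs H. T (s + t) x = T s (T t x)) \<and>
     strongly_continuous_on {0..} H T \<and>
     (\<forall>t\<ge>0. \<forall>x\<in>vecs H. vnorm H (T t x) \<le> vnorm H x)"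

definition unitary_representation :: "'a cspace \<Rightarrow> (real \<Rightarrow> 'a \<Rightarrow> 'a) \<Rightarrow> bool" where
  "unitary_representation H U \<longleftrightarrow>
     (\<forall>t. unitary_op H (U t)) \<and>
     (\<forall>x\<in>vecs H. U 0 x = x) \<and>
     (\<forall>s t. \<forall>x\<in>vecs H. U (s + t) x = U s (U t x)) \<and>
     strongly_continuous_on UNIV H U"

definition word_product :: "('w \<Rightarrow> real \<Rightarrow> 'a \<Rightarrow> 'a) \<Rightarrow> ('w \<times> real) list \<Rightarrow> 'a \<Rightarrow> 'a" where
  "word_product T ws = foldr (\<circ>) (map (\<lambda>(w, t). T w t) ws) id"

lemma word_product_simps:
  "word_product T [] = id"
  "word_product T ((w, t) # ws) = T w t \<circ> word_product T ws"
  by (simp_all add: word_product_def)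

definition free_unitary_dilation ::
  "'w set \<Rightarrow> 'a cspace \<Rightarrow> ('w \<Rightarrow> real \<Rightarrow> 'a \<Rightarrow> 'a) \<Rightarrow>
   'b cspace \<Rightarrow> ('a \<Rightarrow> 'b) \<Rightarrow> ('w \<Rightarrow> real \<Rightarrow> 'b \<Rightarrow> 'b) \<Rightarrow> bool" where
  "free_unitary_dilation W H T H' r U \<longleftrightarrow>
     complex_hilbert_space H' \<and>
     isometry_op H H' r \<and>
     (\<forall>w\<in>W. unitary_representation H' (U w)) \<and>
     (\<forall>ws. set ws \<subseteq> W \<times> {0..} \<longrightarrow>
        (\<forall>x\<in>vecs H. word_product T ws x = adj H H' r (word_product U ws (r x))))"

text \<open>
  Since an existential quantifier cannot range over types, dilation spaces are sought on subsets
  of the following type. This is no restriction on the existence of dilations: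
  the closed span of the vectors \<open>word_product U ws (r x)\<close>, with arbitrary real times in
  \<open>ws\<close>, contains the range of \<open>r\<close> and reduces every \<open>U w t\<close>, and mapping each of its elements
  \<open>v\<close> to \<open>\<lambda>(ws, x). vinner H' (word_product U ws (r x)) v\<close> is injective. A vector space
  structure on a subset of this type need not be the pointwise one.
\<close>

type_synonym ('w, 'h) dilation_vector = "('w \<times> real) list \<times> 'h \<Rightarrow> complex"


section \<open>The topologies of compact-uniform strong and strong-star convergence\<close>

definition op_functions :: "'x topology \<Rightarrow> 'a cspace \<Rightarrow> ('x \<Rightarrow> 'a \<Rightarrow> 'a) set" where
  "op_functions X H = {f. \<forall>x\<in>topspace X. f x \<in> bounded_ops H H}"

text \<open>
  The supremum is taken in \<open>ennreal\<close>: it may be infinite, as the functions need not be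
  bounded on compact sets.
\<close>

definition sup_dist :: "'a cspace \<Rightarrow> 'x set \<Rightarrow> 'a \<Rightarrow> ('x \<Rightarrow> 'a \<Rightarrow> 'a) \<Rightarrow> ('x \<Rightarrow> 'a \<Rightarrow> 'a) \<Rightarrow> ennreal" where
  "sup_dist H K \<xi> g f = (SUP x\<in>K. ennreal (vdist H (g x \<xi>) (f x \<xi>)))"

definition kSOT :: "'x topology \<Rightarrow> 'a cspace \<Rightarrow> ('x \<Rightarrow> 'a \<Rightarrow> 'a) topology" where
  "kSOT X H = topology_generated_by
     {{g \<in> op_functions X H. sup_dist H K \<xi> g f < ennreal e} | f K \<xi> e.
        f \<in> op_functions X H \<and> compactin X K \<and> \<xi> \<in> vecs H \<and> e > 0}"

text \<open>The coarsest topology for which \<open>f \<mapsto> f\<close> and \<open>f \<mapsto> f(\<cdot>)\<^sup>*\<close> are continuous into \<open>kSOT\<close>:\<close>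

definition kSOT_star :: "'x topology \<Rightarrow> 'a cspace \<Rightarrow> ('x \<Rightarrow> 'a \<Rightarrow> 'a) topology" where
  "kSOT_star X H = topology_generated_by
     ({V. openin (kSOT X H) V} \<union>
      {{f \<in> op_functions X H. (\<lambda>x. adj H H (f x)) \<in> V} | V. openin (kSOT X H) V})"

text \<open>Convergence in these topologies is the convergence that is meant to define them:\<close>

context complex_hilbert_space
begin

lemma zero_scale:
  assumes "x \<in> vecs H"
  shows "vscale H 0 x = vzero H"
proof -
  let ?z = "vscale H 0 x"
  have z: "?z \<in> vecs H"
    using assms by (rule scale_closed)
  obtain y where y: "y \<in> vecs H" "vadd H ?z y = vzero H"
    using add_inverse[OF z] by blast
  have "vadd H ?z ?z = ?z"
    using scale_add_left[OF assms, of 0 0] by simp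
  then show ?thesis
    by (metis add_assoc add_zero y z)
qed

lemma add_minus:
  assumes "x \<in> vecs H"
  shows "vadd H x (vscale H (-1) x) = vzero H"
  using scale_add_left[OF assms, of 1 "-1"] by (simp add: scale_one zero_scale assms)

lemma inner_zero: "x \<in> vecs H \<Longrightarrow> vinner H (vzero H) x = 0"
  using inner_scale_left[of x x 0] zero_scale[of x] by simp

lemma vnorm_zero: "vnorm H (vzero H) = 0"
  by (simp add: vnorm_def inner_zero zero_closed)

lemma vdist_self: "x \<in> vecs H \<Longrightarrow> vdist H x x = 0"
  by (simp add: vdist_def add_minus vnorm_zero)

lemma vnorm_nonneg: "x \<in> vecs H \<Longrightarrow> 0 \<le> vnorm H x"
  by (simp add: vnorm_def inner_nonneg)

lemma vnorm_add_square:
  assumes "x \<in> vecs H" "y \<in> vecs H"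
  shows "Re (vinner H (vadd H x y) (vadd H x y)) =
    Re (vinner H x x) + 2 * Re (vinner H x y) + Re (vinner H y y)"
proof -
  have r: "vinner H z (vadd H x y) = vinner H z x + vinner H z y" if "z \<in> vecs H" for z
    using that assms
    by (metis add_closed complex_cnj_add inner_add_left inner_commute)
  have c: "Re (vinner H y x) = Re (vinner H x y)"
    using inner_commute[OF assms] by simp
  show ?thesis
    using assms c by (simp add: inner_add_left add_closed r)
qed

lemma Cauchy_Schwarz_Re:
  assumes x: "x \<in> vecs H" and y: "y \<in> vecs H"
  shows "Re (vinner H x y) \<le> vnorm H x * vnorm H y"
proof -
  let ?a = "Re (vinner H x x)" and ?b = "Re (vinner H x y)" and ?c = "Re (vinner H y y)"
  have pos: "0 \<le> ?a + 2 * s * ?b + s\<^sup>2 * ?c" for s :: real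
  proof -
    let ?y = "vscale H (complex_of_real s) y"
    have sy: "?y \<in> vecs H"
      using y by (rule scale_closed)
    have *: "vinner H z ?y = of_real s * vinner H z y" if "z \<in> vecs H" for z
      using that y
      by (metis complex_cnj_complex_of_real complex_cnj_mult inner_commute inner_scale_left sy)
    have "Re (vinner H ?y ?y) = s\<^sup>2 * ?c"
      using inner_scale_left[OF y sy] *[OF y] by (simp add: power2_eq_square)
    then show ?thesis
      using inner_nonneg[OF add_closed[OF x sy]] vnorm_add_square[OF x sy] *[OF x]
      by simp
  qed
  have c0: "0 \<le> ?c" and a0: "0 \<le> ?a"
    using inner_nonneg x y by auto
  have "?b\<^sup>2 \<le> ?a * ?c"
  proof (cases "?c = 0")
    case True
    have "?b = 0"
    proof (rule ccontr)
      assume "?b \<noteq> 0"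
      then show False
        using pos[of "- (?a + 1) / (2 * ?b)"] True by (simp add: field_simps)
    qed
    then show ?thesis
      by (simp add: True)
  next
    case False
    then have "?c > 0"
      using c0 by simp
    have "0 \<le> ?c * (?a + 2 * (- ?b / ?c) * ?b + (- ?b / ?c)\<^sup>2 * ?c)"
      using pos c0 by (intro mult_nonneg_nonneg)
    also have "\<dots> = ?a * ?c - ?b\<^sup>2"
      using False by (simp add: field_simps power2_eq_square)
    finally show ?thesis
      by simp
  qed
  then have "?b \<le> sqrt (?a * ?c)"
    by (rule real_le_rsqrt)
  then show ?thesis
    by (simp add: vnorm_def real_sqrt_mult)
qed

lemma vnorm_triangle:
  assumes "x \<in> vecs H" "y \<in> vecs H"
  shows "vnorm H (vadd H x y) \<le> vnorm H x + vnorm H y"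
proof -
  have "Re (vinner H (vadd H x y) (vadd H x y)) \<le> (vnorm H x + vnorm H y)\<^sup>2"
    using vnorm_add_square[OF assms] Cauchy_Schwarz_Re[OF assms]
      inner_nonneg[OF assms(1)] inner_nonneg[OF assms(2)]
    by (simp add: vnorm_def power2_sum)
  then show ?thesis
    unfolding vnorm_def[of H "vadd H x y"]
    by (intro real_le_lsqrt) (auto simp: vnorm_nonneg assms)
qed

lemma vdist_nonneg: "\<lbrakk>x \<in> vecs H; y \<in> vecs H\<rbrakk> \<Longrightarrow> 0 \<le> vdist H x y"
  by (simp add: vdist_def vnorm_nonneg add_closed scale_closed)

lemma vdist_triangle:
  assumes "x \<in> vecs H" "y \<in> vecs H" "z \<in> vecs H"
  shows "vdist H x z \<le> vdist H x y + vdist H y z"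
proof -
  let ?m = "vscale H (-1)"
  have mem: "?m y \<in> vecs H" "?m z \<in> vecs H"
    using assms by (auto intro: scale_closed)
  have "vadd H (?m y) (vadd H y (?m z)) = ?m z"
    using assms mem
    by (metis add_assoc add_commute add_minus add_zero zero_closed)
  then have "vadd H x (?m z) = vadd H (vadd H x (?m y)) (vadd H y (?m z))"
    using assms mem by (simp add: add_assoc add_closed)
  then show ?thesis
    using vnorm_triangle[of "vadd H x (?m y)" "vadd H y (?m z)"] assms mem
    by (simp add: vdist_def add_closed)
qed

lemma sup_dist_triangle:
  assumes K: "compactin X K" and \<xi>: "\<xi> \<in> vecs H"
    and f: "f \<in> op_functions X H" and g: "g \<in> op_functions X H" and h: "h \<in> op_functions X H"
  shows "sup_dist H K \<xi> f h \<le> sup_dist H K \<xi> f g + sup_dist H K \<xi> g h"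
  unfolding sup_dist_def[of H K \<xi> f h]
proof (rule SUP_least)
  fix x
  assume x: "x \<in> K"
  have mem: "F x \<xi> \<in> vecs H" if "F \<in> op_functions X H" for F
    using that x \<xi> compactin_subset_topspace[OF K]
    by (auto simp: op_functions_def bounded_ops_def)
  have "ennreal (vdist H (f x \<xi>) (h x \<xi>)) \<le>
      ennreal (vdist H (f x \<xi>) (g x \<xi>)) + ennreal (vdist H (g x \<xi>) (h x \<xi>))"
    using vdist_triangle[OF mem[OF f] mem[OF g] mem[OF h]]
    by (simp add: vdist_nonneg mem f g h ennreal_leI flip: ennreal_plus)
  also have "\<dots> \<le> sup_dist H K \<xi> f g + sup_dist H K \<xi> g h"
    unfolding sup_dist_def by (intro add_mono SUP_upper x)
  finally show "ennreal (vdist H (f x \<xi>) (h x \<xi>)) \<le> \<dots>" .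
qed

lemma sup_dist_self:
  assumes "compactin X K" "\<xi> \<in> vecs H" "f \<in> op_functions X H"
  shows "sup_dist H K \<xi> f f = 0"
proof -
  have "vdist H (f x \<xi>) (f x \<xi>) = 0" if "x \<in> K" for x
    using that assms compactin_subset_topspace[OF assms(1)]
    by (intro vdist_self) (auto simp: op_functions_def bounded_ops_def)
  then have "sup_dist H K \<xi> f f \<le> 0"
    unfolding sup_dist_def by (intro SUP_least) simp
  then show ?thesis
    by simp
qed

lemma topspace_kSOT: "topspace (kSOT X H) = op_functions X H"
proof (intro equalityI subsetI)
  fix f
  assume f: "f \<in> op_functions X H"
  have "f \<in> {g \<in> op_functions X H. sup_dist H {} (vzero H) g f < ennreal 1}"
    using f by (simp add: sup_dist_def bot_ennreal)
  then show "f \<in> topspace (kSOT X H)"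
    unfolding kSOT_def topology_generated_by_topspace
    using f compactin_empty zero_closed zero_less_one by blast
qed (auto simp: kSOT_def topology_generated_by_topspace)

lemma limitin_kSOT_iff:
  "limitin (kSOT X H) f g F \<longleftrightarrow>
     g \<in> op_functions X H \<and> (\<forall>\<^sub>F a in F. f a \<in> op_functions X H) \<and>
     (\<forall>K \<xi>. compactin X K \<longrightarrow> \<xi> \<in> vecs H \<longrightarrow>
        ((\<lambda>a. SUP x\<in>K. ennreal (vdist H (f a x \<xi>) (g x \<xi>))) \<longlongrightarrow> 0) F)"
  (is "?L \<longleftrightarrow> ?R")
proof
  assume L: ?L
  then have g: "g \<in> op_functions X H"
    by (simp add: limitin_def topspace_kSOT)
  have ev: "\<forall>\<^sub>F a in F. f a \<in> op_functions X H"
    using L openin_topspace[of "kSOT X H"] by (auto simp: limitin_def topspace_kSOT)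
  have "((\<lambda>a. sup_dist H K \<xi> (f a) g) \<longlongrightarrow> 0) F" if K: "compactin X K" "\<xi> \<in> vecs H" for K \<xi>
  proof (rule order_tendstoI)
    fix e :: ennreal
    assume "0 < e"
    then obtain d where d: "0 < d" "ennreal d < e"
      by (metis dense ennreal_less_zero_iff ennreal_cases less_top_ennreal
          not_less_iff_gr_or_eq order_less_trans top_greatest not_le)
    let ?B = "{h \<in> op_functions X H. sup_dist H K \<xi> h g < ennreal d}"
    have "openin (kSOT X H) ?B"
      unfolding kSOT_def by (rule topology_generated_by_Basis) (use g K d in blast)
    moreover have "g \<in> ?B"
      using g K d by (simp add: sup_dist_self)
    ultimately have "\<forall>\<^sub>F a in F. f a \<in> ?B"
      by (rule limitinD[OF L])
    then show "\<forall>\<^sub>F a in F. sup_dist H K \<xi> (f a) g < e"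
      by (rule eventually_mono) (use d in auto)
  qed simp
  then show ?R
    using g ev by (auto simp: sup_dist_def)
next
  assume R: ?R
  have "\<forall>\<^sub>F a in F. f a \<in> V" if "openin (kSOT X H) V" "g \<in> V" for V
    using that(1)[unfolded kSOT_def openin_topology_generated_by_iff] that(2)
  proof (induction rule: generate_topology_on.induct)
    case (Int a b)
    then show ?case
      by (auto intro: eventually_conj)
  next
    case (UN KK)
    then obtain k where "k \<in> KK" "\<forall>\<^sub>F a in F. f a \<in> k"
      by blast
    then show ?case
      by (auto elim: eventually_mono)
  next
    case (Basis s)
    then obtain h K \<xi> e where s: "s = {g \<in> op_functions X H. sup_dist H K \<xi> g h < ennreal e}"
      and h: "h \<in> op_functions X H" and K: "compactin X K" and \<xi>: "\<xi> \<in> vecs H"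
      by blast
    have less: "sup_dist H K \<xi> g h < ennreal e" and g: "g \<in> op_functions X H"
      using Basis s by auto
    have "((\<lambda>a. sup_dist H K \<xi> (f a) g) \<longlongrightarrow> 0) F"
      using R K \<xi> by (simp add: sup_dist_def)
    then have "((\<lambda>a. sup_dist H K \<xi> (f a) g + sup_dist H K \<xi> g h) \<longlongrightarrow> 0 + sup_dist H K \<xi> g h) F"
      by (intro tendsto_add tendsto_const)
    then have "\<forall>\<^sub>F a in F. sup_dist H K \<xi> (f a) g + sup_dist H K \<xi> g h < ennreal e"
      using less by (simp add: order_tendstoD(2))
    moreover have "\<forall>\<^sub>F a in F. f a \<in> op_functions X H"
      using R by simp
    ultimately show ?case
      by eventually_elim
        (use sup_dist_triangle[OF K \<xi> _ g h] s in \<open>auto intro: order_le_less_trans\<close>)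
  qed simp
  then show ?L
    using R by (simp add: limitin_def topspace_kSOT)
qed

text \<open>The additional assumption always holds, since adjoints of bounded operators are bounded.\<close>

lemma limitin_kSOT_star_iff:
  assumes "(\<lambda>x. adj H H (g x)) \<in> op_functions X H"
  shows "limitin (kSOT_star X H) f g F \<longleftrightarrow>
     limitin (kSOT X H) f g F \<and>
     limitin (kSOT X H) (\<lambda>a x. adj H H (f a x)) (\<lambda>x. adj H H (g x)) F"
  (is "?L \<longleftrightarrow> ?R")
proof
  assume L: ?L
  have top: "topspace (kSOT_star X H) = op_functions X H"
    unfolding kSOT_star_def topology_generated_by_topspace
    using openin_subset[of "kSOT X H"] openin_topspace[of "kSOT X H"]
    by (fastforce simp: topspace_kSOT)
  have 1: "\<forall>\<^sub>F a in F. f a \<in> V" if "openin (kSOT X H) V" "g \<in> V" for V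
  proof -
    have "openin (kSOT_star X H) V"
      unfolding kSOT_star_def by (rule topology_generated_by_Basis) (use that in blast)
    then show ?thesis
      using L that by (simp add: limitin_def)
  qed
  have g: "g \<in> op_functions X H"
    using L top by (simp add: limitin_def)
  have 2: "\<forall>\<^sub>F a in F. (\<lambda>x. adj H H (f a x)) \<in> V"
    if "openin (kSOT X H) V" "(\<lambda>x. adj H H (g x)) \<in> V" for V
  proof -
    let ?W = "{h \<in> op_functions X H. (\<lambda>x. adj H H (h x)) \<in> V}"
    have "openin (kSOT_star X H) ?W"
      unfolding kSOT_star_def by (rule topology_generated_by_Basis) (use that in blast)
    then have "\<forall>\<^sub>F a in F. f a \<in> ?W"
      by (rule limitinD[OF L]) (use that g in simp)
    then show ?thesis
      by (rule eventually_mono) simp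
  qed
  show ?R
    using 1 2 g assms by (simp add: limitin_def topspace_kSOT)
next
  assume R: ?R
  have top: "g \<in> op_functions X H" "\<forall>\<^sub>F a in F. f a \<in> op_functions X H"
    using R openin_topspace[of "kSOT X H"] by (auto simp: limitin_def topspace_kSOT)
  have "\<forall>\<^sub>F a in F. f a \<in> V" if "openin (kSOT_star X H) V" "g \<in> V" for V
    using that(1)[unfolded kSOT_star_def openin_topology_generated_by_iff] that(2)
  proof (induction rule: generate_topology_on.induct)
    case (Int a b)
    then show ?case
      by (auto intro: eventually_conj)
  next
    case (UN KK)
    then obtain k where "k \<in> KK" "\<forall>\<^sub>F a in F. f a \<in> k"
      by blast
    then show ?case
      by (auto elim: eventually_mono)
  next
    case (Basis s)
    then consider "openin (kSOT X H) s"
      | V where "openin (kSOT X H) V" "s = {h \<in> op_functions X H. (\<lambda>x. adj H H (h x)) \<in> V}"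
      by blast
    then show ?case
    proof cases
      case 1
      then show ?thesis
        using R Basis by (simp add: limitin_def)
    next
      case (2 V)
      then have "\<forall>\<^sub>F a in F. (\<lambda>x. adj H H (f a x)) \<in> V"
        using R Basis by (simp add: limitin_def)
      then show ?thesis
        using top(2) by eventually_elim (simp add: 2)
    qed
  qed simp
  moreover have "g \<in> topspace (kSOT_star X H)"
  proof -
    have "openin (kSOT_star X H) (op_functions X H)"
      unfolding kSOT_star_def
      by (rule topology_generated_by_Basis) (use openin_topspace[of "kSOT X H"] in \<open>simp add: topspace_kSOT\<close>)
    then show ?thesis
      using openin_subset top(1) by blast
  qed
  ultimately show ?L
    by (simp add: limitin_def)
qed

end

end

theory Submission
  imports Defs
begin

text \<open>
  One half of the equivalence holds for every unitary dilation: \<open>T(t) = r\<^sup>* U(t) r\<close> and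
  \<open>T(t)\<^sup>* = r\<^sup>* U(-t) r\<close>, so that continuity of \<open>U\<close> in \<open>\<Omega>\<close> passes to \<open>T\<close> and to its adjoints
  (\<open>semigroup_limit_from_dilation_group\<close>). For the other half the dilations of the single
  semigroups have to live on one space and to depend continuously on the semigroups and their
  adjoints. They are obtained from the cogenerators.

  The Laplace transform \<open>R = \<integral> exp (-t) T(t) dt\<close> is the resolvent at 1 of the generator of a
  semigroup, and \<open>C = 1 - 2 R\<close>, the cogenerator, is a contraction without nonzero fixed vector.
  Schaeffer's matrix, with the entries \<open>C\<close>, \<open>C\<^sup>*\<close> and the square roots of \<open>1 - C\<^sup>* C\<close> and
  \<open>1 - C C\<^sup>*\<close>, dilates \<open>C\<close> to a unitary \<open>V\<close> on a space that only depends on the Hilbert space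
  of \<open>T\<close>. The square roots are absolutely convergent binomial series, hence \<open>V\<close> depends strongly
  continuously on \<open>C\<close> and \<open>C\<^sup>*\<close> (\<open>schaeffer_tendsto\<close>), and these depend strongly continuously
  on \<open>T\<close> and its adjoints (\<open>Laplace_tendsto\<close>, \<open>adjoint_Laplace_tendsto\<close>). Again \<open>V\<close> has no
  nonzero fixed vector, and so it is the cogenerator of a unitary group
  (\<open>flow_resolvent\<close> in \<open>fixpoint_free_unitary\<close>). This group is the dilation of \<open>T\<close>.

  The comparison of semigroups rests on one estimate, \<open>Duhamel_bound\<close>, in terms of their
  resolvents at 1. It yields that a semigroup is determined by its
  resolvent and inherits intertwining relations from it (\<open>resolvent_intertwine\<close>), and also that
  strong convergence of the resolvents implies strong convergence of the semigroups, uniformly on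
  compact sets of times (\<open>Trotter_Kato\<close>). The latter, applied to \<open>V\<close> and to its inverse, gives
  the continuity of \<open>U\<close> (\<open>dilation_group_limit\<close>).

  That products over different parameters are dilated as well is due to a subspace that is the
  same for all parameters: the vectors \<open>(0, x, b)\<close> of the Schaeffer space. It is invariant under
  all \<open>U(t)\<close> with \<open>t \<ge> 0\<close>, and there \<open>U(t)\<close> acts on the component \<open>x\<close> as \<open>T(t)\<close>
  (\<open>dilation_group_invariant\<close>, \<open>dilation_group_compress\<close>). So the compression of a product can
  be computed factor by factor (\<open>word_product_compress\<close>).
\<close>


section \<open>Orthogonality, the Riesz representation and adjoints\<close>

instance complex_hilbert \<subseteq> banach ..

text \<open>A minimising sequence is Cauchy by the parallelogram law, because the midpoint of two of its
  members lies in \<open>M\<close> and is therefore at least as long as the infimum.\<close>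

lemma minimal_norm_exists:
  fixes M :: "'a::complex_hilbert set"
  assumes "closed M" "convex M" "M \<noteq> {}"
  shows "\<exists>z\<in>M. \<forall>y\<in>M. norm z \<le> norm y"
proof -
  define d where "d = Inf (norm ` M)"
  have bdd: "bdd_below (norm ` M)"
    by (rule bdd_belowI[of _ 0]) auto
  have d: "d \<le> norm y" if "y \<in> M" for y
    unfolding d_def using bdd that by (simp add: cInf_lower)
  have d0: "0 \<le> d"
    unfolding d_def using assms(3) by (intro cInf_greatest) auto
  have "\<exists>z\<in>M. norm z < d + 1 / (real n + 1)" for n
    using cInf_lessD[of "norm ` M" "d + 1 / (real n + 1)"] assms(3) by (auto simp: d_def)
  then obtain z where z: "\<And>n. z n \<in> M" "\<And>n. norm (z n) < d + 1 / (real n + 1)"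
    by metis
  have tend: "(\<lambda>n. d + 1 / (real n + 1)) \<longlonglongrightarrow> d + 0"
    by (intro tendsto_add tendsto_const LIMSEQ_inverse_real_of_nat[unfolded inverse_eq_divide of_nat_Suc add.commute[of 1]])
  have par: "(norm (a - b))\<^sup>2 \<le> 2 * (norm a)\<^sup>2 + 2 * (norm b)\<^sup>2 - 4 * d\<^sup>2" if "a \<in> M" "b \<in> M" for a b
  proof -
    have "(1/2) *\<^sub>R a + (1/2) *\<^sub>R b \<in> M"
      using that assms(2) by (intro convexD) auto
    from d[OF this] have "d \<le> norm ((1/2) *\<^sub>R (a + b))"
      by (simp add: scaleR_add_right)
    then have "2 * d \<le> norm (a + b)" by simp
    then have "(2 * d)\<^sup>2 \<le> (norm (a + b))\<^sup>2"
      using d0 by (intro power_mono) auto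
    then show ?thesis
      unfolding power2_norm_eq_inner power_mult_distrib
      by (simp add: inner_diff_left inner_diff_right inner_add_left inner_add_right inner_commute)
  qed
  have "Cauchy z"
  proof (rule metric_CauchyI)
    fix e :: real assume e: "e > 0"
    have "(\<lambda>n. 4 * (d + 1 / (real n + 1))\<^sup>2 - 4 * d\<^sup>2) \<longlonglongrightarrow> 4 * (d + 0)\<^sup>2 - 4 * d\<^sup>2"
      by (intro tendsto_intros tend)
    then have "\<forall>\<^sub>F n in sequentially. 4 * (d + 1 / (real n + 1))\<^sup>2 - 4 * d\<^sup>2 < e\<^sup>2"
      by (rule order_tendstoD(2)) (use e in simp)
    then obtain N where N: "4 * (d + 1 / (real N + 1))\<^sup>2 - 4 * d\<^sup>2 < e\<^sup>2"
      by (auto simp: eventually_sequentially)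
    have le: "(norm (z n))\<^sup>2 \<le> (d + 1 / (real N + 1))\<^sup>2" if "n \<ge> N" for n
    proof (rule power_mono)
      have "1 / (real n + 1) \<le> 1 / (real N + 1)"
        using that by (intro divide_left_mono) auto
      with z(2)[of n] show "norm (z n) \<le> d + 1 / (real N + 1)" by linarith
    qed simp
    show "\<exists>N. \<forall>m\<ge>N. \<forall>n\<ge>N. dist (z m) (z n) < e"
    proof (intro exI allI impI)
      fix m n assume "N \<le> m" "N \<le> n"
      then have "(norm (z m - z n))\<^sup>2 < e\<^sup>2"
        using par[OF z(1) z(1), of m n] le[of m] le[of n] N by linarith
      then show "dist (z m) (z n) < e"
        using e by (simp add: dist_norm power_less_imp_less_base)
    qed
  qed
  then obtain l where l: "z \<longlonglongrightarrow> l"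
    using Cauchy_convergent convergent_def by blast
  have "l \<in> M"
    using assms(1) z(1) l closed_sequentially by blast
  moreover have "norm l \<le> d"
  proof (rule tendsto_le[OF _ _ tendsto_norm[OF l]])
    show "(\<lambda>n. d + 1 / (real n + 1)) \<longlonglongrightarrow> d" using tend by simp
    show "\<forall>\<^sub>F n in sequentially. norm (z n) \<le> d + 1 / (real n + 1)"
      using z(2) by (auto intro: always_eventually less_imp_le)
  qed simp
  ultimately show ?thesis
    using d order_trans by blast
qed

lemma minimal_norm_orthogonal:
  fixes z m :: "'a::real_inner"
  assumes "\<And>t. norm z \<le> norm (z + t *\<^sub>R m)"
  shows "inner z m = 0"
proof (cases "m = 0")
  case False
  \<comment> \<open>The minimum of the quadratic polynomial in \<open>t\<close>.\<close>
  let ?t = "- inner z m / inner m m"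
  have "(norm z)\<^sup>2 \<le> (norm (z + ?t *\<^sub>R m))\<^sup>2"
    using assms by (intro power_mono norm_ge_zero)
  also have "\<dots> = (norm z)\<^sup>2 + 2 * ?t * inner z m + ?t\<^sup>2 * inner m m"
  proof -
    have "(norm (z + t *\<^sub>R m))\<^sup>2 = (norm z)\<^sup>2 + 2 * t * inner z m + t\<^sup>2 * inner m m" for t
      unfolding power2_norm_eq_inner
      by (simp add: inner_add_left inner_add_right inner_commute power2_eq_square)
    then show ?thesis .
  qed
  also have "\<dots> = (norm z)\<^sup>2 - (inner z m)\<^sup>2 / inner m m"
    using False by (simp add: power2_eq_square field_simps)
  finally have "(inner z m)\<^sup>2 / inner m m \<le> 0" by simp
  moreover have "inner m m > 0" using False by simp
  ultimately have "(inner z m)\<^sup>2 \<le> 0"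
    by (simp add: divide_le_0_iff)
  then show ?thesis by simp
qed simp

lemma closure_of_subspace:
  fixes M :: "'a::real_normed_vector set"
  assumes "subspace M"
  shows "subspace (closure M)"
proof (rule subspaceI)
  show "0 \<in> closure M"
    using subspace_0[OF assms] closure_subset by blast
  show "x + y \<in> closure M" if xy: "x \<in> closure M" "y \<in> closure M" for x y
  proof -
    obtain f where "\<And>n. f n \<in> M" "f \<longlonglongrightarrow> x"
      using xy(1) unfolding closure_sequential by auto
    moreover obtain g where "\<And>n. g n \<in> M" "g \<longlonglongrightarrow> y"
      using xy(2) unfolding closure_sequential by auto
    ultimately have "\<And>n. f n + g n \<in> M" "(\<lambda>n. f n + g n) \<longlonglongrightarrow> x + y"
      using assms by (auto intro: subspace_add tendsto_add)
    then show ?thesis unfolding closure_sequential by (intro exI conjI allI)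
  qed
  show "c *\<^sub>R x \<in> closure M" if x: "x \<in> closure M" for c x
  proof -
    obtain f where "\<And>n. f n \<in> M" "f \<longlonglongrightarrow> x"
      using x unfolding closure_sequential by auto
    then have "\<And>n. c *\<^sub>R f n \<in> M" "(\<lambda>n. c *\<^sub>R f n) \<longlonglongrightarrow> c *\<^sub>R x"
      using assms by (auto intro: subspace_scale tendsto_scaleR)
    then show ?thesis unfolding closure_sequential by (intro exI conjI allI)
  qed
qed

text \<open>The shortest vector of the translate \<open>x + closure M\<close> is orthogonal to \<open>M\<close>, hence zero.\<close>

lemma dense_if_orthogonal_trivial:
  fixes M :: "'a::complex_hilbert set"
  assumes M: "subspace M" and orth: "\<And>y. (\<And>m. m \<in> M \<Longrightarrow> inner y m = 0) \<Longrightarrow> y = 0"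
  shows "closure M = UNIV"
proof (intro equalityI subsetI UNIV_I)
  fix x :: 'a
  let ?A = "(+) x ` closure M"
  have sub: "subspace (closure M)"
    using M by (rule closure_of_subspace)
  have "closed ?A" "convex ?A" "?A \<noteq> {}"
    using sub subspace_0[OF M] closure_subset[of M]
    by (auto intro: closed_translation convex_translation subspace_imp_convex)
  then obtain z where z: "z \<in> ?A" "\<And>y. y \<in> ?A \<Longrightarrow> norm z \<le> norm y"
    using minimal_norm_exists by metis
  then obtain c where c: "c \<in> closure M" "z = x + c" by blast
  have "inner z m = 0" if "m \<in> M" for m
  proof (rule minimal_norm_orthogonal)
    fix t
    have "c + t *\<^sub>R m \<in> closure M"
      using that c sub closure_subset by (intro subspace_add subspace_scale) auto
    then show "norm z \<le> norm (z + t *\<^sub>R m)"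
      using z(2) c by (simp add: add.assoc)
  qed
  then have "z = 0" by (rule orth)
  then have "x = - c" using c(2) by (simp add: eq_neg_iff_add_eq_0)
  then show "x \<in> closure M" using c(1) sub by (simp add: subspace_neg)
qed

text \<open>The shortest vector of the hyperplane \<open>f = 1\<close> is orthogonal to the kernel of \<open>f\<close>; a multiple of
  it represents \<open>f\<close>.\<close>

lemma Riesz_representation:
  fixes f :: "'a::complex_hilbert \<Rightarrow> real"
  assumes f: "bounded_linear f"
  shows "\<exists>z. \<forall>x. f x = inner x z"
proof (cases "\<forall>x. f x = 0")
  case True
  then show ?thesis by (intro exI[of _ 0]) simp
next
  case False
  interpret f: bounded_linear f by fact
  let ?A = "{x. f x = 1}"
  obtain x0 where "f x0 \<noteq> 0" using False by blast
  then have "(1 / f x0) *\<^sub>R x0 \<in> ?A" by (simp add: f.scaleR)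
  moreover have "closed ?A"
    by (intro closed_Collect_eq continuous_intros f.continuous_on)
  moreover have "convex ?A"
    by (auto simp: convex_def f.add f.scaleR simp flip: distrib_right)
  ultimately obtain z where z: "f z = 1" "\<And>y. f y = 1 \<Longrightarrow> norm z \<le> norm y"
    using minimal_norm_exists[of ?A] by blast
  have orth: "inner z m = 0" if "f m = 0" for m
    by (rule minimal_norm_orthogonal) (simp add: z f.add f.scaleR that)
  have "z \<noteq> 0" using z(1) f.zero by auto
  have "f x = inner x ((1 / inner z z) *\<^sub>R z)" for x
  proof -
    have "inner z (x - f x *\<^sub>R z) = 0"
      by (rule orth) (simp add: f.diff f.scaleR z)
    then show ?thesis using \<open>z \<noteq> 0\<close> by (simp add: inner_diff_right inner_commute)
  qed
  then show ?thesis by blast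
qed

text \<open>\<open>adjoint A\<close> is by definition some function with this property, if there is one. By the Riesz
  representation there is one on every Hilbert space.\<close>

lemma adjoint_inner:
  fixes A :: "'a::complex_hilbert \<Rightarrow> 'b::complex_hilbert"
  assumes A: "bounded_linear A"
  shows "inner (A x) y = inner x (adjoint A y)"
proof -
  interpret A: bounded_linear A by fact
  have "\<exists>z. \<forall>x. inner (A x) y = inner x z" for y
    by (rule Riesz_representation)
      (rule bounded_linear_compose[OF bounded_linear_inner_left A, unfolded o_def])
  then have "\<exists>A'. \<forall>x y. inner (A x) y = inner x (A' y)" by metis
  then show ?thesis unfolding adjoint_def by (rule someI2_ex) auto
qed

lemma adjoint_eqI:
  fixes A :: "'a::complex_hilbert \<Rightarrow> 'b::complex_hilbert"
  assumes "bounded_linear A" "\<And>x. inner (A x) y = inner x z"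
  shows "adjoint A y = z"
  using assms by (metis adjoint_inner vector_eq_ldot)

definition contraction :: "('a::real_normed_vector \<Rightarrow> 'b::real_normed_vector) \<Rightarrow> bool" where
  "contraction A \<longleftrightarrow> linear A \<and> (\<forall>x. norm (A x) \<le> norm x)"

lemma contraction_bounded_linear: "contraction A \<Longrightarrow> bounded_linear A"
  unfolding contraction_def
  by (intro bounded_linear_intro[where K=1]) (auto simp: linear_add linear_scale)

lemma contraction_adjoint:
  fixes A :: "'a::complex_hilbert \<Rightarrow> 'b::complex_hilbert"
  assumes A: "contraction A"
  shows "contraction (adjoint A)"
proof -
  note bl = contraction_bounded_linear[OF A]
  have "linear (adjoint A)"
  proof
    show "adjoint A (x + y) = adjoint A x + adjoint A y" for x y
      by (rule adjoint_eqI[OF bl]) (simp add: inner_add_right adjoint_inner[OF bl])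
    show "adjoint A (c *\<^sub>R x) = c *\<^sub>R adjoint A x" for c x
      by (rule adjoint_eqI[OF bl]) (simp add: adjoint_inner[OF bl])
  qed
  moreover have "norm (adjoint A y) \<le> norm y" for y
  proof (cases "adjoint A y = 0")
    case False
    have "(norm (adjoint A y))\<^sup>2 = inner (A (adjoint A y)) y"
      by (simp add: adjoint_inner[OF bl] power2_norm_eq_inner)
    also have "\<dots> \<le> norm (adjoint A y) * norm y"
      using A by (intro order_trans[OF norm_cauchy_schwarz]) (auto simp: contraction_def intro: mult_right_mono)
    finally show ?thesis using False by (simp add: power2_eq_square)
  qed simp
  ultimately show ?thesis by (simp add: contraction_def)
qed


section \<open>The unital Banach algebra of operators\<close>

text \<open>The unitization of the algebra of bounded operators: \<open>(A, c)\<close> stands for \<open>A + c\<close>. Its unit is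
  nonzero even if the underlying space is trivial, so that it is a unital Banach algebra, with
  power series and exponentials, over every Banach space. The function \<open>act\<close> represents it on the
  space; \<open>op_of\<close> embeds the bounded operators.\<close>

typedef (overloaded) 'a operator = "UNIV :: (('a::banach \<Rightarrow>\<^sub>L 'a) \<times> real) set" ..

setup_lifting type_definition_operator

instantiation operator :: (banach) real_vector
begin
lift_definition zero_operator :: "'a operator" is "(0, 0)" .
lift_definition plus_operator :: "'a operator \<Rightarrow> 'a operator \<Rightarrow> 'a operator" is "(+)" .
lift_definition minus_operator :: "'a operator \<Rightarrow> 'a operator \<Rightarrow> 'a operator" is "(-)" .
lift_definition uminus_operator :: "'a operator \<Rightarrow> 'a operator" is "uminus" .
lift_definition scaleR_operator :: "real \<Rightarrow> 'a operator \<Rightarrow> 'a operator" is "scaleR" .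
instance
  by standard (transfer; simp add: zero_prod_def[symmetric] algebra_simps)+
end

instantiation operator :: (banach) real_normed_vector
begin
lift_definition norm_operator :: "'a operator \<Rightarrow> real" is "\<lambda>(A, c). norm A + \<bar>c\<bar>" .
definition dist_operator :: "'a operator \<Rightarrow> 'a operator \<Rightarrow> real" where "dist_operator a b = norm (a - b)"
definition sgn_operator :: "'a operator \<Rightarrow> 'a operator" where "sgn_operator a = a /\<^sub>R norm a"
definition uniformity_operator :: "('a operator \<times> 'a operator) filter" where
  "uniformity_operator = (INF e\<in>{0<..}. principal {(x, y). dist x y < e})"
definition open_operator :: "'a operator set \<Rightarrow> bool" where
  "open_operator S = (\<forall>x\<in>S. \<forall>\<^sub>F (x', y) in uniformity. x' = x \<longrightarrow> y \<in> S)"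
instance
proof
  fix a b :: "'a operator" and r :: real
  show "norm a = 0 \<longleftrightarrow> a = 0"
    by transfer (auto simp: add_nonneg_eq_0_iff)
  show "norm (a + b) \<le> norm a + norm b"
    by transfer (auto intro!: order_trans[OF add_mono[OF norm_triangle_ineq abs_triangle_ineq]])
  show "norm (r *\<^sub>R a) = \<bar>r\<bar> * norm a"
    by transfer (auto simp: abs_mult algebra_simps)
qed (simp_all add: dist_operator_def sgn_operator_def uniformity_operator_def open_operator_def)
end

instantiation operator :: (banach) real_normed_algebra_1
begin
lift_definition one_operator :: "'a operator" is "(0, 1)" .
lift_definition times_operator :: "'a operator \<Rightarrow> 'a operator \<Rightarrow> 'a operator" is
  "\<lambda>(A, c) (B, d). ((A o\<^sub>L B) + c *\<^sub>R B + d *\<^sub>R A, c * d)" .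
instance
proof
  fix a b c :: "'a operator" and r :: real
  show "a * b * c = a * (b * c)"
    by transfer (auto intro!: blinfun_eqI simp: blinfun.bilinear_simps algebra_simps)
  show "1 * a = a" "a * 1 = a"
    by (transfer; auto intro!: blinfun_eqI simp: blinfun.bilinear_simps)+
  show "(a + b) * c = a * c + b * c" "a * (b + c) = a * b + a * c"
    by (transfer; auto intro!: blinfun_eqI simp: blinfun.bilinear_simps algebra_simps)+
  show "r *\<^sub>R a * b = r *\<^sub>R (a * b)" "a * r *\<^sub>R b = r *\<^sub>R (a * b)"
    by (transfer; auto intro!: blinfun_eqI simp: blinfun.bilinear_simps algebra_simps)+
  show "(0 :: 'a operator) \<noteq> 1"
    by transfer simp
  show "norm (1 :: 'a operator) = 1"
    by transfer simp
  show "norm (a * b) \<le> norm a * norm b"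
  proof (transfer, clarsimp)
    fix A B :: "'a \<Rightarrow>\<^sub>L 'a" and c d :: real
    have "norm ((A o\<^sub>L B) + c *\<^sub>R B + d *\<^sub>R A) \<le> norm (A o\<^sub>L B) + norm (c *\<^sub>R B) + norm (d *\<^sub>R A)"
      by (intro order_trans[OF norm_triangle_ineq] add_mono norm_triangle_ineq order_refl)
    also have "\<dots> \<le> norm A * norm B + \<bar>c\<bar> * norm B + \<bar>d\<bar> * norm A"
      by (intro add_mono norm_blinfun_compose) auto
    finally show "norm ((A o\<^sub>L B) + c *\<^sub>R B + d *\<^sub>R A) + \<bar>c * d\<bar> \<le> (norm A + \<bar>c\<bar>) * (norm B + \<bar>d\<bar>)"
      by (simp add: abs_mult algebra_simps)
  qed
qed
end

instance operator :: (banach) banach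
proof
  fix X :: "nat \<Rightarrow> 'a operator"
  assume X: "Cauchy X"
  define A where "A n = fst (Rep_operator (X n))" for n
  define c where "c n = snd (Rep_operator (X n))" for n
  have d: "dist (X m) (X n) = dist (A m) (A n) + dist (c m) (c n)" for m n
    unfolding A_def c_def dist_norm by transfer (simp add: case_prod_beta)
  have "Cauchy A" "Cauchy c"
    unfolding Cauchy_def
    by (intro allI impI; drule metric_CauchyD[OF X]; force simp: d intro: order_le_less_trans[rotated])+
  then obtain A' c' where lim: "A \<longlonglongrightarrow> A'" "c \<longlonglongrightarrow> c'"
    using Cauchy_convergent convergent_def by metis
  have d': "dist (X n) (Abs_operator (A', c')) = dist (A n) A' + dist (c n) c'" for n
    unfolding A_def c_def dist_norm
    by transfer (simp add: case_prod_beta)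
  have "(\<lambda>n. dist (A n) A' + dist (c n) c') \<longlonglongrightarrow> 0 + 0"
    using lim by (intro tendsto_add) (simp_all flip: tendsto_dist_iff)
  then have "X \<longlonglongrightarrow> Abs_operator (A', c')"
    unfolding tendsto_dist_iff[of X] d' by simp
  then show "convergent X" unfolding convergent_def by blast
qed

lift_definition act :: "'a::banach operator \<Rightarrow> 'a \<Rightarrow> 'a" is
  "\<lambda>(A, c) x. blinfun_apply A x + c *\<^sub>R x" .

lift_definition op_of :: "('a::banach \<Rightarrow> 'a) \<Rightarrow> 'a operator" is "\<lambda>f. (Blinfun f, 0)" .

lemma act_op_of: "bounded_linear f \<Longrightarrow> act (op_of f) = f"
  by transfer (auto simp: bounded_linear_Blinfun_apply)

lemma act_one: "act 1 x = x" by transfer simp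

lemma act_mult: "act (a * b) x = act a (act b x)"
  by transfer (auto simp: blinfun.bilinear_simps algebra_simps)

lemma norm_act: "norm (act a x) \<le> norm a * norm x"
  by transfer
    (auto simp: distrib_right intro!: order_trans[OF norm_triangle_ineq] add_mono norm_blinfun)

lemma act_add_left: "act (a + b) x = act a x + act b x"
  by transfer (auto simp: blinfun.bilinear_simps algebra_simps)

lemma act_scaleR_left: "act (r *\<^sub>R a) x = r *\<^sub>R act a x"
  by transfer (auto simp: blinfun.bilinear_simps algebra_simps)

lemma act_diff_left: "act (a - b) x = act a x - act b x"
  by transfer (auto simp: blinfun.bilinear_simps algebra_simps)

lemma act_add_right: "act a (x + y) = act a x + act a y"
  by transfer (auto simp: blinfun.bilinear_simps algebra_simps)

lemma act_scaleR_right: "act a (r *\<^sub>R x) = r *\<^sub>R act a x"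
  by transfer (auto simp: blinfun.bilinear_simps algebra_simps)

lemma bounded_linear_act: "bounded_linear (\<lambda>a. act a x)"
  by (rule bounded_linear_intro[where K="norm x"])
    (simp_all add: act_add_left act_scaleR_left norm_act)

lemma bounded_linear_act_right: "bounded_linear (act a)"
  by (rule bounded_linear_intro[where K="norm a"])
    (simp_all add: act_add_right act_scaleR_right norm_act mult.commute[of "norm _" "norm a"])

lemma act_power: "act (a ^ n) x = (act a ^^ n) x"
  by (induction n arbitrary: x) (simp_all add: act_one act_mult funpow_swap1)

lemma norm_op_of_le:
  assumes "bounded_linear f" "\<And>x. norm (f x) \<le> norm x"
  shows "norm (op_of f) \<le> 1"
  using assms
  by transfer (auto intro!: norm_blinfun_bound simp: bounded_linear_Blinfun_apply)

lemma op_of_mult: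
  assumes "bounded_linear f" "bounded_linear g"
  shows "op_of f * op_of g = op_of (\<lambda>x. f (g x))"
  using assms
  by transfer (auto intro!: blinfun_eqI simp: bounded_linear_Blinfun_apply bounded_linear_compose)

lemma exp_act_has_vector_derivative:
  "((\<lambda>t. act (exp (t *\<^sub>R b)) x) has_vector_derivative act (exp (t *\<^sub>R b)) (act b x)) (at t within I)"
proof -
  have "((\<lambda>t. exp (t *\<^sub>R b)) has_vector_derivative exp (t *\<^sub>R b) * b) (at t within I)"
    by (rule exp_scaleR_has_vector_derivative_right)
  from bounded_linear.has_vector_derivative[OF bounded_linear_act this, of x]
  show ?thesis by (simp add: act_mult)
qed


section \<open>Square roots by the binomial series\<close>

text \<open>The coefficients of the power series of \<open>sqrt (1 - z)\<close>.\<close>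

definition root_coeff :: "nat \<Rightarrow> real" where
  "root_coeff n = (-1) ^ n * ((1/2) gchoose n)"

lemma root_coeff_0: "root_coeff 0 = 1"
  by (simp add: root_coeff_def)

lemma root_coeff_Suc: "root_coeff (Suc n) = root_coeff n * ((real n - 1/2) / real (Suc n))"
proof -
  have *: "((1/2::real) gchoose Suc n) = (1/2 gchoose n) * ((1/2 - real n) / real (Suc n))"
    using gbinomial_mult_1[of "1/2::real" n] by (simp add: field_simps)
  show ?thesis unfolding root_coeff_def power_Suc * by (simp add: field_simps)
qed

lemma root_coeff_nonpos: "root_coeff (Suc n) \<le> 0"
proof (induction n)
  case 0
  show ?case by (simp add: root_coeff_Suc root_coeff_0)
next
  case (Suc n)
  show ?case
    by (subst root_coeff_Suc, rule mult_nonpos_nonneg[OF Suc]) simp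
qed

text \<open>All coefficients except the first are nonpositive, so the partial sums of
  \<open>\<bar>root_coeff k\<bar> * r ^ k\<close> are bounded by \<open>2 - sqrt (1 - r)\<close> for \<open>0 < r < 1\<close>; let \<open>r\<close> tend to 1.
  This summability on the boundary of the disc allows the series to be evaluated at every
  contraction.\<close>

lemma summable_root_coeff: "summable (\<lambda>n. \<bar>root_coeff n\<bar>)"
proof (rule bounded_imp_summable)
  fix n
  have bound: "(\<Sum>k\<le>n. \<bar>root_coeff k\<bar> * r ^ k) \<le> 2" if r: "0 < r" "r < 1" for r :: real
  proof -
    have sums: "(\<lambda>k. root_coeff k * r ^ k) sums sqrt (1 - r)"
      using sqrt_series[of "- r"] r by (simp add: root_coeff_def power_minus[of r] mult_ac)
    have eq: "\<bar>root_coeff k\<bar> * r ^ k = 2 * (if k = 0 then 1 else 0) - root_coeff k * r ^ k" for k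
      using root_coeff_nonpos[of "k - 1"] by (cases k) (auto simp: root_coeff_0)
    have "(\<lambda>k. if k = 0 then 1 else 0) sums (1::real)"
      using sums_single[of 0 "\<lambda>_. 1::real"] by simp
    then have "(\<lambda>k. \<bar>root_coeff k\<bar> * r ^ k) sums (2 * 1 - sqrt (1 - r))"
      unfolding eq by (intro sums_diff sums_mult sums)
    then have "(\<Sum>k\<le>n. \<bar>root_coeff k\<bar> * r ^ k) \<le> 2 * 1 - sqrt (1 - r)"
      using r sum_le_suminf[of "\<lambda>k. \<bar>root_coeff k\<bar> * r ^ k" "{..n}"] by (simp add: sums_iff)
    also have "\<dots> \<le> 2" using r by simp
    finally show ?thesis .
  qed
  have "((\<lambda>r. \<Sum>k\<le>n. \<bar>root_coeff k\<bar> * r ^ k) \<longlongrightarrow> (\<Sum>k\<le>n. \<bar>root_coeff k\<bar> * 1 ^ k)) (at_left 1)"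
    by (intro tendsto_intros)
  moreover have "\<forall>\<^sub>F r in at_left 1. (\<Sum>k\<le>n. \<bar>root_coeff k\<bar> * r ^ k) \<le> 2"
    using eventually_at_left_field[of _ "1::real"] bound
    by (auto intro: exI[of _ 0])
  ultimately show "(\<Sum>k\<le>n. \<bar>root_coeff k\<bar>) \<le> 2"
    by (intro tendsto_le[OF _ tendsto_const[of 2]]) auto
qed simp

text \<open>Vandermonde's identity: the square of the series is \<open>1 - z\<close>.\<close>

lemma root_coeff_convolution:
  "(\<Sum>i\<le>n. root_coeff i * root_coeff (n - i)) = (if n = 0 then 1 else if n = 1 then -1 else 0)"
proof -
  have "(\<Sum>i\<le>n. root_coeff i * root_coeff (n - i)) =
      (\<Sum>i\<le>n. (-1) ^ n * ((1/2 gchoose i) * (1/2 gchoose (n - i))))"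
  proof (intro sum.cong refl)
    fix i assume "i \<in> {..n}"
    then have "(-1::real) ^ n = (-1) ^ i * (-1) ^ (n - i)"
      by (simp flip: power_add)
    then show "root_coeff i * root_coeff (n - i) = (-1) ^ n * ((1/2 gchoose i) * (1/2 gchoose (n - i)))"
      unfolding root_coeff_def by simp
  qed
  also have "\<dots> = (-1) ^ n * (1 gchoose n)"
    using gbinomial_Vandermonde[of "1/2::real" "1/2" n]
    by (simp add: atLeast0AtMost flip: sum_distrib_left)
  also have "(1::real) gchoose n = of_nat (1 choose n)"
    using binomial_gbinomial[of 1 n, where 'a=real] by simp
  finally show ?thesis
    by (cases n) (auto simp: binomial_eq_0)
qed

lemma contraction_compose:
  assumes "contraction X" "contraction Y"
  shows "contraction (\<lambda>x. X (Y x))"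
proof -
  have "norm (X (Y x)) \<le> norm x" for x
    using assms order_trans[of "norm (X (Y x))" "norm (Y x)" "norm x"] by (auto simp: contraction_def)
  then show ?thesis
    using assms linear_compose[of Y X] by (auto simp: contraction_def o_def)
qed

lemma contraction_power:
  fixes X :: "'a::real_normed_vector \<Rightarrow> 'a"
  assumes "contraction X"
  shows "contraction (X ^^ n)"
proof (induction n)
  case 0
  show ?case using bounded_linear.linear[OF bounded_linear_ident] by (simp add: contraction_def id_def)
next
  case (Suc n)
  show ?case
    using contraction_compose[OF assms Suc] by (simp add: o_def)
qed

definition root_one_minus :: "('a::banach \<Rightarrow> 'a) \<Rightarrow> 'a \<Rightarrow> 'a" where
  "root_one_minus X = act (\<Sum>n. root_coeff n *\<^sub>R op_of X ^ n)"

context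
  fixes X :: "'a::banach \<Rightarrow> 'a"
  assumes X: "contraction X"
begin

lemma summable_root_series: "summable (\<lambda>n. norm (root_coeff n *\<^sub>R op_of X ^ n))"
proof (rule summable_comparison_test'[OF summable_root_coeff])
  fix n
  have "norm (op_of X) \<le> 1"
    using X by (intro norm_op_of_le contraction_bounded_linear) (auto simp: contraction_def)
  then have "norm (op_of X ^ n) \<le> 1"
    using norm_power_ineq[of "op_of X" n] power_le_one[of "norm (op_of X)" n] by simp
  then have "\<bar>root_coeff n\<bar> * norm (op_of X ^ n) \<le> \<bar>root_coeff n\<bar> * 1"
    by (intro mult_left_mono) auto
  then show "norm (norm (root_coeff n *\<^sub>R op_of X ^ n)) \<le> \<bar>root_coeff n\<bar>"
    by simp
qed

lemma bounded_linear_root: "bounded_linear (root_one_minus X)"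
  unfolding root_one_minus_def by (rule bounded_linear_act_right)

lemma root_sums: "(\<lambda>n. root_coeff n *\<^sub>R (X ^^ n) x) sums root_one_minus X x"
proof -
  have "(\<lambda>n. root_coeff n *\<^sub>R op_of X ^ n) sums (\<Sum>n. root_coeff n *\<^sub>R op_of X ^ n)"
    by (rule summable_sums, rule summable_norm_cancel, rule summable_root_series)
  from bounded_linear.sums[OF bounded_linear_act this, of x]
  show ?thesis
    unfolding root_one_minus_def act_scaleR_left act_power act_op_of[OF contraction_bounded_linear[OF X]] .
qed

lemma root_root: "root_one_minus X (root_one_minus X x) = x - X x"
proof -
  let ?r = "\<Sum>n. root_coeff n *\<^sub>R op_of X ^ n"
  have "(\<lambda>n. \<Sum>i\<le>n. (root_coeff i *\<^sub>R op_of X ^ i) * (root_coeff (n - i) *\<^sub>R op_of X ^ (n - i))) sums (?r * ?r)"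
    by (rule Cauchy_product_sums) (rule summable_root_series)+
  moreover have "(\<Sum>i\<le>n. (root_coeff i *\<^sub>R op_of X ^ i) * (root_coeff (n - i) *\<^sub>R op_of X ^ (n - i))) =
      (if n = 0 then 1 else if n = 1 then -1 else 0) *\<^sub>R op_of X ^ n" for n
    unfolding root_coeff_convolution[symmetric] scaleR_sum_left
    by (intro sum.cong refl) (simp flip: power_add)
  ultimately have 1: "(\<lambda>n. (if n = 0 then 1 else if n = 1 then -1 else 0) *\<^sub>R op_of X ^ n) sums (?r * ?r)"
    by simp
  have "(\<lambda>n. (if n = 0 then 1 else if n = 1 then -1 else 0) *\<^sub>R op_of X ^ n) sums
      (\<Sum>n\<in>{0,1}. (if n = 0 then 1 else if n = 1 then -1 else 0) *\<^sub>R op_of X ^ n)"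
    by (rule sums_finite) auto
  with 1 have "?r * ?r = 1 - op_of X"
    by (simp add: sums_iff)
  then have "act ?r (act ?r x) = act (1 - op_of X) x"
    by (simp flip: act_mult)
  then show ?thesis
    by (simp add: root_one_minus_def act_one act_op_of contraction_bounded_linear[OF X] act_diff_left)
qed

end

lemma root_intertwine:
  fixes X :: "'a::banach \<Rightarrow> 'a" and Y :: "'b::banach \<Rightarrow> 'b"
  assumes X: "contraction X" and Y: "contraction Y" and J: "bounded_linear J"
    and JX: "\<And>x. J (X x) = Y (J x)"
  shows "J (root_one_minus X x) = root_one_minus Y (J x)"
proof -
  have p: "J ((X ^^ n) x) = (Y ^^ n) (J x)" for n
    by (induction n) (simp_all add: JX)
  have "(\<lambda>n. J (root_coeff n *\<^sub>R (X ^^ n) x)) sums J (root_one_minus X x)"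
    by (rule bounded_linear.sums[OF J root_sums[OF X]])
  then have "(\<lambda>n. root_coeff n *\<^sub>R (Y ^^ n) (J x)) sums J (root_one_minus X x)"
    by (simp add: p linear_scale[OF bounded_linear.linear[OF J]])
  then show ?thesis
    using root_sums[OF Y, of "J x"] sums_unique2 by blast
qed

lemma root_selfadjoint:
  fixes X :: "'a::complex_hilbert \<Rightarrow> 'a"
  assumes X: "contraction X" and sa: "\<And>x y. inner (X x) y = inner x (X y)"
  shows "inner (root_one_minus X x) y = inner x (root_one_minus X y)"
proof -
  have p: "inner ((X ^^ n) x) y = inner x ((X ^^ n) y)" for n x y
    by (induction n arbitrary: x y) (simp_all add: sa funpow_swap1)
  have "(\<lambda>n. inner (root_coeff n *\<^sub>R (X ^^ n) x) y) sums inner (root_one_minus X x) y"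
    by (rule bounded_linear.sums[OF bounded_linear_inner_left root_sums[OF X]])
  moreover have "(\<lambda>n. inner x (root_coeff n *\<^sub>R (X ^^ n) y)) sums inner x (root_one_minus X y)"
    by (rule bounded_linear.sums[OF bounded_linear_inner_right root_sums[OF X]])
  ultimately show ?thesis
    by (simp add: p sums_unique2)
qed

lemma power_strong_convergence:
  fixes X :: "'w \<Rightarrow> 'a::real_normed_vector \<Rightarrow> 'a"
  assumes Xa: "\<forall>\<^sub>F a in F. contraction (X a)" 
    and lim: "\<And>x. ((\<lambda>a. X a x) \<longlongrightarrow> Y x) F"
  shows "((\<lambda>a. (X a ^^ n) x) \<longlongrightarrow> (Y ^^ n) x) F"
proof (induction n)
  case (Suc n)
  have "((\<lambda>a. norm ((X a ^^ n) x - (Y ^^ n) x) + norm (X a ((Y ^^ n) x) - Y ((Y ^^ n) x))) \<longlongrightarrow> 0 + 0) F"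
    using Suc lim by (intro tendsto_add tendsto_norm_zero LIM_zero)
  then have "((\<lambda>a. (X a ^^ Suc n) x - (Y ^^ Suc n) x) \<longlongrightarrow> 0) F"
    unfolding add_0
  proof (rule Lim_null_comparison[rotated])
    show "\<forall>\<^sub>F a in F. norm ((X a ^^ Suc n) x - (Y ^^ Suc n) x) \<le>
        norm ((X a ^^ n) x - (Y ^^ n) x) + norm (X a ((Y ^^ n) x) - Y ((Y ^^ n) x))"
      using Xa
    proof eventually_elim
      case (elim a)
      have "(X a ^^ Suc n) x - (Y ^^ Suc n) x =
          X a ((X a ^^ n) x - (Y ^^ n) x) + (X a ((Y ^^ n) x) - Y ((Y ^^ n) x))"
        using elim by (simp add: contraction_def linear_diff)
      also have "norm \<dots> \<le> norm ((X a ^^ n) x - (Y ^^ n) x) + norm (X a ((Y ^^ n) x) - Y ((Y ^^ n) x))"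
        using elim by (intro order_trans[OF norm_triangle_ineq] add_mono) (auto simp: contraction_def)
      finally show ?case .
    qed
  qed
  then show ?case by (simp add: LIM_zero_iff)
qed simp

text \<open>The single powers converge strongly, and they are dominated by the summable sequence of
  coefficients, uniformly in the index \<open>a\<close>.\<close>

lemma root_strong_convergence:
  fixes X :: "'w \<Rightarrow> 'a::banach \<Rightarrow> 'a"
  assumes Xa: "\<forall>\<^sub>F a in F. contraction (X a)" and Y: "contraction Y"
    and lim: "\<And>x. ((\<lambda>a. X a x) \<longlongrightarrow> Y x) F"
  shows "((\<lambda>a. root_one_minus (X a) x) \<longlongrightarrow> root_one_minus Y x) F"
proof (cases "F = bot")
  case False
  let ?d = "\<lambda>k a. \<bar>root_coeff k\<bar> * norm ((X a ^^ k) x - (Y ^^ k) x)"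
  have bound: "norm (?d k a) \<le> \<bar>root_coeff k\<bar> * (2 * norm x)" if "contraction (X a)" for k a
  proof -
    have "norm ((X a ^^ k) x - (Y ^^ k) x) \<le> norm x + norm x"
      using contraction_power[OF that, of k] contraction_power[OF Y, of k]
      by (intro order_trans[OF norm_triangle_ineq4] add_mono) (auto simp: contraction_def)
    then show ?thesis by (simp add: mult_left_mono)
  qed
  have sum: "summable (\<lambda>k. \<bar>root_coeff k\<bar> * (2 * norm x))"
    by (intro summable_mult2 summable_root_coeff)
  have "((\<lambda>a. suminf (\<lambda>k. ?d k a)) \<longlongrightarrow> suminf (\<lambda>k. \<bar>root_coeff k\<bar> * norm ((Y ^^ k) x - (Y ^^ k) x))) F"
  proof (rule tannerys_theorem[THEN conjunct2, THEN conjunct2])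
    show "((\<lambda>a. ?d k a) \<longlongrightarrow> \<bar>root_coeff k\<bar> * norm ((Y ^^ k) x - (Y ^^ k) x)) F" for k
      by (intro tendsto_intros power_strong_convergence Xa lim)
    show "\<forall>\<^sub>F (k, a) in at_top \<times>\<^sub>F F. norm (?d k a) \<le> \<bar>root_coeff k\<bar> * (2 * norm x)"
      using eventually_prodI[OF eventually_True[of at_top] Xa]
      by (rule eventually_mono) (use bound in auto)
  qed (use sum False in auto)
  then have "((\<lambda>a. suminf (\<lambda>k. ?d k a)) \<longlongrightarrow> 0) F" by simp
  then have "((\<lambda>a. root_one_minus (X a) x - root_one_minus Y x) \<longlongrightarrow> 0) F"
  proof (rule Lim_null_comparison[rotated])
    show "\<forall>\<^sub>F a in F. norm (root_one_minus (X a) x - root_one_minus Y x) \<le> suminf (\<lambda>k. ?d k a)"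
      using Xa
    proof eventually_elim
      case (elim a)
      have s: "summable (\<lambda>k. ?d k a)"
        by (rule summable_comparison_test'[OF sum]) (use bound[OF elim] in auto)
      have "(\<lambda>k. root_coeff k *\<^sub>R ((X a ^^ k) x - (Y ^^ k) x)) sums (root_one_minus (X a) x - root_one_minus Y x)"
        unfolding scaleR_diff_right by (intro sums_diff root_sums elim Y)
      then have "norm (root_one_minus (X a) x - root_one_minus Y x) =
          norm (\<Sum>k. root_coeff k *\<^sub>R ((X a ^^ k) x - (Y ^^ k) x))"
        by (simp add: sums_iff)
      also have "\<dots> \<le> (\<Sum>k. norm (root_coeff k *\<^sub>R ((X a ^^ k) x - (Y ^^ k) x)))"
        by (rule summable_norm) (use s in simp)
      finally show ?case by simp
    qed
  qed
  then show ?thesis by (simp add: LIM_zero_iff)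
qed simp


section \<open>Semigroups determined by their resolvent at one\<close>

text \<open>The properties of the resolvent \<open>R\<close> at 1 of a dissipative generator \<open>A\<close> in terms of the
  cogenerator \<open>1 - 2 R\<close>, the Cayley transform of \<open>A\<close>.\<close>

definition dissipative_resolvent :: "('a::real_normed_vector \<Rightarrow> 'a) \<Rightarrow> bool" where
  "dissipative_resolvent R \<longleftrightarrow>
     bounded_linear R \<and> contraction (\<lambda>x. x - 2 *\<^sub>R R x) \<and> (\<forall>x. R x = 0 \<longrightarrow> x = 0)"

lemma dissipative_resolvent_norm:
  assumes "dissipative_resolvent R"
  shows "norm (R x) \<le> norm x"
proof -
  have "norm (2 *\<^sub>R R x) = norm (x - (x - 2 *\<^sub>R R x))" by simp
  also have "\<dots> \<le> norm x + norm (x - 2 *\<^sub>R R x)" by (rule norm_triangle_ineq4)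
  also have "\<dots> \<le> norm x + norm x"
    using assms by (simp add: dissipative_resolvent_def contraction_def)
  finally show ?thesis by simp
qed

lemma dissipative_resolvent_contraction:
  assumes R: "dissipative_resolvent R"
  shows "contraction R"
  unfolding contraction_def
proof (intro conjI allI)
  show "linear R"
    using R by (intro bounded_linear.linear) (simp add: dissipative_resolvent_def)
  show "norm (R x) \<le> norm x" for x
    using R by (rule dissipative_resolvent_norm)
qed

lemma dissipative_resolvent_cancel:
  assumes R: "dissipative_resolvent R" and eq: "R a = R b"
  shows "a = b"
proof -
  have "R (a - b) = 0"
    using eq linear_diff[of R a b] dissipative_resolvent_contraction[OF R] by (simp add: contraction_def)
  then have "a - b = 0" using R unfolding dissipative_resolvent_def by blast
  then show ?thesis by simp
qed

text \<open>Since \<open>A (R x) = R x - x\<close>, this is the inequality \<open>inner y (A y) \<le> 0\<close> for \<open>y = R x\<close>.\<close>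

lemma dissipative_resolvent_inner:
  fixes R :: "'a::real_inner \<Rightarrow> 'a"
  assumes "dissipative_resolvent R"
  shows "inner (R x) (R x - x) \<le> 0"
proof -
  have "(norm (x - 2 *\<^sub>R R x))\<^sup>2 \<le> (norm x)\<^sup>2"
    using assms by (intro power_mono) (auto simp: dissipative_resolvent_def contraction_def)
  then show ?thesis
    unfolding power2_norm_eq_inner
    by (simp add: inner_diff_left inner_diff_right inner_commute)
qed

lemma dissipative_resolventI:
  fixes R :: "'a::real_inner \<Rightarrow> 'a"
  assumes "linear R" "\<And>x. inner (R x) (R x - x) \<le> 0" "\<And>x. R x = 0 \<Longrightarrow> x = 0"
  shows "dissipative_resolvent R"
proof -
  have n: "norm (x - 2 *\<^sub>R R x) \<le> norm x" for x
  proof (rule power2_le_imp_le)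
    show "(norm (x - 2 *\<^sub>R R x))\<^sup>2 \<le> (norm x)\<^sup>2"
      using assms(2)[of x] unfolding power2_norm_eq_inner
      by (simp add: inner_diff_left inner_diff_right inner_commute)
  qed simp
  have "linear (\<lambda>x. x - 2 *\<^sub>R R x)"
    using assms(1) by (auto intro!: linearI simp: linear_add linear_scale algebra_simps)
  with n have c: "contraction (\<lambda>x. x - 2 *\<^sub>R R x)"
    by (simp add: contraction_def)
  have "norm (R x) \<le> norm x * 1" for x
  proof -
    have "norm (2 *\<^sub>R R x) = norm (x - (x - 2 *\<^sub>R R x))" by simp
    also have "\<dots> \<le> norm x + norm (x - 2 *\<^sub>R R x)" by (rule norm_triangle_ineq4)
    finally show ?thesis using n[of x] by simp
  qed
  then have "bounded_linear R"
    using assms(1) by (intro bounded_linear_intro[where K=1]) (auto simp: linear_add linear_scale)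
  with c assms(3) show ?thesis by (simp add: dissipative_resolvent_def)
qed

text \<open>If \<open>y\<close> is orthogonal to the range, then \<open>inner (R y) y = 0\<close>, and dissipativity leaves only
  \<open>R y = 0\<close>.\<close>

lemma dense_range_resolvent:
  fixes R :: "'a::complex_hilbert \<Rightarrow> 'a"
  assumes R: "dissipative_resolvent R"
  shows "closure (range R) = UNIV"
proof (rule dense_if_orthogonal_trivial)
  show "subspace (range R)"
    using R by (intro linear_subspace_image bounded_linear.linear) (auto simp: dissipative_resolvent_def)
  fix y assume "\<And>m. m \<in> range R \<Longrightarrow> inner y m = 0"
  then have "inner y (R y) = 0" by blast
  then have "inner (R y) y = 0" by (simp add: inner_commute)
  with dissipative_resolvent_inner[OF R, of y] have "inner (R y) (R y) \<le> 0"
    by (simp add: inner_diff_right)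
  then have "R y = 0" by (meson inner_gt_zero_iff not_le)
  then show "y = 0" using R by (simp add: dissipative_resolvent_def)
qed

lemma dense_range_resolvent_square:
  fixes R :: "'a::complex_hilbert \<Rightarrow> 'a"
  assumes R: "dissipative_resolvent R"
  shows "closure (range (\<lambda>x. R (R x))) = UNIV"
proof -
  have "continuous_on UNIV R"
    using R by (simp add: dissipative_resolvent_def linear_continuous_on)
  then have "R ` closure (range R) \<subseteq> closure (R ` range R)"
    by (intro image_closure_subset closure_subset closed_closure) (rule continuous_on_subset, auto)
  then have "range R \<subseteq> closure (range (\<lambda>x. R (R x)))"
    by (simp add: dense_range_resolvent[OF R] image_image)
  then show ?thesis
    using dense_range_resolvent[OF R] closure_mono[of "range R" "closure (range (\<lambda>x. R (R x)))"]
    by auto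
qed

lemma contraction_diff: "contraction A \<Longrightarrow> norm (A x - A y) \<le> norm (x - y)"
  using linear_diff[of A x y] unfolding contraction_def by metis

text \<open>The last condition says that \<open>R x\<close> lies in the domain of the generator \<open>A\<close> of \<open>S\<close> and that
  \<open>A (R x) = R x - x\<close>. In this form all statements about generators are statements about bounded
  operators.\<close>

definition resolvent_at_one :: "(real \<Rightarrow> 'a \<Rightarrow> 'a::real_normed_vector) \<Rightarrow> ('a \<Rightarrow> 'a) \<Rightarrow> bool" where
  "resolvent_at_one S R \<longleftrightarrow>
     (\<forall>t\<ge>0. contraction (S t)) \<and> (\<forall>x. S 0 x = x) \<and> (\<forall>x. continuous_on {0..} (\<lambda>t. S t x)) \<and>
     dissipative_resolvent R \<and> (\<forall>t\<ge>0. \<forall>x. R (S t x) = S t (R x)) \<and>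
     (\<forall>x. \<forall>t\<ge>0. ((\<lambda>t. S t (R x)) has_vector_derivative S t (R x - x)) (at t within {0..}))"

text \<open>A product rule for operators that are merely strongly differentiable; that they are contractions
  replaces the continuity of a bilinear map.\<close>

lemma has_vector_derivative_apply:
  fixes A :: "real \<Rightarrow> 'a::real_normed_vector \<Rightarrow> 'b::real_normed_vector"
  assumes y: "(y has_vector_derivative y') (at s within I)" and s: "s \<in> I"
    and A: "\<And>r. r \<in> I \<Longrightarrow> contraction (A r)"
    and cont: "((\<lambda>r. A r y') \<longlongrightarrow> A s y') (at s within I)"
    and d: "((\<lambda>r. A r (y s)) has_vector_derivative d) (at s within I)"
  shows "((\<lambda>r. A r (y r)) has_vector_derivative (A s y' + d)) (at s within I)"
proof -
  let ?q1 = "\<lambda>r. (1 / norm (r - s)) *\<^sub>R (y r - (y s + (r - s) *\<^sub>R y'))"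
  let ?q2 = "\<lambda>r. (1 / norm (r - s)) *\<^sub>R (A r (y s) - (A s (y s) + (r - s) *\<^sub>R d))"
  let ?q = "\<lambda>r. (1 / norm (r - s)) *\<^sub>R (A r (y r) - (A s (y s) + (r - s) *\<^sub>R (A s y' + d)))"
  have 1: "(?q1 \<longlongrightarrow> 0) (at s within I)"
    using y unfolding has_vector_derivative_def has_derivative_within by blast
  have 2: "(?q2 \<longlongrightarrow> 0) (at s within I)"
    using d unfolding has_vector_derivative_def has_derivative_within by blast
  have "((\<lambda>r. norm (?q1 r) + norm (?q2 r) + norm (A r y' - A s y')) \<longlongrightarrow> 0 + 0 + 0) (at s within I)"
    using 1 2 cont by (intro tendsto_add tendsto_norm_zero LIM_zero)
  then have "(?q \<longlongrightarrow> 0) (at s within I)"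
    unfolding add_0
  proof (rule Lim_null_comparison[rotated])
    show "\<forall>\<^sub>F r in at s within I. norm (?q r) \<le> norm (?q1 r) + norm (?q2 r) + norm (A r y' - A s y')"
      unfolding eventually_at_filter
    proof (intro always_eventually allI impI)
      fix r assume r: "r \<noteq> s" "r \<in> I"
      note lin = A[OF r(2), unfolded contraction_def, THEN conjunct1]
      let ?z = "A r (y r - (y s + (r - s) *\<^sub>R y')) + (A r (y s) - (A s (y s) + (r - s) *\<^sub>R d)) +
          (r - s) *\<^sub>R (A r y' - A s y')"
      have z: "A r (y r) - (A s (y s) + (r - s) *\<^sub>R (A s y' + d)) = ?z"
        by (simp add: linear_diff[OF lin] linear_add[OF lin] linear_scale[OF lin] algebra_simps)
      have z': "(1 / norm (r - s)) *\<^sub>R ?z = A r (?q1 r) + ?q2 r + ((r - s) / norm (r - s)) *\<^sub>R (A r y' - A s y')"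
        by (simp add: linear_scale[OF lin] scaleR_add_right)
      have "norm (?q r) \<le> norm (A r (?q1 r)) + norm (?q2 r) + norm (((r - s) / norm (r - s)) *\<^sub>R (A r y' - A s y'))"
        unfolding z z' by (rule order_trans[OF norm_triangle_ineq add_right_mono[OF norm_triangle_ineq]])
      moreover have "norm (A r (?q1 r)) \<le> norm (?q1 r)"
        using A[OF r(2)] unfolding contraction_def by blast
      moreover have "norm (((r - s) / norm (r - s)) *\<^sub>R (A r y' - A s y')) = norm (A r y' - A s y')"
        using r(1) by simp
      ultimately show "norm (?q r) \<le> norm (?q1 r) + norm (?q2 r) + norm (A r y' - A s y')"
        by linarith
    qed
  qed
  then show ?thesis
    unfolding has_vector_derivative_def has_derivative_within
    by (intro conjI bounded_linear_scaleR_left)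
qed

lemma vector_mean_value_inequality:
  fixes f :: "real \<Rightarrow> 'a::real_normed_vector"
  assumes f: "\<And>s. s \<in> {0..t} \<Longrightarrow> (f has_vector_derivative f' s) (at s within {0..t})"
    and B: "\<And>s. s \<in> {0..t} \<Longrightarrow> norm (f' s) \<le> B" and t: "0 \<le> t"
  shows "norm (f t - f 0) \<le> B * t"
proof -
  have "norm (f t - f 0) \<le> B * norm (t - 0)"
  proof (rule differentiable_bound[where S="{0..t}" and f'="\<lambda>s h. h *\<^sub>R f' s"])
    fix s assume s: "s \<in> {0..t}"
    then show "(f has_derivative (\<lambda>h. h *\<^sub>R f' s)) (at s within {0..t})"
      using f by (simp add: has_vector_derivative_def)
    show "onorm (\<lambda>h. h *\<^sub>R f' s) \<le> B"
    proof (rule onorm_le)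
      show "norm (h *\<^sub>R f' s) \<le> B * norm h" for h
        using mult_left_mono[OF B[OF s], of "norm h"] by (simp add: mult.commute)
    qed
  qed (use t in auto)
  then show ?thesis using t by simp
qed

text \<open>The path \<open>s \<mapsto> S' (t - s) (R' (J (R (S s x))))\<close> connects the two sides. It is differentiable because
  both resolvents map into the domains of the generators, and in its derivative
  \<open>S' (t - s) (J (R (S s x)) - R' (J (S s x)))\<close> the generators have disappeared.\<close>

lemma Duhamel_bound:
  assumes SR: "resolvent_at_one S R" and SR': "resolvent_at_one S' R'"
    and J: "bounded_linear J" and t: "0 \<le> t"
    and B: "\<And>s. s \<in> {0..t} \<Longrightarrow> norm (J (R (S s x)) - R' (J (S s x))) \<le> B"
  shows "norm (R' (J (S t (R x))) - S' t (R' (J (R x)))) \<le> B * t"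
proof -
  have S: "contraction (S s)" and S': "contraction (S' s)" if "s \<ge> 0" for s
    using that SR SR' by (auto simp: resolvent_at_one_def)
  have linR': "bounded_linear R'" and linR: "bounded_linear R"
    using SR SR' by (auto simp: resolvent_at_one_def dissipative_resolvent_def)
  have comm: "R (S s x) = S s (R x)" if "s \<ge> 0" for s x
    using that SR by (simp add: resolvent_at_one_def)
  have comm': "R' (S' s x) = S' s (R' x)" if "s \<ge> 0" for s x
    using that SR' by (simp add: resolvent_at_one_def)
  let ?y = "\<lambda>s. J (S s (R x))"
  let ?f = "\<lambda>s. S' (t - s) (R' (?y s))"
  let ?f' = "\<lambda>s. S' (t - s) (J (R (S s x)) - R' (J (S s x)))"
  have "norm (?f t - ?f 0) \<le> B * t"
  proof (rule vector_mean_value_inequality[OF _ _ t])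
    fix s assume s: "s \<in> {0..t}"
    show "norm (?f' s) \<le> B"
    proof -
      have "norm (?f' s) \<le> norm (J (R (S s x)) - R' (J (S s x)))"
        using S'[of "t - s"] s by (simp add: contraction_def)
      then show ?thesis using B[OF s] by simp
    qed
    let ?A = "\<lambda>r y. S' (t - r) (R' y)"
    have A: "contraction (?A r)" if "r \<in> {0..t}" for r
    proof (rule contraction_compose[OF S'])
      show "contraction R'"
        using SR' by (simp add: resolvent_at_one_def dissipative_resolvent_contraction)
    qed (use that in auto)
    have "((\<lambda>s. S s (R x)) has_vector_derivative S s (R x - x)) (at s within {0..})"
      using SR s by (simp add: resolvent_at_one_def)
    then have "((\<lambda>s. S s (R x)) has_vector_derivative S s (R x - x)) (at s within {0..t})"
      by (rule has_vector_derivative_within_subset) auto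
    from bounded_linear.has_vector_derivative[OF J this]
    have y: "(?y has_vector_derivative J (S s (R x - x))) (at s within {0..t})" .
    have dA: "((\<lambda>r. ?A r y) has_vector_derivative - S' (t - s) (R' y - y)) (at s within {0..t})" for y
    proof -
      have 1: "((\<lambda>r. t - r) has_vector_derivative -1) (at s within {0..t})"
        by (auto intro!: derivative_eq_intros)
      have "((\<lambda>r. S' r (R' y)) has_vector_derivative S' (t - s) (R' y - y)) (at (t - s) within {0..})"
        using SR' s by (simp add: resolvent_at_one_def)
      then have 2: "((\<lambda>r. S' r (R' y)) has_vector_derivative S' (t - s) (R' y - y)) (at (t - s) within ((\<lambda>r. t - r) ` {0..t}))"
        by (rule has_vector_derivative_within_subset) auto
      show ?thesis
        using vector_diff_chain_within[OF 1 2] by (simp add: o_def)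
    qed
    have c: "((\<lambda>r. ?A r z) \<longlongrightarrow> ?A s z) (at s within {0..t})" for z
      using has_vector_derivative_continuous[OF dA] by (simp add: continuous_within)
    have "(?f has_vector_derivative ?A s (J (S s (R x - x))) + (- S' (t - s) (R' (?y s) - ?y s))) (at s within {0..t})"
      by (rule has_vector_derivative_apply[OF y s A c dA])
    moreover have "?A s (J (S s (R x - x))) + (- S' (t - s) (R' (?y s) - ?y s)) = ?f' s"
    proof -
      have l: "linear (S' (t - s))" "linear (S s)" "linear J" "linear R'"
        using S S' s J linR' by (auto simp: contraction_def bounded_linear.linear)
      show ?thesis
        using s by (simp add: comm linear_diff[OF l(1)] linear_diff[OF l(2)] linear_diff[OF l(3)] linear_diff[OF l(4)])
    qed
    ultimately show "(?f has_vector_derivative ?f' s) (at s within {0..t})" by simp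
  qed
  moreover have "S 0 z = z" "S' 0 z' = z'" for z z'
    using SR SR' by (simp_all add: resolvent_at_one_def)
  ultimately show ?thesis by simp
qed

text \<open>Duhamel's bound vanishes if \<open>J\<close> intertwines the resolvents along the orbit of \<open>x\<close>; the remaining
  factors \<open>R'\<close> are cancelled by injectivity.\<close>

lemma resolvent_intertwine:
  assumes SR: "resolvent_at_one S R" and SR': "resolvent_at_one S' R'"
    and J: "bounded_linear J" and t: "0 \<le> t"
    and M: "\<And>s. s \<ge> 0 \<Longrightarrow> J (R (S s x)) = R' (J (S s x))"
  shows "J (S t x) = S' t (J x)"
proof -
  have "norm (R' (J (S t (R x))) - S' t (R' (J (R x)))) \<le> 0 * t"
    by (rule Duhamel_bound[OF SR SR' J t]) (simp add: M)
  then have "R' (J (S t (R x))) = S' t (R' (J (R x)))" by simp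
  moreover have "S t (R x) = R (S t x)" "S 0 x = x"
    using SR t by (simp_all add: resolvent_at_one_def)
  moreover have "S' t (R' z) = R' (S' t z)" for z
    using SR' t by (simp add: resolvent_at_one_def)
  ultimately have *: "R' (R' (J (S t x))) = R' (R' (S' t (J x)))"
    using M[of t] M[of 0] t by simp
  have "dissipative_resolvent R'" using SR' by (simp add: resolvent_at_one_def)
  from dissipative_resolvent_cancel[OF this dissipative_resolvent_cancel[OF this *]]
  show ?thesis .
qed

text \<open>Here no semigroup acts on the target of \<open>J\<close>. Instead, the dissipativity of \<open>R'\<close> shows that the
  norm of \<open>J (S s (R x)) = R' (J (S s x))\<close> does not increase with \<open>s\<close>.\<close>

lemma resolvent_kernel_invariant:
  fixes J :: "'a::real_normed_vector \<Rightarrow> 'b::real_inner"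
  assumes SR: "resolvent_at_one S R" and R': "dissipative_resolvent R'"
    and J: "bounded_linear J" and JR: "\<And>x. J (R x) = R' (J x)"
    and x: "J x = 0" and t: "0 \<le> t"
  shows "J (S t x) = 0"
proof -
  let ?g = "\<lambda>s. J (S s (R x))"
  have comm: "S s (R x) = R (S s x)" if "s \<ge> 0" for s
    using that SR by (simp add: resolvent_at_one_def)
  have d: "(?g has_vector_derivative J (S s (R x - x))) (at s within {0..})" if "s \<ge> 0" for s
    using that SR by (intro bounded_linear.has_vector_derivative[OF J]) (simp add: resolvent_at_one_def)
  have "inner (?g t) (?g t) \<le> inner (?g 0) (?g 0)"
  proof (rule DERIV_nonpos_imp_decreasing_open[OF t])
    fix s assume s: "0 < s" "s < t"
    have "(?g has_vector_derivative J (S s (R x - x))) (at s)"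
      using d[of s] s by (simp add: at_within_interior[of s "{0..}"])
    then have "((\<lambda>s. inner (?g s) (?g s)) has_vector_derivative
        inner (?g s) (J (S s (R x - x))) + inner (J (S s (R x - x))) (?g s)) (at s)"
      unfolding has_vector_derivative_def
      by (auto intro!: derivative_eq_intros simp: distrib_left)
    moreover have "J (S s (R x - x)) = R' (J (S s x)) - J (S s x)" "?g s = R' (J (S s x))"
      using s SR J comm[of s] JR[of "S s x"]
      by (simp_all add: resolvent_at_one_def contraction_def linear_diff bounded_linear.linear)
    ultimately show "\<exists>y. DERIV (\<lambda>s. inner (?g s) (?g s)) s :> y \<and> y \<le> 0"
      using dissipative_resolvent_inner[OF R', of "J (S s x)"]
      by (auto simp: has_real_derivative_iff_has_vector_derivative inner_commute)
  next
    have "continuous_on {0..} ?g"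
      using has_vector_derivative_continuous[OF d] by (simp add: continuous_on_eq_continuous_within)
    then have "continuous_on {0..t} ?g" by (rule continuous_on_subset) auto
    then show "continuous_on {0..t} (\<lambda>s. inner (?g s) (?g s))" by (intro continuous_intros)
  qed
  moreover have "?g 0 = 0"
    using SR R' x by (simp add: resolvent_at_one_def JR dissipative_resolvent_def bounded_linear.linear linear_0)
  ultimately have "inner (?g t) (?g t) \<le> 0" by simp
  then have "?g t = 0" by (meson inner_gt_zero_iff not_le)
  then have "R' (J (S t x)) = 0" using comm[OF t] by (simp add: JR)
  then show ?thesis using R' by (simp add: dissipative_resolvent_def)
qed

lemma strong_convergence_uniform_on_compact:
  fixes L :: "'w \<Rightarrow> 'a::real_normed_vector \<Rightarrow> 'b::real_normed_vector"
  assumes K: "compact K" and L: "\<forall>\<^sub>F a in F. linear (L a) \<and> (\<forall>x. norm (L a x) \<le> M * norm x)"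
    and lim: "\<And>y. ((\<lambda>a. L a y) \<longlongrightarrow> 0) F" and e: "e > 0"
  shows "\<forall>\<^sub>F a in F. \<forall>y\<in>K. norm (L a y) < e"
proof -
  define d where "d = e / (2 * (\<bar>M\<bar> + 1))"
  have d: "d > 0" using e by (simp add: d_def)
  have Md: "\<bar>M\<bar> * d < e / 2"
    using e by (simp add: d_def field_simps)
  obtain N where N: "finite N" "N \<subseteq> K" "K \<subseteq> (\<Union>x\<in>N. ball x d)"
    using compactE_image[OF K, of K "\<lambda>x. ball x d"] d by force
  have "\<forall>\<^sub>F a in F. \<forall>y\<in>N. norm (L a y) < e / 2"
  proof (rule eventually_ball_finite[OF N(1)], rule ballI)
    fix y
    show "\<forall>\<^sub>F a in F. norm (L a y) < e / 2"
      using order_tendstoD(2)[OF tendsto_norm_zero[OF lim[of y]], of "e / 2"] e by simp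
  qed
  with L show ?thesis
  proof eventually_elim
    case (elim a)
    show ?case
    proof
      fix y assume "y \<in> K"
      then obtain z where z: "z \<in> N" "dist z y < d" using N(3) by auto
      have "norm (L a y) = norm (L a (y - z) + L a z)"
        using elim by (simp add: linear_diff)
      also have "\<dots> \<le> norm (L a (y - z)) + norm (L a z)" by (rule norm_triangle_ineq)
      also have "norm (L a (y - z)) \<le> \<bar>M\<bar> * norm (y - z)"
        using elim by (meson abs_ge_self mult_right_mono norm_ge_zero order_trans)
      also have "\<dots> \<le> \<bar>M\<bar> * d"
        using z by (intro mult_left_mono) (auto simp: dist_norm norm_minus_commute)
      finally show "norm (L a y) < e"
        using Md elim z by (smt (verit) field_sum_of_halves)
    qed
  qed
qed

text \<open>On the dense range of \<open>R\<^sup>2\<close>, Duhamel's bound reduces the claim to the convergence of \<open>R' a\<close> to \<open>R\<close>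
  along two orbits of \<open>S\<close>. Over a bounded interval of times these are compact, so that strong
  convergence is uniform on them.\<close>

theorem Trotter_Kato:
  fixes S :: "real \<Rightarrow> 'a::complex_hilbert \<Rightarrow> 'a"
  assumes SR: "resolvent_at_one S R"
    and SRa: "\<forall>\<^sub>F a in F. resolvent_at_one (S' a) (R' a)"
    and lim: "\<And>x. ((\<lambda>a. R' a x) \<longlongrightarrow> R x) F" and e: "e > 0" and T: "0 \<le> T"
  shows "\<forall>\<^sub>F a in F. \<forall>t\<in>{0..T}. norm (S' a t x - S t x) < e"
proof -
  have dR: "dissipative_resolvent R" using SR by (simp add: resolvent_at_one_def)
  have linR: "bounded_linear R" using dR by (simp add: dissipative_resolvent_def)
  have L: "\<forall>\<^sub>F a in F. linear (\<lambda>x. R' a x - R x) \<and> (\<forall>x. norm (R' a x - R x) \<le> 2 * norm x)"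
    using SRa
  proof eventually_elim
    case (elim a)
    then have dR': "dissipative_resolvent (R' a)" by (simp add: resolvent_at_one_def)
    have "norm (R' a x - R x) \<le> 2 * norm x" for x
      using norm_triangle_ineq4[of "R' a x" "R x"] dissipative_resolvent_norm[OF dR, of x]
        dissipative_resolvent_norm[OF dR', of x] by linarith
    moreover have "linear (\<lambda>x. R' a x - R x)"
      using dR dR' by (intro linear_compose_sub bounded_linear.linear) (auto simp: dissipative_resolvent_def)
    ultimately show ?case by simp
  qed
  have lim0: "((\<lambda>a. R' a x - R x) \<longlongrightarrow> 0) F" for x
    using lim by (rule LIM_zero)
  have cpt: "compact ((\<lambda>t. S t y) ` {0..T})" for y
  proof (rule compact_continuous_image)
    have "continuous_on {0..} (\<lambda>t. S t y)" using SR by (simp add: resolvent_at_one_def)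
    then show "continuous_on {0..T} (\<lambda>t. S t y)" by (rule continuous_on_subset) auto
  qed simp
  have unif: "\<forall>\<^sub>F a in F. \<forall>t\<in>{0..T}. norm (R' a (S t y) - R (S t y)) < d" if "d > 0" for y d
    using strong_convergence_uniform_on_compact[OF cpt L lim0 that] by simp
  obtain y where y: "dist (R (R y)) x < e / 4"
  proof -
    have "x \<in> closure (range (\<lambda>x. R (R x)))"
      using dense_range_resolvent_square[OF dR] by simp
    then have "\<forall>d>0. \<exists>y\<in>range (\<lambda>x. R (R x)). dist y x < d"
      by (simp only: closure_approachable)
    then show ?thesis using e that by (auto dest: spec[of _ "e / 4"])
  qed
  \<comment> \<open>Both \<open>d\<close> and \<open>d * T\<close>, the Duhamel term, have to be small.\<close>
  define d where "d = e / (8 * (T + 1))"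
  have d: "d > 0" using e T by (simp add: d_def)
  have dT: "d * T < e / 8" "d \<le> e / 8"
    using e T by (auto simp: d_def field_simps)
  have "\<forall>\<^sub>F a in F. norm (R' a (R y) - R (R y)) < e / 8"
    using order_tendstoD(2)[OF tendsto_norm_zero[OF lim0[of "R y"]], of "e / 8"] e by simp
  with SRa unif[OF d, of y] unif[OF d, of "R y"] show ?thesis
  proof eventually_elim
    case (elim a)
    show ?case
    proof
      fix t assume t: "t \<in> {0..T}"
      have con: "contraction (S t)" "contraction (S' a t)"
        using SR elim(1) t by (auto simp: resolvent_at_one_def)
      have 1: "norm (R' a (S t (R y)) - S' a t (R' a (R y))) \<le> d * T"
      proof -
        have "norm (R' a (S t (R y)) - S' a t (R' a (R y))) \<le> d * t"
          using Duhamel_bound[OF SR elim(1) bounded_linear_ident, of t y d] t elim(2)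
          by (force simp: norm_minus_commute)
        also have "\<dots> \<le> d * T" using t d by simp
        finally show ?thesis .
      qed
      have 2: "norm (R' a (S t (R y)) - S t (R (R y))) < e / 8"
      proof -
        have "R (S t (R y)) = S t (R (R y))" using SR t by (simp add: resolvent_at_one_def)
        then show ?thesis using elim(3)[rule_format, OF t] dT by simp
      qed
      have 3: "norm (S' a t (R' a (R y)) - S' a t (R (R y))) < e / 8"
        using contraction_diff[OF con(2), of "R' a (R y)" "R (R y)"] elim(4) by linarith
      have 4: "norm (S t (R (R y)) - S t x) < e / 4" "norm (S' a t (R (R y)) - S' a t x) < e / 4"
        using contraction_diff[OF con(1), of "R (R y)" x] contraction_diff[OF con(2), of "R (R y)" x] y
        unfolding dist_norm by linarith+
      have tri: "norm (p + q + r + u + v) \<le> norm p + norm q + norm r + norm u + norm v" for p q r u v :: 'a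
        using norm_triangle_ineq[of "p + q + r + u" v] norm_triangle_ineq[of "p + q + r" u]
          norm_triangle_ineq[of "p + q" r] norm_triangle_ineq[of p q] by linarith
      have eq: "S' a t x - S t x = (S' a t x - S' a t (R (R y))) + (S' a t (R (R y)) - S' a t (R' a (R y)))
          + (S' a t (R' a (R y)) - R' a (S t (R y))) + (R' a (S t (R y)) - S t (R (R y))) + (S t (R (R y)) - S t x)"
        by simp
      have "norm (S' a t x - S t x) \<le> norm (S' a t x - S' a t (R (R y))) + norm (S' a t (R (R y)) - S' a t (R' a (R y)))
          + norm (S' a t (R' a (R y)) - R' a (S t (R y))) + norm (R' a (S t (R y)) - S t (R (R y))) + norm (S t (R (R y)) - S t x)"
        unfolding eq by (rule tri)
      also have "\<dots> < e / 4 + e / 8 + d * T + e / 8 + e / 4"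
        using 1 2 3 4 by (simp add: norm_minus_commute)
      also have "\<dots> < e" using dT e by linarith
      finally show "norm (S' a t x - S t x) < e" .
    qed
  qed
qed


section \<open>The resolvent of a contraction semigroup\<close>

definition contraction_semigroup :: "(real \<Rightarrow> 'a \<Rightarrow> 'a::real_normed_vector) \<Rightarrow> bool" where
  "contraction_semigroup T \<longleftrightarrow>
     (\<forall>t\<ge>0. contraction (T t)) \<and> (\<forall>x. T 0 x = x) \<and>
     (\<forall>s\<ge>0. \<forall>t\<ge>0. \<forall>x. T (s + t) x = T s (T t x)) \<and>
     (\<forall>x. continuous_on {0..} (\<lambda>t. T t x))"

definition truncated_Laplace :: "(real \<Rightarrow> 'a \<Rightarrow> 'a::banach) \<Rightarrow> real \<Rightarrow> 'a \<Rightarrow> 'a" where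
  "truncated_Laplace T N x = integral {0..N} (\<lambda>s. exp (- s) *\<^sub>R T s x)"

definition Laplace :: "(real \<Rightarrow> 'a \<Rightarrow> 'a::banach) \<Rightarrow> 'a \<Rightarrow> 'a" where
  "Laplace T x = Lim at_top (\<lambda>N. truncated_Laplace T N x)"

context
  fixes T :: "real \<Rightarrow> 'a::complex_hilbert \<Rightarrow> 'a"
  assumes T: "contraction_semigroup T"
begin

lemma semigroup_contraction: "t \<ge> 0 \<Longrightarrow> contraction (T t)"
  using T by (simp add: contraction_semigroup_def)

lemma semigroup_bounded_linear: "t \<ge> 0 \<Longrightarrow> bounded_linear (T t)"
  by (intro contraction_bounded_linear semigroup_contraction)

lemma semigroup_continuous_on:
  assumes "A \<subseteq> {0..}"
  shows "continuous_on A (\<lambda>t. T t x)"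
proof -
  have "continuous_on {0..} (\<lambda>t. T t x)"
    using T by (simp add: contraction_semigroup_def)
  then show ?thesis using assms by (rule continuous_on_subset)
qed

lemma Laplace_integrand_continuous:
  "A \<subseteq> {0..} \<Longrightarrow> continuous_on A (\<lambda>s. exp (- s) *\<^sub>R T s x)"
  by (intro continuous_intros semigroup_continuous_on)

lemma Laplace_integrand_integrable:
  assumes "0 \<le> M"
  shows "(\<lambda>s. exp (- s) *\<^sub>R T s x) integrable_on {M..N}"
  using assms by (intro integrable_continuous_interval Laplace_integrand_continuous) auto

lemma truncated_Laplace_combine:
  assumes "0 \<le> M" "M \<le> N"
  shows "truncated_Laplace T N x - truncated_Laplace T M x = integral {M..N} (\<lambda>s. exp (- s) *\<^sub>R T s x)"
  unfolding truncated_Laplace_def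
  using Henstock_Kurzweil_Integration.integral_combine[OF assms Laplace_integrand_integrable, of x]
  by (simp add: algebra_simps)

lemma truncated_Laplace_tail:
  assumes "0 \<le> M" "M \<le> N"
  shows "norm (truncated_Laplace T N x - truncated_Laplace T M x) \<le> exp (- M) * norm x"
proof -
  have "((\<lambda>s. exp (- s)) has_integral (- exp (- N) - - exp (- M))) {M..N}"
    by (rule fundamental_theorem_of_calculus[OF assms(2)])
      (auto intro!: derivative_eq_intros simp flip: has_real_derivative_iff_has_vector_derivative)
  then have I: "((\<lambda>s. exp (- s) * norm x) has_integral (exp (- M) - exp (- N)) * norm x) {M..N}"
    using has_integral_mult_left[of "\<lambda>s. exp (- s)" "- exp (- N) - - exp (- M)" "{M..N}" "norm x"] by simp
  have "norm (integral {M..N} (\<lambda>s. exp (- s) *\<^sub>R T s x)) \<le> integral {M..N} (\<lambda>s. exp (- s) * norm x)"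
  proof (rule integral_norm_bound_integral)
    show "(\<lambda>s. exp (- s) *\<^sub>R T s x) integrable_on {M..N}"
      using assms(1) by (rule Laplace_integrand_integrable)
    show "(\<lambda>s. exp (- s) * norm x) integrable_on {M..N}" using I by (rule has_integral_integrable)
    fix s assume "s \<in> {M..N}"
    then show "norm (exp (- s) *\<^sub>R T s x) \<le> exp (- s) * norm x"
      using assms semigroup_contraction[of s] by (simp add: contraction_def)
  qed
  also have "\<dots> = (exp (- M) - exp (- N)) * norm x"
    using I by (rule integral_unique)
  also have "\<dots> \<le> exp (- M) * norm x" by (simp add: mult_right_mono)
  finally show ?thesis using truncated_Laplace_combine[OF assms] by simp
qed

text \<open>The limit exists along the natural numbers, and the estimate of the tails extends it to the reals.\<close>

lemma truncated_Laplace_tendsto: "((\<lambda>N. truncated_Laplace T N x) \<longlongrightarrow> Laplace T x) at_top"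
proof -
  let ?s = "\<lambda>n. truncated_Laplace T (real n) x"
  have "((\<lambda>N. exp (- N) * norm x) \<longlongrightarrow> 0 * norm x) at_top"
    by (intro tendsto_mult tendsto_const filterlim_compose[OF exp_at_bot filterlim_uminus_at_bot_at_top])
  then have e: "((\<lambda>N. exp (- N) * norm x) \<longlongrightarrow> 0) at_top" by simp
  have "Cauchy ?s"
  proof (rule metric_CauchyI)
    fix d :: real assume "d > 0"
    then have "\<forall>\<^sub>F N in at_top. exp (- N) * norm x < d"
      using order_tendstoD(2)[OF e, of d] by simp
    then have "\<forall>\<^sub>F n in sequentially. exp (- real n) * norm x < d"
      by (rule eventually_compose_filterlim[OF _ filterlim_real_sequentially])
    then obtain k where k: "exp (- real k) * norm x < d"
      by (auto simp: eventually_sequentially)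
    have less: "dist (?s m) (?s n) < d" if "k \<le> n" "n \<le> m" for m n
    proof -
      have "exp (- real n) * norm x \<le> exp (- real k) * norm x"
        using that by (intro mult_right_mono) auto
      then show ?thesis
        using truncated_Laplace_tail[of "real n" "real m" x] that k by (simp add: dist_norm)
    qed
    show "\<exists>M. \<forall>m\<ge>M. \<forall>n\<ge>M. dist (?s m) (?s n) < d"
      using less by (metis dist_commute nat_le_linear)
  qed
  then obtain l where l: "?s \<longlonglongrightarrow> l"
    using Cauchy_convergent convergent_def by blast
  have tail: "norm (l - truncated_Laplace T N x) \<le> exp (- N) * norm x" if "N \<ge> 0" for N
  proof (rule tendsto_le[OF _ tendsto_const tendsto_norm[OF tendsto_diff[OF l tendsto_const]]])
    show "\<forall>\<^sub>F n in sequentially. norm (?s n - truncated_Laplace T N x) \<le> exp (- N) * norm x"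
      using eventually_ge_at_top[of "nat \<lceil>N\<rceil>"]
      by eventually_elim (rule truncated_Laplace_tail[OF that], simp add: nat_ceiling_le_eq)
  qed simp
  have bound: "norm (truncated_Laplace T N x - l) \<le> exp (- N) * norm x" if "0 \<le> N" for N
    using tail[OF that] by (simp only: norm_minus_commute)
  have "\<forall>\<^sub>F N in at_top. norm (truncated_Laplace T N x - l) \<le> exp (- N) * norm x"
    using eventually_ge_at_top[of 0] by eventually_elim (rule bound)
  then have "((\<lambda>N. truncated_Laplace T N x - l) \<longlongrightarrow> 0) at_top"
    using e by (rule Lim_null_comparison[where g="\<lambda>N. exp (- N) * norm x"])
  then have "((\<lambda>N. truncated_Laplace T N x) \<longlongrightarrow> l) at_top"
    by (rule LIM_zero_cancel)
  moreover from this have "Laplace T x = l"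
    unfolding Laplace_def by (intro tendsto_Lim) simp_all
  ultimately show ?thesis by simp
qed

lemma Laplace_tail:
  assumes "N \<ge> 0"
  shows "norm (Laplace T x - truncated_Laplace T N x) \<le> exp (- N) * norm x"
proof (rule tendsto_le[OF _ tendsto_const tendsto_norm[OF tendsto_diff[OF truncated_Laplace_tendsto tendsto_const]]])
  show "\<forall>\<^sub>F M in at_top. norm (truncated_Laplace T M x - truncated_Laplace T N x) \<le> exp (- N) * norm x"
    using eventually_ge_at_top[of N]
    by eventually_elim (rule truncated_Laplace_tail[OF assms])
qed simp

lemma truncated_Laplace_linear_image:
  assumes J: "bounded_linear J" and JT: "\<And>s. s \<ge> 0 \<Longrightarrow> J (T s x) = T s z"
  shows "J (truncated_Laplace T N x) = truncated_Laplace T N z"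
proof -
  have "J (truncated_Laplace T N x) = integral {0..N} (J \<circ> (\<lambda>s. exp (- s) *\<^sub>R T s x))"
    unfolding truncated_Laplace_def
    by (rule integral_linear[OF Laplace_integrand_integrable J, symmetric]) simp
  also have "\<dots> = truncated_Laplace T N z"
    unfolding truncated_Laplace_def
    by (intro integral_cong) (simp add: linear_scale[OF bounded_linear.linear[OF J]] JT)
  finally show ?thesis .
qed

lemma Laplace_commute:
  assumes J: "bounded_linear J" and JT: "\<And>s. s \<ge> 0 \<Longrightarrow> J (T s x) = T s (J x)"
  shows "J (Laplace T x) = Laplace T (J x)"
proof -
  have "((\<lambda>N. J (truncated_Laplace T N x)) \<longlongrightarrow> J (Laplace T x)) at_top"
    by (rule bounded_linear.tendsto[OF J truncated_Laplace_tendsto])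
  then have "((\<lambda>N. truncated_Laplace T N (J x)) \<longlongrightarrow> J (Laplace T x)) at_top"
    using truncated_Laplace_linear_image[OF J JT] by simp
  then show ?thesis
    using truncated_Laplace_tendsto tendsto_unique trivial_limit_at_top_linorder by blast
qed

lemma linear_truncated_Laplace: "linear (truncated_Laplace T N)"
proof
  fix x y :: 'a and c :: real
  have "truncated_Laplace T N (x + y) =
      integral {0..N} (\<lambda>s. exp (- s) *\<^sub>R T s x + exp (- s) *\<^sub>R T s y)"
    unfolding truncated_Laplace_def
    using semigroup_contraction
    by (intro integral_cong) (simp add: contraction_def linear_add scaleR_add_right)
  also have "\<dots> = truncated_Laplace T N x + truncated_Laplace T N y"
    unfolding truncated_Laplace_def by (intro integral_add Laplace_integrand_integrable) simp_all
  finally show "truncated_Laplace T N (x + y) = truncated_Laplace T N x + truncated_Laplace T N y" .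
  have "c *\<^sub>R T s x = T s (c *\<^sub>R x)" if "s \<ge> 0" for s
    using semigroup_contraction[OF that] by (simp add: contraction_def linear_scale)
  from truncated_Laplace_linear_image[OF bounded_linear_scaleR_right this]
  show "truncated_Laplace T N (c *\<^sub>R x) = c *\<^sub>R truncated_Laplace T N x" by simp
qed

lemma linear_Laplace: "linear (Laplace T)"
proof
  fix x y :: 'a and c :: real
  have "((\<lambda>N. truncated_Laplace T N (x + y)) \<longlongrightarrow> Laplace T x + Laplace T y) at_top"
    unfolding linear_add[OF linear_truncated_Laplace] by (intro tendsto_add truncated_Laplace_tendsto)
  then show "Laplace T (x + y) = Laplace T x + Laplace T y"
    using truncated_Laplace_tendsto tendsto_unique trivial_limit_at_top_linorder by blast
  have "((\<lambda>N. truncated_Laplace T N (c *\<^sub>R x)) \<longlongrightarrow> c *\<^sub>R Laplace T x) at_top"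
    unfolding linear_scale[OF linear_truncated_Laplace] by (intro tendsto_scaleR tendsto_const truncated_Laplace_tendsto)
  then show "Laplace T (c *\<^sub>R x) = c *\<^sub>R Laplace T x"
    using truncated_Laplace_tendsto tendsto_unique trivial_limit_at_top_linorder by blast
qed

text \<open>A shift of the variable of integration. The right-hand side is visibly differentiable in \<open>h\<close>.\<close>

lemma semigroup_Laplace:
  assumes h: "h \<ge> 0"
  shows "T h (Laplace T x) = exp h *\<^sub>R (Laplace T x - truncated_Laplace T h x)"
proof -
  have step: "T h (truncated_Laplace T N x) = exp h *\<^sub>R (truncated_Laplace T (N + h) x - truncated_Laplace T h x)"
    if N: "N \<ge> 0" for N
  proof -
    let ?f = "\<lambda>s. exp (- s) *\<^sub>R T s x"
    have "T h (truncated_Laplace T N x) = integral {0..N} (T h \<circ> ?f)"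
      unfolding truncated_Laplace_def
      by (rule integral_linear[OF Laplace_integrand_integrable semigroup_bounded_linear[OF h], symmetric]) simp
    also have "\<dots> = integral {0..N} (\<lambda>s. exp h *\<^sub>R (?f \<circ> (+) h) s)"
    proof (rule integral_cong)
      fix s assume s: "s \<in> {0..N}"
      have "T h (T s x) = T (h + s) x"
        using T h s unfolding contraction_semigroup_def by (metis atLeastAtMost_iff add.commute)
      then show "(T h \<circ> ?f) s = exp h *\<^sub>R (?f \<circ> (+) h) s"
        using semigroup_contraction[OF h] by (simp add: contraction_def linear_scale flip: exp_add)
    qed
    also have "\<dots> = exp h *\<^sub>R integral {0..N} (?f \<circ> (+) h)"
      by (rule integral_cmul)
    also have "integral {0..N} (?f \<circ> (+) h) = integral {0 + h..N + h} ?f"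
      by (rule integral_shift_Icc_real)
    also have "\<dots> = truncated_Laplace T (N + h) x - truncated_Laplace T h x"
      using truncated_Laplace_combine[of h "N + h" x] h N by simp
    finally show ?thesis .
  qed
  have "((\<lambda>N. T h (truncated_Laplace T N x)) \<longlongrightarrow> T h (Laplace T x)) at_top"
    by (rule bounded_linear.tendsto[OF semigroup_bounded_linear[OF h] truncated_Laplace_tendsto])
  moreover have "\<forall>\<^sub>F N in at_top. T h (truncated_Laplace T N x) =
      exp h *\<^sub>R (truncated_Laplace T (N + h) x - truncated_Laplace T h x)"
    using eventually_ge_at_top[of 0] by eventually_elim (rule step)
  ultimately have "((\<lambda>N. exp h *\<^sub>R (truncated_Laplace T (N + h) x - truncated_Laplace T h x)) \<longlongrightarrow> T h (Laplace T x)) at_top"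
    by (rule Lim_transform_eventually)
  moreover have "((\<lambda>N. exp h *\<^sub>R (truncated_Laplace T (N + h) x - truncated_Laplace T h x)) \<longlongrightarrow>
      exp h *\<^sub>R (Laplace T x - truncated_Laplace T h x)) at_top"
  proof -
    have "filterlim (\<lambda>N. N + h) at_top at_top"
      using filterlim_tendsto_add_at_top[OF tendsto_const filterlim_ident, of h] by (simp add: add.commute)
    from filterlim_compose[OF truncated_Laplace_tendsto this, of x]
    show ?thesis by (intro tendsto_scaleR tendsto_diff tendsto_const)
  qed
  ultimately show ?thesis
    using tendsto_unique trivial_limit_at_top_linorder by blast
qed

lemma Laplace_has_vector_derivative:
  assumes t: "t \<ge> 0"
  shows "((\<lambda>t. T t (Laplace T x)) has_vector_derivative T t (Laplace T x - x)) (at t within {0..})"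
proof -
  let ?f = "\<lambda>s. exp (- s) *\<^sub>R T s x"
  have "((\<lambda>u. integral {0..u} ?f) has_vector_derivative ?f t) (at t within {0..t + 1})"
    using t by (intro integral_has_vector_derivative Laplace_integrand_continuous) auto
  moreover have "at t within {0..t + 1} = at t within {0..}"
    by (rule at_within_nhd[of t "{..<t + 1}"]) (use t in auto)
  ultimately have "(truncated_Laplace T t x = integral {0..t} ?f) \<and>
      ((\<lambda>u. truncated_Laplace T u x) has_vector_derivative ?f t) (at t within {0..})"
    by (simp add: truncated_Laplace_def)
  then have "((\<lambda>u. exp u *\<^sub>R (Laplace T x - truncated_Laplace T u x)) has_vector_derivative
      exp t *\<^sub>R (0 - ?f t) + exp t *\<^sub>R (Laplace T x - truncated_Laplace T t x)) (at t within {0..})"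
    by (intro has_vector_derivative_scaleR has_vector_derivative_diff has_vector_derivative_const
        DERIV_subset[OF DERIV_exp]) auto
  moreover have "exp t *\<^sub>R (0 - ?f t) + exp t *\<^sub>R (Laplace T x - truncated_Laplace T t x) = T t (Laplace T x - x)"
    using semigroup_contraction[OF t] semigroup_Laplace[OF t, of x]
    by (simp add: contraction_def linear_diff flip: exp_add)
  ultimately have "((\<lambda>u. exp u *\<^sub>R (Laplace T x - truncated_Laplace T u x)) has_vector_derivative
      T t (Laplace T x - x)) (at t within {0..})" by simp
  then show ?thesis
    by (rule has_vector_derivative_transform[rotated 2]) (use t semigroup_Laplace in auto)
qed

text \<open>For \<open>y = Laplace T x\<close> the function \<open>inner y (T t y)\<close> does not exceed its value at \<open>t = 0\<close>,
  because \<open>T t\<close> is a contraction; so its derivative \<open>inner y (y - x)\<close> there is not positive.\<close>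

lemma resolvent_at_one_Laplace: "resolvent_at_one T (Laplace T)"
proof -
  have T0: "T 0 x = x" for x
    using T by (simp add: contraction_semigroup_def)
  have d0: "((\<lambda>t. T t (Laplace T x)) has_vector_derivative Laplace T x - x) (at 0 within {0..})" for x
    using Laplace_has_vector_derivative[of 0 x] by (simp add: T0)
  have "dissipative_resolvent (Laplace T)"
  proof (rule dissipative_resolventI[OF linear_Laplace])
    fix x
    let ?y = "Laplace T x"
    show "inner ?y (?y - x) \<le> 0"
    proof (rule ccontr)
      assume "\<not> ?thesis"
      then have "0 < inner ?y (?y - x)" by simp
      moreover have "((\<lambda>t. inner ?y (T t ?y)) has_real_derivative inner ?y (?y - x)) (at 0 within {0..})"
        unfolding has_real_derivative_iff_has_vector_derivative
        by (rule bounded_linear.has_vector_derivative[OF bounded_linear_inner_right d0])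
      ultimately obtain d where d: "d > 0" "\<And>h. 0 < h \<Longrightarrow> h < d \<Longrightarrow> inner ?y (T 0 ?y) < inner ?y (T (0 + h) ?y)"
        using has_real_derivative_pos_inc_right[of "\<lambda>t. inner ?y (T t ?y)" _ 0 "{0..}"] by auto
      have "inner ?y ?y < inner ?y (T (d / 2) ?y)"
        using d(2)[of "d / 2"] d(1) by (simp add: T0)
      also have "\<dots> \<le> norm ?y * norm (T (d / 2) ?y)" by (rule norm_cauchy_schwarz)
      also have "\<dots> \<le> norm ?y * norm ?y"
        using semigroup_contraction[of "d / 2"] d(1) by (intro mult_left_mono) (auto simp: contraction_def)
      finally show False by (simp add: norm_eq_sqrt_inner)
    qed
  next
    fix x assume 0: "Laplace T x = 0"
    have "T t 0 = 0" if "t \<ge> 0" for t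
      using semigroup_contraction[OF that] by (simp add: contraction_def linear_0)
    moreover have "((\<lambda>t. T t 0) has_vector_derivative - x) (at 0 within {0..})"
      using d0[of x] 0 by simp
    ultimately have "((\<lambda>t. 0) has_vector_derivative - x) (at 0 within {0..})"
      by (intro has_vector_derivative_transform[of 0 "{0..}" "\<lambda>t. 0" "\<lambda>t. T t 0"]) auto
    moreover have "((\<lambda>t. 0) has_vector_derivative (0::'a)) (at 0 within {0..})"
      by (rule has_vector_derivative_const)
    ultimately have "- x = 0"
      by (rule vector_derivative_unique_within[rotated]) (simp add: at_within_Ici_at_right)
    then show "x = 0" by simp
  qed
  moreover have "Laplace T (T t x) = T t (Laplace T x)" if t: "t \<ge> 0" for t x
  proof (rule Laplace_commute[OF semigroup_bounded_linear[OF t], symmetric])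
    fix s :: real assume "s \<ge> 0"
    then show "T t (T s x) = T s (T t x)"
      using T t unfolding contraction_semigroup_def by (metis add.commute)
  qed
  ultimately show ?thesis
    using T Laplace_has_vector_derivative by (simp add: resolvent_at_one_def contraction_semigroup_def)
qed

end

text \<open>Stated for matrix coefficients, this estimate serves for the Laplace transforms and for their
  adjoints alike.\<close>

lemma Laplace_difference_bound:
  fixes T T' :: "real \<Rightarrow> 'a::complex_hilbert \<Rightarrow> 'a"
  assumes T: "contraction_semigroup T" and T': "contraction_semigroup T'" and N: "N \<ge> 0"
    and c: "\<And>s. s \<in> {0..N} \<Longrightarrow> \<bar>inner x (T s y - T' s y)\<bar> \<le> c"
  shows "\<bar>inner x (Laplace T y - Laplace T' y)\<bar> \<le> c * N + 2 * exp (- N) * norm x * norm y"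
proof -
  let ?G = "truncated_Laplace T N y" and ?G' = "truncated_Laplace T' N y"
  let ?f = "\<lambda>s. exp (- s) *\<^sub>R T s y" and ?f' = "\<lambda>s. exp (- s) *\<^sub>R T' s y"
  have "0 \<le> c" using c[of 0] N by fastforce
  have int: "?f integrable_on {0..N}" "?f' integrable_on {0..N}"
    using Laplace_integrand_integrable[OF T] Laplace_integrand_integrable[OF T'] by simp_all
  have "?G - ?G' = integral {0..N} (\<lambda>s. ?f s - ?f' s)"
    unfolding truncated_Laplace_def using int by (rule integral_diff[symmetric])
  then have "inner x (?G - ?G') = integral {0..N} (inner x \<circ> (\<lambda>s. ?f s - ?f' s))"
    using integral_linear[OF integrable_diff[OF int] bounded_linear_inner_right[of x]] by simp
  also have "norm \<dots> \<le> c * (N - 0)"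
  proof (rule integral_bound[OF N])
    have "continuous_on {0..N} (\<lambda>s. inner x (?f s - ?f' s))"
      by (intro continuous_intros Laplace_integrand_continuous T T') auto
    then show "continuous_on {0..N} (inner x \<circ> (\<lambda>s. ?f s - ?f' s))" by (simp add: o_def)
    fix s assume s: "s \<in> {0..N}"
    have "norm ((inner x \<circ> (\<lambda>s. ?f s - ?f' s)) s) = exp (- s) * \<bar>inner x (T s y - T' s y)\<bar>"
      by (simp add: abs_mult flip: scaleR_diff_right)
    also have "\<dots> \<le> 1 * c" using s c[OF s] by (intro mult_mono) auto
    finally show "norm ((inner x \<circ> (\<lambda>s. ?f s - ?f' s)) s) \<le> c" by simp
  qed
  finally have 1: "\<bar>inner x (?G - ?G')\<bar> \<le> c * N" by simp
  have 2: "\<bar>inner x (Laplace T y - ?G)\<bar> \<le> norm x * (exp (- N) * norm y)"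
    by (rule order_trans[OF Cauchy_Schwarz_ineq2 mult_left_mono[OF Laplace_tail[OF T N]]]) simp
  have 3: "\<bar>inner x (Laplace T' y - ?G')\<bar> \<le> norm x * (exp (- N) * norm y)"
    by (rule order_trans[OF Cauchy_Schwarz_ineq2 mult_left_mono[OF Laplace_tail[OF T' N]]]) simp
  have "inner x (Laplace T y - Laplace T' y) =
      inner x (?G - ?G') + inner x (Laplace T y - ?G) - inner x (Laplace T' y - ?G')"
    by (simp add: inner_diff_right)
  with 1 2 3 show ?thesis by (simp add: mult_ac)
qed


section \<open>The unitary group with a given cogenerator\<close>

lemma exp_commute_if_commute:
  fixes a y :: "'a::{real_normed_algebra_1, banach}"
  assumes "a * y = y * a"
  shows "exp a * y = y * exp a"
proof -
  have s: "(\<lambda>n. a ^ n /\<^sub>R fact n) sums exp a"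
    unfolding exp_def by (rule summable_sums[OF summable_exp_generic])
  have "(\<lambda>n. (a ^ n /\<^sub>R fact n) * y) sums (exp a * y)"
    using s by (rule sums_mult2)
  moreover have "(\<lambda>n. y * (a ^ n /\<^sub>R fact n)) sums (y * exp a)"
    using s by (rule sums_mult)
  moreover have "(a ^ n /\<^sub>R fact n) * y = y * (a ^ n /\<^sub>R fact n)" for n
    using power_commuting_commutes[OF assms, of n] by simp
  ultimately show ?thesis using sums_unique2 by auto
qed

lemma exp_skew_isometry:
  fixes c :: "'a::complex_hilbert operator"
  assumes skew: "\<And>x. inner (act c x) x = 0"
  shows "norm (act (exp (t *\<^sub>R c)) x) = norm x"
proof -
  let ?E = "\<lambda>t. act (exp (t *\<^sub>R c)) x"
  have "((\<lambda>s. inner (?E s) (?E s)) has_real_derivative 0) (at s)" for s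
  proof -
    have "act (exp (s *\<^sub>R c)) (act c x) = act c (?E s)"
      using exp_commute_if_commute[of "s *\<^sub>R c" c] by (simp flip: act_mult)
    then have d: "(?E has_derivative (\<lambda>h. h *\<^sub>R act c (?E s))) (at s)"
      using exp_act_has_vector_derivative[of c x s UNIV] by (simp add: has_vector_derivative_def)
    have "inner (?E s) (act c (?E s)) = 0"
      using skew[of "?E s"] by (simp add: inner_commute)
    then show ?thesis
      using has_derivative_inner[OF d d] skew[of "?E s"]
      by (simp add: has_field_derivative_def lambda_zero)
  qed
  then have "\<forall>s. ((\<lambda>s. inner (?E s) (?E s)) has_real_derivative 0) (at s)" by blast
  from DERIV_isconst_all[OF this, of t 0] have "inner (?E t) (?E t) = inner (?E 0) (?E 0)" .
  then show ?thesis by (simp add: act_one norm_eq_sqrt_inner)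
qed

text \<open>The path \<open>exp (t c) x\<close> has the velocity \<open>exp (t c) (c x)\<close>, whose norm is constant.\<close>

lemma exp_skew_displacement:
  fixes c :: "'a::complex_hilbert operator"
  assumes skew: "\<And>x. inner (act c x) x = 0"
  shows "norm (act (exp (t *\<^sub>R c)) x - x) \<le> \<bar>t\<bar> * norm (act c x)"
proof -
  have pos: "norm (act (exp (t *\<^sub>R b)) x - x) \<le> norm (act b x) * t"
    if "t \<ge> 0" and b: "\<And>x. inner (act b x) x = 0" for b :: "'a operator" and t
  proof -
    have "norm (act (exp (t *\<^sub>R b)) x - act (exp (0 *\<^sub>R b)) x) \<le> norm (act b x) * t"
      by (rule vector_mean_value_inequality[OF exp_act_has_vector_derivative _ that(1)])
        (simp add: exp_skew_isometry[OF b])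
    then show ?thesis by (simp add: act_one)
  qed
  have neg: "act (- c) x = - act c x" for x
    using act_scaleR_left[of "-1" c x] by simp
  show ?thesis
  proof (cases "t \<ge> 0")
    case True
    then show ?thesis using pos[OF True skew] by (simp add: mult.commute)
  next
    case False
    then show ?thesis using pos[of "- t" "- c"] skew by (simp add: neg mult.commute)
  qed
qed

lemma strong_limit_from_dense:
  fixes L :: "nat \<Rightarrow> 'a::real_normed_vector \<Rightarrow> 'b::real_normed_vector"
  assumes L: "\<And>n. contraction (L n)" and D: "closure D = UNIV"
    and lim: "\<And>x. x \<in> D \<Longrightarrow> (\<lambda>n. L n x) \<longlonglongrightarrow> 0"
  shows "(\<lambda>n. L n x) \<longlonglongrightarrow> 0"
proof (rule LIMSEQ_I)
  fix e :: real assume e: "e > 0"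
  have "x \<in> closure D" using D by simp
  then obtain y where y: "y \<in> D" "dist y x < e / 2"
    unfolding closure_approachable using e by (meson half_gt_zero)
  obtain N where N: "\<And>n. n \<ge> N \<Longrightarrow> norm (L n y) < e / 2"
    using LIMSEQ_D[OF lim[OF y(1)], of "e / 2"] e by auto
  show "\<exists>N. \<forall>n\<ge>N. norm (L n x - 0) < e"
  proof (intro exI allI impI)
    fix n assume n: "n \<ge> N"
    have "norm (L n x) \<le> norm (L n y) + norm (L n x - L n y)"
      by (metis add.commute norm_triangle_sub)
    also have "norm (L n x - L n y) \<le> norm (x - y)" by (rule contraction_diff[OF L])
    finally show "norm (L n x - 0) < e"
      using N[OF n] y(2) by (simp add: dist_norm norm_minus_commute)
  qed
qed

text \<open>This is \<open>1 - k / (n + 1)\<close> for \<open>k \<le> n + 1\<close>.\<close>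

definition Fejer_weight :: "nat \<Rightarrow> nat \<Rightarrow> real" where
  "Fejer_weight n k = real (Suc n - k) / real (Suc n)"

text \<open>Summation by parts: the weights decrease by \<open>1 / (n + 1)\<close> in each step.\<close>

lemma Fejer_telescope:
  fixes a :: "nat \<Rightarrow> 'a::real_vector"
  shows "(\<Sum>k=1..n. Fejer_weight n k *\<^sub>R (a k - a (Suc k))) =
    a 1 - (1 / real (Suc n)) *\<^sub>R (\<Sum>k=1..Suc n. a k)"
proof -
  have "(\<Sum>k=1..n. real (Suc n - k) *\<^sub>R (a k - a (Suc k))) = real (Suc n) *\<^sub>R a 1 - (\<Sum>k=1..Suc n. a k)"
  proof (induction n)
    case (Suc n)
    \<comment> \<open>Passing from \<open>n\<close> to \<open>Suc n\<close> raises every weight \<open>Suc n - k\<close> by one.\<close>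
    have tel: "(\<Sum>k=1..Suc n. a k - a (Suc k)) = a 1 - a (Suc (Suc n))"
      by (induction n) simp_all
    have "(\<Sum>k=1..Suc n. real (Suc (Suc n) - k) *\<^sub>R (a k - a (Suc k))) =
        (\<Sum>k=1..Suc n. real (Suc n - k) *\<^sub>R (a k - a (Suc k)) + (a k - a (Suc k)))"
    proof (rule sum.cong[OF refl])
      fix k assume "k \<in> {1..Suc n}"
      then have "real (Suc (Suc n) - k) = real (Suc n - k) + 1" by (simp add: of_nat_diff)
      then show "real (Suc (Suc n) - k) *\<^sub>R (a k - a (Suc k)) =
          real (Suc n - k) *\<^sub>R (a k - a (Suc k)) + (a k - a (Suc k))"
        by (simp only: scaleR_add_left scaleR_one)
    qed
    also have "\<dots> = (\<Sum>k=1..Suc n. real (Suc n - k) *\<^sub>R (a k - a (Suc k))) + (\<Sum>k=1..Suc n. a k - a (Suc k))"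
      by (rule sum.distrib)
    also have "(\<Sum>k=1..Suc n. real (Suc n - k) *\<^sub>R (a k - a (Suc k))) =
        (\<Sum>k=1..n. real (Suc n - k) *\<^sub>R (a k - a (Suc k)))" by simp
    also have "\<dots> = real (Suc n) *\<^sub>R a 1 - (\<Sum>k=1..Suc n. a k)" by (rule Suc.IH)
    also have "real (Suc n) *\<^sub>R a 1 - (\<Sum>k=1..Suc n. a k) + (\<Sum>k=1..Suc n. a k - a (Suc k)) =
        real (Suc (Suc n)) *\<^sub>R a 1 - (\<Sum>k=1..Suc (Suc n). a k)"
      unfolding tel by (simp add: algebra_simps scaleR_2)
    finally show ?case .
  qed simp
  then have "(1 / real (Suc n)) *\<^sub>R (\<Sum>k=1..n. real (Suc n - k) *\<^sub>R (a k - a (Suc k))) =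
      (1 / real (Suc n)) *\<^sub>R (real (Suc n) *\<^sub>R a 1 - (\<Sum>k=1..Suc n. a k))" by (rule arg_cong)
  then show ?thesis
    unfolding Fejer_weight_def by (simp add: scaleR_sum_right scaleR_diff_right)
qed

text \<open>For a vector \<open>z - V z\<close> the sums telescope.\<close>

lemma mean_ergodic:
  fixes V :: "'a::complex_hilbert \<Rightarrow> 'a"
  assumes V: "contraction V" and dense: "closure (range (\<lambda>z. z - V z)) = UNIV"
  shows "(\<lambda>n. (1 / real (Suc n)) *\<^sub>R (\<Sum>k<Suc n. (V ^^ k) x)) \<longlonglongrightarrow> 0"
proof (rule strong_limit_from_dense[OF _ dense])
  note lin = contraction_power[OF V, unfolded contraction_def, THEN conjunct1]
  fix n
  show "contraction (\<lambda>x. (1 / real (Suc n)) *\<^sub>R (\<Sum>k<Suc n. (V ^^ k) x))"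
    unfolding contraction_def
  proof (intro conjI allI)
    show "linear (\<lambda>x. (1 / real (Suc n)) *\<^sub>R (\<Sum>k<Suc n. (V ^^ k) x))"
      by (intro linear_compose_scale_right linear_compose_sum ballI lin)
    fix x
    have "norm (\<Sum>k<Suc n. (V ^^ k) x) \<le> real (card {..<Suc n}) * norm x"
      using contraction_power[OF V] by (intro sum_norm_bound) (simp add: contraction_def)
    then show "norm ((1 / real (Suc n)) *\<^sub>R (\<Sum>k<Suc n. (V ^^ k) x)) \<le> norm x"
      by (simp add: divide_simps mult.commute del: sum.lessThan_Suc)
  qed
next
  note lin = contraction_power[OF V, unfolded contraction_def, THEN conjunct1]
  fix x assume "x \<in> range (\<lambda>z. z - V z)"
  then obtain z where x: "x = z - V z" by blast
  have tel: "(\<Sum>k<n. (V ^^ k) x) = z - (V ^^ n) z" for n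
    unfolding x by (induction n) (simp_all add: linear_diff[OF lin] funpow_swap1)
  have le: "norm (z - (V ^^ n) z) \<le> norm z + norm z" for n
    using contraction_power[OF V, of n]
    by (intro order_trans[OF norm_triangle_ineq4] add_mono) (auto simp: contraction_def)
  have bound: "norm ((1 / real (Suc n)) *\<^sub>R (\<Sum>k<Suc n. (V ^^ k) x)) \<le> (2 * norm z) * (1 / real (Suc n))" for n
    unfolding tel using le[of "Suc n"] by (simp add: divide_right_mono)
  have "(\<lambda>n. (2 * norm z) * (1 / real (Suc n))) \<longlonglongrightarrow> (2 * norm z) * 0"
    by (intro tendsto_mult tendsto_const LIMSEQ_inverse_real_of_nat[unfolded inverse_eq_divide])
  then have "(\<lambda>n. (2 * norm z) * (1 / real (Suc n))) \<longlonglongrightarrow> 0" by simp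
  then show "(\<lambda>n. (1 / real (Suc n)) *\<^sub>R (\<Sum>k<Suc n. (V ^^ k) x)) \<longlonglongrightarrow> 0"
    by (rule Lim_null_comparison[rotated]) (use bound in \<open>auto intro: always_eventually\<close>)
qed

text \<open>The unitary \<open>V\<close>, with inverse \<open>W\<close>, is the cogenerator of a unitary group, to be constructed. The
  generator of the group is \<open>(V + 1) (V - 1)\<^sup>-\<^sup>1\<close>, in general unbounded, and its resolvent at 1 is
  \<open>Res = (1 - V) / 2\<close>.\<close>

locale fixpoint_free_unitary =
  fixes V W :: "'a::complex_hilbert \<Rightarrow> 'a"
  assumes V_linear: "linear V" and V_isometric: "norm (V x) = norm x"
    and VW: "V (W x) = x" and WV: "W (V x) = x"
    and V_fixpoint: "V x = x \<Longrightarrow> x = 0"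
begin

lemma W_linear: "linear W"
proof
  show "W (x + y) = W x + W y" for x y
  proof -
    have "W (V (W x + W y)) = W x + W y" by (rule WV)
    then show ?thesis by (simp add: linear_add[OF V_linear] VW)
  qed
  show "W (c *\<^sub>R x) = c *\<^sub>R W x" for c x
  proof -
    have "W (V (c *\<^sub>R W x)) = c *\<^sub>R W x" by (rule WV)
    then show ?thesis by (simp add: linear_scale[OF V_linear] VW)
  qed
qed

lemma W_isometric: "norm (W x) = norm x"
  using V_isometric[of "W x"] by (simp add: VW)

lemma inverse_fixpoint_free_unitary: "fixpoint_free_unitary W V"
proof (rule fixpoint_free_unitary.intro)
  show "x = 0" if "W x = x" for x
    using that VW[of x] by (intro V_fixpoint) simp
qed (fact W_linear W_isometric VW WV)+

lemma V_contraction: "contraction V" and W_contraction: "contraction W"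
  by (simp_all add: contraction_def V_linear W_linear V_isometric W_isometric)

lemma V_inner: "inner (V x) (V y) = inner x y"
proof -
  have "inner (V x + V y) (V x + V y) = inner (x + y) (x + y)"
    using V_isometric[of "x + y"] by (simp add: norm_eq_sqrt_inner linear_add[OF V_linear])
  moreover have "inner (V z) (V z) = inner z z" for z
    using V_isometric[of z] by (simp add: norm_eq_sqrt_inner)
  ultimately show ?thesis by (simp add: inner_add_left inner_add_right inner_commute)
qed

definition Res :: "'a \<Rightarrow> 'a" where "Res x = (1/2) *\<^sub>R (x - V x)"

lemma Res_linear: "linear Res"
  unfolding Res_def
  by (intro linear_compose_scale_right linear_compose_sub V_linear bounded_linear.linear[OF bounded_linear_ident])

lemma Res_resolvent: "dissipative_resolvent Res"
  unfolding dissipative_resolvent_def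
proof (intro conjI allI impI)
  have "contraction (\<lambda>x. x - 2 *\<^sub>R Res x)"
    by (simp add: Res_def V_contraction)
  then show "contraction (\<lambda>x. x - 2 *\<^sub>R Res x)" .
  have "norm (Res x) \<le> norm x * 1" for x
    using norm_triangle_ineq4[of x "V x"] by (simp add: Res_def V_isometric)
  then show "bounded_linear Res"
    by (intro bounded_linear_intro[where K=1]) (auto simp: linear_add[OF Res_linear] linear_scale[OF Res_linear])
  show "x = 0" if "Res x = 0" for x
    using that by (intro V_fixpoint) (simp add: Res_def)
qed

lemma range_one_minus_V: "closure (range (\<lambda>z. z - V z)) = UNIV"
proof -
  have "Res x \<in> range (\<lambda>z. z - V z)" for x
    by (rule range_eqI[of _ _ "(1/2) *\<^sub>R x"])
      (simp add: Res_def linear_scale[OF V_linear] scaleR_diff_right)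
  then have "closure (range Res) \<subseteq> closure (range (\<lambda>z. z - V z))"
    by (intro closure_mono) auto
  then show ?thesis using dense_range_resolvent[OF Res_resolvent] by auto
qed

text \<open>The generator \<open>(V + 1) (V - 1)\<^sup>-\<^sup>1\<close> is formally the divergent series of the \<open>- (V\<^sup>k - W\<^sup>k)\<close> over
  \<open>k \<ge> 1\<close>. Its Fejer means are bounded, skew-adjoint and commute with each other, so that their
  exponentials are unitary groups.\<close>

definition Fejer :: "nat \<Rightarrow> 'a operator" where
  "Fejer n = - (\<Sum>k=1..n. Fejer_weight n k *\<^sub>R (op_of V ^ k - op_of W ^ k))"

lemma act_sum: "act (sum f A) x = (\<Sum>k\<in>A. act (f k) x)"
  by (rule linear_sum[OF bounded_linear.linear[OF bounded_linear_act]])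

lemma act_Fejer: "act (Fejer n) x = - (\<Sum>k=1..n. Fejer_weight n k *\<^sub>R ((V ^^ k) x - (W ^^ k) x))"
proof -
  have "act (Fejer n) x = (-1) *\<^sub>R act (\<Sum>k=1..n. Fejer_weight n k *\<^sub>R (op_of V ^ k - op_of W ^ k)) x"
    unfolding Fejer_def using act_scaleR_left[of "-1"] by simp
  then show ?thesis
    by (simp add: act_sum act_scaleR_left act_diff_left act_power
        act_op_of[OF contraction_bounded_linear[OF V_contraction]]
        act_op_of[OF contraction_bounded_linear[OF W_contraction]])
qed

lemma Fejer_skew: "inner (act (Fejer n) x) x = 0"
proof -
  have "inner ((V ^^ k) x) y = inner x ((W ^^ k) y)" for k x y
  proof (induction k arbitrary: x y)
    case (Suc k)
    have "inner ((V ^^ Suc k) x) y = inner (V ((V ^^ k) x)) (V (W y))" by (simp add: VW)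
    also have "\<dots> = inner x ((W ^^ k) (W y))" by (simp only: V_inner Suc.IH)
    finally show ?case by (simp add: funpow_swap1)
  qed simp
  then have "inner ((V ^^ k) x) x = inner ((W ^^ k) x) x" for k
    by (simp add: inner_commute)
  then show ?thesis
    by (simp add: act_Fejer inner_sum_left inner_diff_left)
qed

lemma commute_Fejer:
  assumes "c * op_of V = op_of V * c" "c * op_of W = op_of W * c"
  shows "c * Fejer n = Fejer n * c"
proof -
  have p: "op_of V ^ k * c = c * op_of V ^ k" "op_of W ^ k * c = c * op_of W ^ k" for k
    using assms by (intro power_commuting_commutes, simp)+
  show ?thesis
    unfolding Fejer_def
    by (simp add: sum_distrib_left sum_distrib_right p left_diff_distrib right_diff_distrib)
qed

lemma op_VW_commute: "op_of V * op_of W = op_of W * op_of V"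
  using contraction_bounded_linear[OF V_contraction] contraction_bounded_linear[OF W_contraction]
  by (simp add: op_of_mult VW WV)

lemma Fejer_commute_V: "Fejer n * op_of V = op_of V * Fejer n"
  by (rule commute_Fejer[symmetric]) (simp_all add: op_VW_commute)

lemma Fejer_commute: "Fejer m * Fejer n = Fejer n * Fejer m"
  by (rule commute_Fejer[OF Fejer_commute_V]) (simp add: commute_Fejer op_VW_commute)

text \<open>Applied to \<open>x - V x\<close>, both halves of the Fejer mean telescope and leave \<open>- (x + V x)\<close> up to
  ergodic means.\<close>

lemma Fejer_tendsto: "(\<lambda>n. act (Fejer n) (Res x)) \<longlonglongrightarrow> Res x - x"
proof -
  interpret inv: fixpoint_free_unitary W V by (rule inverse_fixpoint_free_unitary)
  let ?A = "\<lambda>n. (1 / real (Suc n)) *\<^sub>R (\<Sum>k<Suc n. (V ^^ k) (V x))"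
  let ?B = "\<lambda>n. (1 / real (Suc n)) *\<^sub>R (\<Sum>k<Suc n. (W ^^ k) x)"
  have eq: "act (Fejer n) (x - V x) = (?A n + ?B n) - (x + V x)" for n
  proof -
    note linV = contraction_power[OF V_contraction, unfolded contraction_def, THEN conjunct1]
    note linW = contraction_power[OF W_contraction, unfolded contraction_def, THEN conjunct1]
    have "(\<Sum>k=1..n. Fejer_weight n k *\<^sub>R (V ^^ k) (x - V x)) =
        (\<Sum>k=1..n. Fejer_weight n k *\<^sub>R ((V ^^ k) x - (V ^^ Suc k) x))"
      by (simp add: linear_diff[OF linV] funpow_swap1)
    also have "\<dots> = V x - (1 / real (Suc n)) *\<^sub>R (\<Sum>k=1..Suc n. (V ^^ k) x)"
      using Fejer_telescope[of n "\<lambda>k. (V ^^ k) x"] by (simp only: One_nat_def funpow.simps o_apply id_apply)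
    also have "(\<Sum>k=1..Suc n. (V ^^ k) x) = (\<Sum>k<Suc n. (V ^^ k) (V x))"
      by (rule sum.reindex_bij_witness[of _ Suc "\<lambda>k. k - 1"]) (auto simp: funpow_swap1 Suc_le_eq gr0_conv_Suc)
    finally have 1: "(\<Sum>k=1..n. Fejer_weight n k *\<^sub>R (V ^^ k) (x - V x)) = V x - ?A n" .
    have "(\<Sum>k=1..n. Fejer_weight n k *\<^sub>R (W ^^ k) (x - V x)) =
        (\<Sum>k=1..n. - (Fejer_weight n k *\<^sub>R ((W ^^ (k - 1)) x - (W ^^ (Suc k - 1)) x)))"
    proof (rule sum.cong[OF refl])
      fix k assume "k \<in> {1..n}"
      then obtain j where "k = Suc j" by (cases k) auto
      moreover have "(W ^^ Suc j) (V x) = (W ^^ j) x" by (simp only: funpow_Suc_right o_def WV)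
      ultimately show "Fejer_weight n k *\<^sub>R (W ^^ k) (x - V x) =
          - (Fejer_weight n k *\<^sub>R ((W ^^ (k - 1)) x - (W ^^ (Suc k - 1)) x))"
        by (simp only: linear_diff[OF linW]) (simp add: scaleR_diff_right)
    qed
    also have "\<dots> = - (x - (1 / real (Suc n)) *\<^sub>R (\<Sum>k=1..Suc n. (W ^^ (k - 1)) x))"
      unfolding sum_negf
      using Fejer_telescope[of n "\<lambda>k. (W ^^ (k - 1)) x"]
      by (simp only: diff_self_eq_0 funpow.simps id_apply)
    also have "(\<Sum>k=1..Suc n. (W ^^ (k - 1)) x) = (\<Sum>k<Suc n. (W ^^ k) x)"
      by (rule sum.reindex_bij_witness[of _ Suc "\<lambda>k. k - 1"]) auto
    finally have 2: "(\<Sum>k=1..n. Fejer_weight n k *\<^sub>R (W ^^ k) (x - V x)) = ?B n - x" by simp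
    show ?thesis
      unfolding act_Fejer scaleR_diff_right sum_subtractf 1 2 by simp
  qed
  have "(\<lambda>n. (1/2) *\<^sub>R ((?A n + ?B n) - (x + V x))) \<longlonglongrightarrow> (1/2) *\<^sub>R ((0 + 0) - (x + V x))"
    by (intro tendsto_intros mean_ergodic V_contraction W_contraction range_one_minus_V inv.range_one_minus_V)
  moreover have "act (Fejer n) (Res x) = (1/2) *\<^sub>R ((?A n + ?B n) - (x + V x))" for n
    unfolding Res_def act_scaleR_right eq ..
  moreover have "(1/2) *\<^sub>R ((0 + 0) - (x + V x)) = Res x - x"
  proof -
    have "x = (1/2) *\<^sub>R (x + x)" by (simp flip: scaleR_2)
    then show ?thesis unfolding Res_def by (simp add: algebra_simps) 
  qed
  ultimately show ?thesis by simp
qed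

definition approx :: "nat \<Rightarrow> real \<Rightarrow> 'a \<Rightarrow> 'a" where "approx n t = act (exp (t *\<^sub>R Fejer n))"

lemma approx_isometric: "norm (approx n t x) = norm x"
  unfolding approx_def by (rule exp_skew_isometry) (rule Fejer_skew)

lemma approx_linear: "linear (approx n t)"
  unfolding approx_def by (rule bounded_linear.linear[OF bounded_linear_act_right])

lemma approx_0: "approx n 0 x = x"
  by (simp add: approx_def act_one)

lemma approx_add: "approx n (s + t) x = approx n s (approx n t x)"
  unfolding approx_def act_mult[symmetric]
  by (simp add: scaleR_add_left exp_add_commuting)

lemma approx_commute_V: "approx n t (V x) = V (approx n t x)"
proof -
  have "exp (t *\<^sub>R Fejer n) * op_of V = op_of V * exp (t *\<^sub>R Fejer n)"
    by (rule exp_commute_if_commute) (simp add: Fejer_commute_V)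
  from arg_cong[OF this, of "\<lambda>a. act a x"] show ?thesis
    by (simp add: approx_def act_mult act_op_of[OF contraction_bounded_linear[OF V_contraction]])
qed

text \<open>As the Fejer means commute, the two exponentials differ by the factor \<open>exp (t c)\<close>, where \<open>c\<close> is
  the difference of the means and again skew.\<close>

lemma approx_difference: "norm (approx n t x - approx m t x) \<le> \<bar>t\<bar> * norm (act (Fejer n) x - act (Fejer m) x)"
proof -
  let ?c = "Fejer n - Fejer m"
  have skew: "inner (act ?c x) x = 0" for x
    by (simp add: act_diff_left inner_diff_left Fejer_skew)
  have "t *\<^sub>R Fejer n = t *\<^sub>R Fejer m + t *\<^sub>R ?c" by (simp add: scaleR_diff_right)
  moreover have "(t *\<^sub>R Fejer m) * (t *\<^sub>R ?c) = (t *\<^sub>R ?c) * (t *\<^sub>R Fejer m)"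
    by (simp add: left_diff_distrib right_diff_distrib Fejer_commute scaleR_diff_right)
  ultimately have "exp (t *\<^sub>R Fejer n) = exp (t *\<^sub>R Fejer m) * exp (t *\<^sub>R ?c)"
    using exp_add_commuting by metis
  then have "approx n t x - approx m t x = approx m t (act (exp (t *\<^sub>R ?c)) x - x)"
    using linear_diff[OF approx_linear[of m t]] by (simp add: approx_def act_mult)
  then have "norm (approx n t x - approx m t x) = norm (act (exp (t *\<^sub>R ?c)) x - x)"
    by (simp add: approx_isometric)
  also have "\<dots> \<le> \<bar>t\<bar> * norm (act ?c x)" by (rule exp_skew_displacement[OF skew])
  finally show ?thesis by (simp add: act_diff_left)
qed

lemma approx_uniformly_Cauchy: "uniformly_Cauchy_on {-\<tau>..\<tau>} (\<lambda>n t. approx n t x)"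
proof (rule uniformly_Cauchy_onI)
  fix e :: real assume e: "e > 0"
  have "x \<in> closure (range Res)" using dense_range_resolvent[OF Res_resolvent] by simp
  then obtain y where y: "dist (Res y) x < e / 4"
    unfolding closure_approachable using e by (metis divide_pos_pos imageE zero_less_numeral)
  have "Cauchy (\<lambda>n. act (Fejer n) (Res y))"
    using Fejer_tendsto by (rule LIMSEQ_imp_Cauchy)
  moreover have "e / (2 * (\<bar>\<tau>\<bar> + 1)) > 0" using e by simp
  ultimately obtain N where N: "\<And>m n. m \<ge> N \<Longrightarrow> n \<ge> N \<Longrightarrow>
      norm (act (Fejer m) (Res y) - act (Fejer n) (Res y)) < e / (2 * (\<bar>\<tau>\<bar> + 1))"
    unfolding Cauchy_iff by metis
  show "\<exists>M. \<forall>t\<in>{-\<tau>..\<tau>}. \<forall>m\<ge>M. \<forall>n\<ge>M. dist (approx m t x) (approx n t x) < e"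
  proof (intro exI ballI allI impI)
    fix t m n assume t: "t \<in> {-\<tau>..\<tau>}" and mn: "m \<ge> N" "n \<ge> N"
    have close: "norm (approx k t x - approx k t (Res y)) < e / 4" for k
      using y approx_isometric[of k t "x - Res y"]
      by (simp add: linear_diff[OF approx_linear] dist_norm norm_minus_commute)
    have "norm (approx m t (Res y) - approx n t (Res y)) \<le> \<bar>t\<bar> * (e / (2 * (\<bar>\<tau>\<bar> + 1)))"
      by (rule order_trans[OF approx_difference mult_left_mono]) (use N[OF mn] in auto)
    also have "\<dots> \<le> (\<bar>\<tau>\<bar> + 1) * (e / (2 * (\<bar>\<tau>\<bar> + 1)))"
      using t e by (intro mult_right_mono) auto
    also have "\<dots> = e / 2" using e by (simp add: field_simps)
    finally have mid: "norm (approx m t (Res y) - approx n t (Res y)) \<le> e / 2" .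
    have "approx m t x - approx n t x = (approx m t x - approx m t (Res y)) + (approx m t (Res y) - approx n t (Res y)) - (approx n t x - approx n t (Res y))"
      by simp
    then have "norm (approx m t x - approx n t x) \<le>
        norm (approx m t x - approx m t (Res y)) + norm (approx m t (Res y) - approx n t (Res y)) + norm (approx n t x - approx n t (Res y))"
      using norm_triangle_ineq4[of "(approx m t x - approx m t (Res y)) + (approx m t (Res y) - approx n t (Res y))" "approx n t x - approx n t (Res y)"]
        norm_triangle_ineq[of "approx m t x - approx m t (Res y)" "approx m t (Res y) - approx n t (Res y)"] by simp
    then show "dist (approx m t x) (approx n t x) < e"
      using close[of m] close[of n] mid by (simp add: dist_norm)
  qed
qed

definition flow :: "real \<Rightarrow> 'a \<Rightarrow> 'a" where "flow t x = lim (\<lambda>n. approx n t x)"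

lemma approx_uniform_limit: "uniform_limit {-\<tau>..\<tau>} (\<lambda>n t. approx n t x) (\<lambda>t. flow t x) sequentially"
  unfolding flow_def
  using Cauchy_uniformly_convergent[OF approx_uniformly_Cauchy] uniformly_convergent_uniform_limit_iff by blast

lemma approx_tendsto: "(\<lambda>n. approx n t x) \<longlonglongrightarrow> flow t x"
  by (rule tendsto_uniform_limitI[OF approx_uniform_limit[where \<tau>="\<bar>t\<bar>"]]) auto

lemma flow_isometric: "norm (flow t x) = norm x"
  using tendsto_norm[OF approx_tendsto[of t x]] by (simp add: approx_isometric LIMSEQ_const_iff)

lemma flow_linear: "linear (flow t)"
proof
  show "flow t (x + y) = flow t x + flow t y" for x y
    using tendsto_add[OF approx_tendsto[of t x] approx_tendsto[of t y]] approx_tendsto[of t "x + y"]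
    by (simp add: linear_add[OF approx_linear] LIMSEQ_unique)
  show "flow t (c *\<^sub>R x) = c *\<^sub>R flow t x" for c x
    using tendsto_scaleR[OF tendsto_const approx_tendsto[of t x], of c] approx_tendsto[of t "c *\<^sub>R x"]
    by (simp add: linear_scale[OF approx_linear] LIMSEQ_unique)
qed

lemma flow_contraction: "contraction (flow t)"
  by (simp add: contraction_def flow_linear flow_isometric)

lemma flow_0: "flow 0 x = x"
  using approx_tendsto[of 0 x] by (simp add: approx_0 LIMSEQ_const_iff)

lemma flow_add: "flow (s + t) x = flow s (flow t x)"
proof -
  have "(\<lambda>n. norm (approx n t x - flow t x) + norm (approx n s (flow t x) - flow s (flow t x))) \<longlonglongrightarrow> 0 + 0"
    by (intro tendsto_add tendsto_norm_zero LIM_zero approx_tendsto)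
  then have "(\<lambda>n. norm (approx n t x - flow t x) + norm (approx n s (flow t x) - flow s (flow t x))) \<longlonglongrightarrow> 0" by simp
  then have "(\<lambda>n. approx n (s + t) x - flow s (flow t x)) \<longlonglongrightarrow> 0"
  proof (rule Lim_null_comparison[rotated], intro always_eventually allI)
    fix n
    have "approx n (s + t) x - flow s (flow t x) = approx n s (approx n t x - flow t x) + (approx n s (flow t x) - flow s (flow t x))"
      by (simp add: approx_add linear_diff[OF approx_linear])
    then show "norm (approx n (s + t) x - flow s (flow t x)) \<le> norm (approx n t x - flow t x) + norm (approx n s (flow t x) - flow s (flow t x))"
      by (metis approx_isometric norm_triangle_ineq)
  qed
  then have "(\<lambda>n. approx n (s + t) x) \<longlonglongrightarrow> flow s (flow t x)" by (rule LIM_zero_cancel)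
  then show ?thesis using approx_tendsto LIMSEQ_unique by blast
qed

lemma flow_commute_V: "flow t (V x) = V (flow t x)"
proof -
  have "(\<lambda>n. approx n t (V x)) \<longlonglongrightarrow> V (flow t x)"
    unfolding approx_commute_V by (rule bounded_linear.tendsto[OF contraction_bounded_linear[OF V_contraction] approx_tendsto])
  then show ?thesis using approx_tendsto LIMSEQ_unique by blast
qed

lemma flow_commute_S: "Res (flow t x) = flow t (Res x)"
  by (simp add: Res_def flow_commute_V linear_diff[OF flow_linear] linear_scale[OF flow_linear])

lemma flow_commute_W: "flow t (W x) = W (flow t x)"
  by (metis flow_commute_V VW WV)

lemma flow_continuous_on: "continuous_on A (\<lambda>t. flow t x)"
proof -
  have "continuous (at t) (\<lambda>t. flow t x)" for t
  proof -
    let ?I = "{-(\<bar>t\<bar> + 1)..\<bar>t\<bar> + 1}"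
    have "continuous_on ?I (\<lambda>t. approx n t x)" for n
      unfolding approx_def continuous_on_eq_continuous_within
      by (intro ballI has_vector_derivative_continuous[OF exp_act_has_vector_derivative])
    then have "continuous_on ?I (\<lambda>t. flow t x)"
      by (intro uniform_limit_theorem[OF _ approx_uniform_limit]) auto
    then show ?thesis by (rule continuous_on_interior) auto
  qed
  then show ?thesis by (simp add: continuous_at_imp_continuous_on)
qed

text \<open>The derivatives of the approximating groups at \<open>Res x\<close> converge uniformly on bounded intervals, by
  \<open>Fejer_tendsto\<close> and since the approximating groups are isometric.\<close>

lemma flow_has_vector_derivative: "((\<lambda>t. flow t (Res x)) has_vector_derivative flow t (Res x - x)) (at t within A)"
proof -
  let ?I = "{-(\<bar>t\<bar> + 1)..\<bar>t\<bar> + 1}"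
  have "\<exists>g. \<forall>s\<in>?I. (\<lambda>n. approx n s (Res x)) \<longlonglongrightarrow> g s \<and> (g has_derivative (\<lambda>h. h *\<^sub>R flow s (Res x - x))) (at s within ?I)"
  proof (rule has_derivative_sequence[where f'="\<lambda>n s h. h *\<^sub>R approx n s (act (Fejer n) (Res x))"])
    show "((\<lambda>t. approx n t (Res x)) has_derivative (\<lambda>h. h *\<^sub>R approx n s (act (Fejer n) (Res x)))) (at s within ?I)" for n s
      using exp_act_has_vector_derivative unfolding approx_def has_vector_derivative_def by blast
    show "(\<lambda>n. approx n 0 (Res x)) \<longlonglongrightarrow> Res x" by (simp add: approx_0)
    fix e :: real assume e: "e > 0"
    have 1: "\<forall>\<^sub>F n in sequentially. dist (act (Fejer n) (Res x)) (Res x - x) < e / 2"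
      using tendstoD[OF Fejer_tendsto, of "e / 2"] e by simp
    have 2: "\<forall>\<^sub>F n in sequentially. \<forall>s\<in>?I. dist (approx n s (Res x - x)) (flow s (Res x - x)) < e / 2"
      by (rule uniform_limitD[OF approx_uniform_limit]) (use e in simp)
    from 1 2 show "\<forall>\<^sub>F n in sequentially. \<forall>s\<in>?I. \<forall>h.
        norm (h *\<^sub>R approx n s (act (Fejer n) (Res x)) - h *\<^sub>R flow s (Res x - x)) \<le> e * norm h"
    proof eventually_elim
      case (elim n)
      show ?case
      proof (intro ballI allI)
        fix s h assume s: "s \<in> ?I"
        have "approx n s (act (Fejer n) (Res x)) - flow s (Res x - x) =
            approx n s (act (Fejer n) (Res x) - (Res x - x)) + (approx n s (Res x - x) - flow s (Res x - x))"
          by (simp add: linear_diff[OF approx_linear])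
        then have "norm (approx n s (act (Fejer n) (Res x)) - flow s (Res x - x)) \<le>
            norm (act (Fejer n) (Res x) - (Res x - x)) + norm (approx n s (Res x - x) - flow s (Res x - x))"
          by (metis approx_isometric norm_triangle_ineq)
        also have "\<dots> \<le> e"
          using elim(1) elim(2)[rule_format, OF s] unfolding dist_norm by linarith
        finally have "\<bar>h\<bar> * norm (approx n s (act (Fejer n) (Res x)) - flow s (Res x - x)) \<le> \<bar>h\<bar> * e"
          by (rule mult_left_mono) simp
        then show "norm (h *\<^sub>R approx n s (act (Fejer n) (Res x)) - h *\<^sub>R flow s (Res x - x)) \<le> e * norm h"
          by (simp add: mult.commute flip: scaleR_diff_right)
      qed
    qed
  qed auto
  then obtain g where g: "\<And>s. s \<in> ?I \<Longrightarrow> (\<lambda>n. approx n s (Res x)) \<longlonglongrightarrow> g s"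
      "\<And>s. s \<in> ?I \<Longrightarrow> (g has_derivative (\<lambda>h. h *\<^sub>R flow s (Res x - x))) (at s within ?I)"
    by blast
  have gU: "flow s (Res x) = g s" if "s \<in> ?I" for s
    using g(1)[OF that] approx_tendsto LIMSEQ_unique by blast
  have "((\<lambda>t. flow t (Res x)) has_vector_derivative flow t (Res x - x)) (at t within ?I)"
    unfolding has_vector_derivative_def
    by (rule has_derivative_transform[OF _ gU g(2)]) auto
  moreover have "at t within ?I = at t" by (rule at_within_interior) auto
  ultimately show ?thesis using has_vector_derivative_at_within by metis
qed

lemma flow_resolvent: "resolvent_at_one flow Res"
  unfolding resolvent_at_one_def
  using flow_contraction flow_0 flow_continuous_on Res_resolvent flow_commute_S flow_has_vector_derivative by blast

text \<open>The reversed group belongs to the cogenerator \<open>W\<close>, as \<open>(x - W x) / 2 = - Res (W x)\<close>.\<close>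

lemma flow_reverse_resolvent: "resolvent_at_one (\<lambda>t. flow (- t)) (\<lambda>x. (1/2) *\<^sub>R (x - W x))"
proof -
  interpret inv: fixpoint_free_unitary W V by (rule inverse_fixpoint_free_unitary)
  have S': "inv.Res x = - Res (W x)" for x
    by (simp add: inv.Res_def Res_def VW flip: scaleR_minus_right)
  have eq: "(\<lambda>x. (1/2) *\<^sub>R (x - W x)) = inv.Res" by (simp add: fun_eq_iff inv.Res_def)
  have "((\<lambda>t. flow (- t) (inv.Res x)) has_vector_derivative flow (- t) (inv.Res x - x)) (at t within {0..})" for x t
  proof -
    have 1: "((\<lambda>t. - t) has_vector_derivative -1) (at t within {0..})"
      by (auto intro!: derivative_eq_intros)
    have "((\<lambda>t. - flow (- t) (Res (W x))) has_vector_derivative - ((-1) *\<^sub>R flow (- t) (Res (W x) - W x))) (at t within {0..})"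
      using has_vector_derivative_minus[OF vector_diff_chain_within[OF 1 flow_has_vector_derivative]]
      by (simp add: o_def)
    moreover have "inv.Res x - x = Res (W x) - W x"
    proof -
      have "inv.Res x - x - (Res (W x) - W x) = W x - x - (2 *\<^sub>R Res (W x))"
        unfolding S' by (simp add: scaleR_2)
      also have "\<dots> = 0" by (simp add: Res_def VW)
      finally show ?thesis by simp
    qed
    ultimately show ?thesis
      by (simp add: S' linear_neg[OF flow_linear])
  qed
  moreover have "continuous_on {0..} (\<lambda>t. flow (- t) x)" for x
    by (intro continuous_on_compose2[OF flow_continuous_on[of UNIV x]] continuous_intros) auto
  moreover have "inv.Res (flow (- t) x) = flow (- t) (inv.Res x)" for t x
    by (simp add: inv.Res_def flow_commute_W linear_diff[OF flow_linear] linear_scale[OF flow_linear])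
  ultimately show ?thesis
    unfolding eq resolvent_at_one_def
    using flow_contraction flow_0 inv.Res_resolvent by simp
qed

end


section \<open>Square-summable sequences\<close>

lemma scaleC_real_one: "scaleC 1 x = (x::'a::complex_hilbert)"
  using scaleC_of_real[of 1 x] by simp

lemma inner_scaleC:
  fixes x y :: "'a::complex_hilbert"
  shows "inner (scaleC a x) y = inner x (scaleC (cnj a) y)"
proof -
  have "cinner x (scaleC (cnj a) y) = cnj (cnj a * cinner y x)"
    by (subst cinner_commute) (simp add: cinner_scaleC_left)
  also have "\<dots> = a * cinner x y"
    by (simp add: cinner_commute[of x y])
  also have "\<dots> = cinner (scaleC a x) y" by (simp add: cinner_scaleC_left)
  finally show ?thesis by (metis Re_cinner)
qed

lemma norm_scaleC:
  fixes x :: "'a::complex_hilbert"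
  shows "norm (scaleC a x) = cmod a * norm x"
proof -
  have "inner (scaleC a x) (scaleC a x) = inner x ((cmod a)\<^sup>2 *\<^sub>R x)"
    unfolding inner_scaleC scaleC_scaleC scaleC_of_real[symmetric] complex_norm_square
    by (simp add: mult.commute)
  then show ?thesis
    by (simp add: norm_eq_sqrt_inner real_sqrt_mult power2_eq_square)
qed

lemma scaleC_commutes_scaleR:
  fixes x :: "'a::complex_hilbert"
  shows "scaleC a (r *\<^sub>R x) = r *\<^sub>R scaleC a x"
  by (simp add: scaleC_scaleC mult.commute flip: scaleC_of_real)

lemma bounded_linear_scaleC: "bounded_linear (scaleC a :: 'a::complex_hilbert \<Rightarrow> 'a)"
  by (rule bounded_linear_intro[where K="cmod a"])
    (simp_all add: scaleC_add_right scaleC_commutes_scaleR norm_scaleC mult.commute)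

lemma cinner_eq_Complex:
  fixes x y :: "'a::complex_hilbert"
  shows "cinner x y = Complex (inner x y) (inner x (scaleC \<i> y))"
proof -
  have "inner x (scaleC \<i> y) = inner (scaleC (- \<i>) x) y" by (simp add: inner_scaleC)
  also have "\<dots> = Im (cinner x y)"
    by (simp add: cinner_scaleC_left flip: Re_cinner)
  finally show ?thesis by (simp add: complex_eq_iff Re_cinner)
qed

text \<open>A complex structure that is compatible with a real inner product turns it into the real part of a
  hermitian form. This reduces the construction of complex Hilbert spaces to real inner products.\<close>

lemma hermitian_form_from_inner:
  fixes x y :: "'a::real_inner" and sc :: "complex \<Rightarrow> 'a \<Rightarrow> 'a"
  assumes add: "\<And>a b x. sc (a + b) x = sc a x + sc b x"
    and mul: "\<And>a b x. sc a (sc b x) = sc (a * b) x"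
    and real: "\<And>r x. sc (complex_of_real r) x = r *\<^sub>R x"
    and adj: "\<And>a x y. inner (sc a x) y = inner x (sc (cnj a) y)"
  shows "Complex (inner x y) (inner x (sc \<i> y)) = cnj (Complex (inner y x) (inner y (sc \<i> x)))"
    and "Complex (inner (sc a x) y) (inner (sc a x) (sc \<i> y)) = a * Complex (inner x y) (inner x (sc \<i> y))"
proof -
  have split: "sc a z = Re a *\<^sub>R z + Im a *\<^sub>R sc \<i> z" for a z
  proof -
    have "a = complex_of_real (Re a) + complex_of_real (Im a) * \<i>" by (simp add: complex_eq_iff)
    then have "sc a z = sc (complex_of_real (Re a) + complex_of_real (Im a) * \<i>) z" by simp
    also have "\<dots> = Re a *\<^sub>R z + Im a *\<^sub>R sc \<i> z" by (simp only: add real flip: mul)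
    finally show ?thesis .
  qed
  show "Complex (inner x y) (inner x (sc \<i> y)) = cnj (Complex (inner y x) (inner y (sc \<i> x)))"
    using adj[of \<i> x y] split[of "- \<i>" y] by (simp add: complex_eq_iff inner_commute)
  show "Complex (inner (sc a x) y) (inner (sc a x) (sc \<i> y)) = a * Complex (inner x y) (inner x (sc \<i> y))"
    using adj[of a x y] adj[of a x "sc \<i> y"] split[of "cnj a" y] split[of "cnj a * \<i>" y]
    by (simp add: complex_eq_iff mul inner_add_right inner_diff_right)
qed

typedef (overloaded) 'h square_summable = "{f :: nat \<Rightarrow> 'h::complex_hilbert. summable (\<lambda>n. (norm (f n))\<^sup>2)}"
  morphisms entry Abs_square_summable
  by (rule exI[of _ "\<lambda>_. 0"]) simp

setup_lifting type_definition_square_summable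

lemma summable_entry: "summable (\<lambda>n. (norm (entry f n))\<^sup>2)"
  using entry[of f] by simp

lemma square_summable_add:
  fixes f g :: "nat \<Rightarrow> 'h::real_inner"
  assumes "summable (\<lambda>n. (norm (f n))\<^sup>2)" "summable (\<lambda>n. (norm (g n))\<^sup>2)"
  shows "summable (\<lambda>n. (norm (f n + g n))\<^sup>2)"
proof (rule summable_comparison_test')
  show "summable (\<lambda>n. 2 * (norm (f n))\<^sup>2 + 2 * (norm (g n))\<^sup>2)"
    using assms by (intro summable_add summable_mult)
  fix n
  have "0 \<le> (norm (f n - g n))\<^sup>2" by simp
  then have "(norm (f n + g n))\<^sup>2 \<le> 2 * (norm (f n))\<^sup>2 + 2 * (norm (g n))\<^sup>2"
    unfolding power2_norm_eq_inner
    by (simp add: inner_add_left inner_add_right inner_diff_left inner_diff_right inner_commute)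
  then show "norm ((norm (f n + g n))\<^sup>2) \<le> 2 * (norm (f n))\<^sup>2 + 2 * (norm (g n))\<^sup>2" by simp
qed

lemma summable_inner_entries: "summable (\<lambda>n. inner (entry f n) (entry g n))"
proof (rule summable_comparison_test')
  show "summable (\<lambda>n. (norm (entry f n))\<^sup>2 + (norm (entry g n))\<^sup>2)"
    by (intro summable_add summable_entry)
  fix n
  have "\<bar>inner (entry f n) (entry g n)\<bar> \<le> norm (entry f n) * norm (entry g n)"
    by (rule Cauchy_Schwarz_ineq2)
  also have "\<dots> \<le> (norm (entry f n))\<^sup>2 + (norm (entry g n))\<^sup>2"
  proof -
    have "0 \<le> norm (entry f n) * norm (entry g n)" by simp
    then show ?thesis
      using sum_squares_bound[of "norm (entry f n)" "norm (entry g n)"] by linarith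
  qed
  finally show "norm (inner (entry f n) (entry g n)) \<le> (norm (entry f n))\<^sup>2 + (norm (entry g n))\<^sup>2" by simp
qed

instantiation square_summable :: (complex_hilbert) real_vector
begin
lift_definition zero_square_summable :: "'a square_summable" is "\<lambda>_. 0" by simp
lift_definition plus_square_summable :: "'a square_summable \<Rightarrow> 'a square_summable \<Rightarrow> 'a square_summable"
  is "\<lambda>f g n. f n + g n" by (rule square_summable_add)
lift_definition scaleR_square_summable :: "real \<Rightarrow> 'a square_summable \<Rightarrow> 'a square_summable"
  is "\<lambda>r f n. r *\<^sub>R f n" by (simp add: power_mult_distrib summable_mult)
lift_definition uminus_square_summable :: "'a square_summable \<Rightarrow> 'a square_summable"
  is "\<lambda>f n. - f n" by simp
lift_definition minus_square_summable :: "'a square_summable \<Rightarrow> 'a square_summable \<Rightarrow> 'a square_summable"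
  is "\<lambda>f g n. f n - g n"
proof -
  fix f g :: "nat \<Rightarrow> 'a"
  assume "summable (\<lambda>n. (norm (f n))\<^sup>2)" "summable (\<lambda>n. (norm (g n))\<^sup>2)"
  then show "summable (\<lambda>n. (norm (f n - g n))\<^sup>2)"
    using square_summable_add[of f "\<lambda>n. - g n"] by simp
qed
instance
  by standard
    (simp_all add: entry_inject[symmetric] fun_eq_iff plus_square_summable.rep_eq
      scaleR_square_summable.rep_eq uminus_square_summable.rep_eq zero_square_summable.rep_eq
      minus_square_summable.rep_eq algebra_simps)
end

lemmas entry_simps =
  plus_square_summable.rep_eq scaleR_square_summable.rep_eq uminus_square_summable.rep_eq
  zero_square_summable.rep_eq minus_square_summable.rep_eq

lemma square_summable_eqI: "(\<And>n. entry f n = entry g n) \<Longrightarrow> f = g"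
  by (simp add: entry_inject[symmetric] fun_eq_iff)

instantiation square_summable :: (complex_hilbert) real_inner
begin
definition inner_square_summable :: "'a square_summable \<Rightarrow> 'a square_summable \<Rightarrow> real"
  where "inner_square_summable f g = (\<Sum>n. inner (entry f n) (entry g n))"
definition norm_square_summable :: "'a square_summable \<Rightarrow> real"
  where "norm_square_summable f = sqrt (inner f f)"
definition dist_square_summable :: "'a square_summable \<Rightarrow> 'a square_summable \<Rightarrow> real"
  where "dist_square_summable f g = norm (f - g)"
definition sgn_square_summable :: "'a square_summable \<Rightarrow> 'a square_summable"
  where "sgn_square_summable f = f /\<^sub>R norm f"
definition uniformity_square_summable :: "('a square_summable \<times> 'a square_summable) filter" where
  "uniformity_square_summable = (INF e\<in>{0<..}. principal {(x, y). dist x y < e})"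
definition open_square_summable :: "'a square_summable set \<Rightarrow> bool" where
  "open_square_summable S = (\<forall>x\<in>S. \<forall>\<^sub>F (x', y) in uniformity. x' = x \<longrightarrow> y \<in> S)"
instance
proof
  fix f g h :: "'a square_summable" and r :: real
  show "inner f g = inner g f"
    by (simp add: inner_square_summable_def inner_commute)
  show "inner (f + g) h = inner f h + inner g h"
    by (simp add: inner_square_summable_def entry_simps inner_add_left suminf_add summable_inner_entries)
  show "inner (r *\<^sub>R f) g = r * inner f g"
    by (simp add: inner_square_summable_def entry_simps suminf_mult summable_inner_entries)
  show "0 \<le> inner f f"
    unfolding inner_square_summable_def by (intro suminf_nonneg summable_inner_entries) simp
  show "inner f f = 0 \<longleftrightarrow> f = 0"
    unfolding inner_square_summable_def
    by (subst suminf_eq_zero_iff)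
      (auto simp: summable_inner_entries entry_simps intro: square_summable_eqI)
qed (simp_all add: norm_square_summable_def dist_square_summable_def sgn_square_summable_def
    uniformity_square_summable_def open_square_summable_def)
end

lemma norm_square_summable: "(norm f)\<^sup>2 = (\<Sum>n. (norm (entry f n))\<^sup>2)"
  by (simp add: power2_norm_eq_inner inner_square_summable_def)

lemma norm_entry_le: "norm (entry f n) \<le> norm f"
proof (rule power2_le_imp_le)
  show "(norm (entry f n))\<^sup>2 \<le> (norm f)\<^sup>2"
    unfolding norm_square_summable
    using sum_le_suminf[OF summable_entry[of f], of "{n}"] by simp
qed simp

text \<open>Fatou's lemma for sequences with a uniform bound on their partial sums of squares.\<close>

lemma norm_square_summable_le:
  fixes f :: "nat \<Rightarrow> 'h::complex_hilbert"
  assumes "0 \<le> c" "\<And>n. (\<Sum>k<n. (norm (f k))\<^sup>2) \<le> c\<^sup>2"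
  obtains g where "entry g = f" "norm g \<le> c"
proof -
  have s: "summable (\<lambda>n. (norm (f n))\<^sup>2)"
  proof (rule bounded_imp_summable)
    show "(\<Sum>k\<le>n. (norm (f k))\<^sup>2) \<le> c\<^sup>2" for n
      using assms(2)[of "Suc n"] by (simp add: lessThan_Suc_atMost)
  qed simp
  then have e: "entry (Abs_square_summable f) = f" by (simp add: Abs_square_summable_inverse)
  moreover have "norm (Abs_square_summable f) \<le> c"
    using suminf_le_const[OF s assms(2)] assms(1)
    by (intro power2_le_imp_le[OF _ assms(1)]) (simp add: norm_square_summable e)
  ultimately show ?thesis by (rule that)
qed

instance square_summable :: (complex_hilbert) complete_space
proof
  fix F :: "nat \<Rightarrow> 'a square_summable"
  assume F: "Cauchy F"
  have "Cauchy (\<lambda>m. entry (F m) n)" for n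
  proof (rule metric_CauchyI)
    fix e :: real assume "e > 0"
    then obtain N where "\<And>m k. m \<ge> N \<Longrightarrow> k \<ge> N \<Longrightarrow> dist (F m) (F k) < e"
      using metric_CauchyD[OF F] by metis
    moreover have "dist (entry (F m) n) (entry (F k) n) \<le> dist (F m) (F k)" for m k
      using norm_entry_le[of "F m - F k" n] by (simp add: dist_norm entry_simps)
    ultimately show "\<exists>N. \<forall>m\<ge>N. \<forall>k\<ge>N. dist (entry (F m) n) (entry (F k) n) < e"
      by (meson order_le_less_trans)
  qed
  then have "\<exists>l. (\<lambda>m. entry (F m) n) \<longlonglongrightarrow> l" for n
    using Cauchy_convergent convergent_def by blast
  then obtain g where g: "\<And>n. (\<lambda>m. entry (F m) n) \<longlonglongrightarrow> g n" by metis
  have close: "\<exists>N. \<forall>m\<ge>N. \<exists>d. entry d = (\<lambda>n. entry (F m) n - g n) \<and> norm d \<le> e" if e: "e > 0" for e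
  proof -
    obtain N where N: "\<And>m k. m \<ge> N \<Longrightarrow> k \<ge> N \<Longrightarrow> dist (F m) (F k) < e"
      using metric_CauchyD[OF F e] by metis
    have "\<exists>d. entry d = (\<lambda>n. entry (F m) n - g n) \<and> norm d \<le> e" if m: "m \<ge> N" for m
    proof -
      have "(\<Sum>k<n. (norm (entry (F m) k - g k))\<^sup>2) \<le> e\<^sup>2" for n
      proof (rule tendsto_le[OF _ tendsto_const])
        show "(\<lambda>j. \<Sum>k<n. (norm (entry (F m) k - entry (F j) k))\<^sup>2) \<longlonglongrightarrow> (\<Sum>k<n. (norm (entry (F m) k - g k))\<^sup>2)"
          by (intro tendsto_intros g)
        show "\<forall>\<^sub>F j in sequentially. (\<Sum>k<n. (norm (entry (F m) k - entry (F j) k))\<^sup>2) \<le> e\<^sup>2"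
          using eventually_ge_at_top[of N]
        proof eventually_elim
          case (elim j)
          have "(\<Sum>k<n. (norm (entry (F m - F j) k))\<^sup>2) \<le> (norm (F m - F j))\<^sup>2"
            unfolding norm_square_summable by (intro sum_le_suminf summable_entry) auto
          also have "\<dots> \<le> e\<^sup>2"
            using N[OF m elim] by (intro power_mono) (auto simp: dist_norm)
          finally show ?case by (simp add: entry_simps)
        qed
      qed simp
      then show ?thesis
        using norm_square_summable_le[of e "\<lambda>n. entry (F m) n - g n"] e by (metis less_imp_le)
    qed
    then show ?thesis by blast
  qed
  obtain N d where d: "entry d = (\<lambda>n. entry (F N) n - g n)"
    using close[of 1] by auto
  \<comment> \<open>The entrywise limit \<open>g\<close> is square-summable because it differs from some \<open>F N\<close> by a square-summable sequence.\<close>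
  define G where "G = F N - d"
  have G: "entry G n = g n" for n by (simp add: G_def entry_simps d)
  have "F \<longlonglongrightarrow> G"
  proof (rule metric_LIMSEQ_I)
    fix e :: real assume e: "e > 0"
    then obtain N where N: "\<And>m. m \<ge> N \<Longrightarrow> \<exists>d. entry d = (\<lambda>n. entry (F m) n - g n) \<and> norm d \<le> e / 2"
      using close[of "e / 2"] by auto
    have "dist (F m) G < e" if m: "m \<ge> N" for m
    proof -
      obtain d where d: "entry d = (\<lambda>n. entry (F m) n - g n)" "norm d \<le> e / 2"
        using N[OF m] by blast
      have "F m - G = d" by (rule square_summable_eqI) (simp add: entry_simps G d)
      then show ?thesis using d(2) e by (simp add: dist_norm)
    qed
    then show "\<exists>N. \<forall>m\<ge>N. dist (F m) G < e" by blast
  qed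
  then show "convergent F" by (rule convergentI)
qed

instantiation square_summable :: (complex_hilbert) complex_hilbert
begin
lift_definition scaleC_square_summable :: "complex \<Rightarrow> 'a square_summable \<Rightarrow> 'a square_summable"
  is "\<lambda>a f n. scaleC a (f n)"
  by (simp add: norm_scaleC power_mult_distrib summable_mult)
definition cinner_square_summable :: "'a square_summable \<Rightarrow> 'a square_summable \<Rightarrow> complex"
  where "cinner_square_summable f g = Complex (inner f g) (inner f (scaleC \<i> g))"
instance
proof
  fix a b :: complex and f g h :: "'a square_summable" and r :: real
  show 1: "scaleC a (f + g) = scaleC a f + scaleC a g"
    by (rule square_summable_eqI) (simp add: entry_simps scaleC_square_summable.rep_eq scaleC_add_right)
  have add: "scaleC (a + b) f = scaleC a f + scaleC b f" for a b and f :: "'a square_summable"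
    by (rule square_summable_eqI) (simp add: entry_simps scaleC_square_summable.rep_eq scaleC_add_left)
  show "scaleC (a + b) f = scaleC a f + scaleC b f" by (rule add)
  have mul: "scaleC a (scaleC b f) = scaleC (a * b) f" for a b and f :: "'a square_summable"
    by (rule square_summable_eqI) (simp add: scaleC_square_summable.rep_eq scaleC_scaleC)
  show "scaleC a (scaleC b f) = scaleC (a * b) f" by (rule mul)
  have real: "scaleC (complex_of_real r) f = r *\<^sub>R f" for r and f :: "'a square_summable"
    by (rule square_summable_eqI) (simp add: entry_simps scaleC_square_summable.rep_eq scaleC_of_real)
  show "scaleC (complex_of_real r) f = r *\<^sub>R f" by (rule real)
  have adj: "inner (scaleC a f) g = inner f (scaleC (cnj a) g)" for a and f g :: "'a square_summable"
    by (simp add: inner_square_summable_def scaleC_square_summable.rep_eq inner_scaleC)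
  show "cinner f g = cnj (cinner g f)"
    unfolding cinner_square_summable_def by (rule hermitian_form_from_inner[OF add mul real adj])
  show "cinner (scaleC a f) g = a * cinner f g"
    unfolding cinner_square_summable_def by (rule hermitian_form_from_inner[OF add mul real adj])
  show "cinner (f + g) h = cinner f h + cinner g h"
    by (simp add: cinner_square_summable_def inner_add_left complex_eq_iff)
  show "Re (cinner f g) = inner f g" by (simp add: cinner_square_summable_def)
qed
end

instantiation prod :: (complex_hilbert, complex_hilbert) complex_hilbert
begin
definition scaleC_prod :: "complex \<Rightarrow> 'a \<times> 'b \<Rightarrow> 'a \<times> 'b"
  where "scaleC_prod a x = (scaleC a (fst x), scaleC a (snd x))"
definition cinner_prod :: "'a \<times> 'b \<Rightarrow> 'a \<times> 'b \<Rightarrow> complex"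
  where "cinner_prod x y = cinner (fst x) (fst y) + cinner (snd x) (snd y)"
instance
proof
  fix x y :: "'a \<times> 'b"
  show "cinner x y = cnj (cinner y x)"
    by (simp add: cinner_prod_def cinner_commute[of "fst x"] cinner_commute[of "snd x"])
qed (simp_all add: scaleC_prod_def cinner_prod_def prod_eq_iff inner_prod_def scaleC_add_right
    scaleC_add_left scaleC_scaleC scaleC_of_real cinner_add_left cinner_scaleC_left Re_cinner algebra_simps)
end

lift_definition l2_cons :: "'h::complex_hilbert \<Rightarrow> 'h square_summable \<Rightarrow> 'h square_summable"
  is "\<lambda>y f n. case n of 0 \<Rightarrow> y | Suc m \<Rightarrow> f m"
  by (subst summable_Suc_iff[symmetric]) simp

lift_definition l2_tl :: "'h::complex_hilbert square_summable \<Rightarrow> 'h square_summable"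
  is "\<lambda>f n. f (Suc n)"
  by (subst summable_Suc_iff)

abbreviation l2_hd :: "'h::complex_hilbert square_summable \<Rightarrow> 'h" where "l2_hd f \<equiv> entry f 0"

lemma l2_tl_cons [simp]: "l2_tl (l2_cons y f) = f" and l2_hd_cons [simp]: "l2_hd (l2_cons y f) = y"
  by (auto intro: square_summable_eqI simp: l2_tl.rep_eq l2_cons.rep_eq)

lemma l2_cons_hd_tl [simp]: "l2_cons (l2_hd f) (l2_tl f) = f"
  by (rule square_summable_eqI) (simp add: l2_tl.rep_eq l2_cons.rep_eq split: nat.split)

lemma l2_cons_add: "l2_cons (x + y) (f + g) = l2_cons x f + l2_cons y g"
  by (rule square_summable_eqI) (simp add: l2_cons.rep_eq entry_simps split: nat.split)

lemma l2_cons_scaleR: "l2_cons (r *\<^sub>R x) (r *\<^sub>R f) = r *\<^sub>R l2_cons x f"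
  by (rule square_summable_eqI) (simp add: l2_cons.rep_eq entry_simps split: nat.split)

lemma l2_cons_scaleC: "l2_cons (scaleC c x) (scaleC c f) = scaleC c (l2_cons x f)"
  by (rule square_summable_eqI) (simp add: l2_cons.rep_eq scaleC_square_summable.rep_eq split: nat.split)

lemma l2_tl_add: "l2_tl (f + g) = l2_tl f + l2_tl g"
  and l2_tl_scaleR: "l2_tl (r *\<^sub>R f) = r *\<^sub>R l2_tl f"
  and l2_tl_scaleC: "l2_tl (scaleC c f) = scaleC c (l2_tl f)"
  by (rule square_summable_eqI, simp add: l2_tl.rep_eq entry_simps scaleC_square_summable.rep_eq)+

lemma norm_l2_cons: "(norm (l2_cons y f))\<^sup>2 = (norm y)\<^sup>2 + (norm f)\<^sup>2"
  unfolding norm_square_summable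
  using suminf_split_head[OF summable_entry[of "l2_cons y f"]]
  by (simp add: l2_cons.rep_eq)

lemma norm_l2_tl: "(norm f)\<^sup>2 = (norm (l2_hd f))\<^sup>2 + (norm (l2_tl f))\<^sup>2"
  using norm_l2_cons[of "l2_hd f" "l2_tl f"] by simp

lemma contraction_l2_tl: "contraction l2_tl"
  unfolding contraction_def
proof (intro conjI allI linearI)
  show "norm (l2_tl f) \<le> norm f" for f :: "'a square_summable"
    by (rule power2_le_imp_le) (simp_all add: norm_l2_tl[of f])
qed (simp_all add: l2_tl_add l2_tl_scaleR)

lemma l2_tl_fixpoint:
  assumes "l2_tl f = f"
  shows "f = 0"
proof -
  have "entry f (Suc n) = entry f n" for n
    using arg_cong[OF assms, of "\<lambda>g. entry g n"] by (simp add: l2_tl.rep_eq)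
  then have const: "entry f n = entry f 0" for n
    by (induction n) simp_all
  have "(\<lambda>_::nat. (norm (entry f 0))\<^sup>2) \<longlonglongrightarrow> 0"
  proof (rule Lim_transform_eventually[OF summable_LIMSEQ_zero[OF summable_entry[of f]]])
    show "\<forall>\<^sub>F n in sequentially. (norm (entry f n))\<^sup>2 = (norm (entry f 0))\<^sup>2"
      by (intro always_eventually allI) (subst const, rule refl)
  qed
  then have zero: "entry f 0 = 0" by (simp add: LIMSEQ_const_iff)
  show ?thesis
  proof (rule square_summable_eqI)
    show "entry f n = entry 0 n" for n
      by (rule trans[OF const]) (simp add: zero entry_simps)
  qed
qed

lemma l2_cons_tendsto:
  assumes "((\<lambda>a. y a) \<longlongrightarrow> y') F"
  shows "((\<lambda>a. l2_cons (y a) f) \<longlongrightarrow> l2_cons y' f) F"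
proof -
  have eq: "norm (l2_cons (y a) f - l2_cons y' f) = norm (y a - y')" for a
  proof -
    have "l2_cons (y a) f - l2_cons y' f = l2_cons (y a - y') 0"
      by (rule square_summable_eqI) (simp add: l2_cons.rep_eq entry_simps split: nat.split)
    moreover have "norm (l2_cons (y a - y') 0) = norm (y a - y')"
      by (rule power2_eq_imp_eq) (simp_all add: norm_l2_cons)
    ultimately show ?thesis by simp
  qed
  have "((\<lambda>a. norm (l2_cons (y a) f - l2_cons y' f)) \<longlongrightarrow> 0) F"
    unfolding eq by (rule tendsto_norm_zero[OF LIM_zero[OF assms]])
  then show ?thesis by (rule LIM_zero_cancel[OF tendsto_norm_zero_cancel])
qed


section \<open>Schaeffer dilations of cogenerators\<close>

text \<open>The square root of \<open>1 - C\<^sup>* C\<close>; likewise \<open>codefect C\<close> is the one of \<open>1 - C C\<^sup>*\<close>.\<close>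

definition defect :: "('h::complex_hilbert \<Rightarrow> 'h) \<Rightarrow> 'h \<Rightarrow> 'h" where
  "defect C = root_one_minus (\<lambda>x. adjoint C (C x))"

definition codefect :: "('h::complex_hilbert \<Rightarrow> 'h) \<Rightarrow> 'h \<Rightarrow> 'h" where
  "codefect C = root_one_minus (\<lambda>x. C (adjoint C x))"

type_synonym 'h schaeffer_space = "'h square_summable \<times> 'h \<times> 'h square_summable"

text \<open>A triple \<open>(a, x, b)\<close> is the two-sided sequence \<open>\<dots>, a\<^sub>1, a\<^sub>0, x, b\<^sub>0, b\<^sub>1, \<dots>\<close>. It is shifted by one
  place to the right, and the pair \<open>(x, a\<^sub>0)\<close> is transformed by Halmos' unitary matrix
  on its way to the places of \<open>x\<close> and \<open>b\<^sub>0\<close>.\<close>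

definition schaeffer :: "('h::complex_hilbert \<Rightarrow> 'h) \<Rightarrow> 'h schaeffer_space \<Rightarrow> 'h schaeffer_space" where
  "schaeffer C = (\<lambda>(a, x, b). (l2_tl a, C x + codefect C (l2_hd a), l2_cons (defect C x - adjoint C (l2_hd a)) b))"

definition schaeffer_inv :: "('h::complex_hilbert \<Rightarrow> 'h) \<Rightarrow> 'h schaeffer_space \<Rightarrow> 'h schaeffer_space" where
  "schaeffer_inv C = (\<lambda>(a, x, b). (l2_cons (codefect C x - C (l2_hd b)) a, adjoint C x + defect C (l2_hd b), l2_tl b))"

context
  fixes C :: "'h::complex_hilbert \<Rightarrow> 'h"
  assumes C: "contraction C"
begin

lemma inner_adjoint: "inner (C x) y = inner x (adjoint C y)"
  by (rule adjoint_inner[OF contraction_bounded_linear[OF C]])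

lemma adjoint_inner_left: "inner (adjoint C x) y = inner x (C y)"
  using inner_adjoint[of y x] by (simp add: inner_commute)

lemma contraction_adj_C: "contraction (\<lambda>x. adjoint C (C x))"
  and contraction_C_adj: "contraction (\<lambda>x. C (adjoint C x))"
  by (rule contraction_compose[OF contraction_adjoint[OF C] C])
    (rule contraction_compose[OF C contraction_adjoint[OF C]])

lemma linear_C: "linear C" and linear_adj_C: "linear (adjoint C)"
  using C contraction_adjoint[OF C] by (simp_all add: contraction_def)

lemma linear_defect: "linear (defect C)" and linear_codefect: "linear (codefect C)"
  unfolding defect_def codefect_def
  by (intro bounded_linear.linear bounded_linear_root contraction_adj_C contraction_C_adj)+

lemma defect_defect: "defect C (defect C x) = x - adjoint C (C x)"
  unfolding defect_def by (rule root_root[OF contraction_adj_C])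

lemma codefect_codefect: "codefect C (codefect C x) = x - C (adjoint C x)"
  unfolding codefect_def by (rule root_root[OF contraction_C_adj])

lemma C_defect: "C (defect C x) = codefect C (C x)"
  unfolding defect_def codefect_def
  by (rule root_intertwine[OF contraction_adj_C contraction_C_adj contraction_bounded_linear[OF C]]) simp

lemma adj_codefect: "adjoint C (codefect C x) = defect C (adjoint C x)"
  unfolding defect_def codefect_def
  by (rule root_intertwine[OF contraction_C_adj contraction_adj_C
        contraction_bounded_linear[OF contraction_adjoint[OF C]]]) simp

lemma inner_defect: "inner (defect C x) y = inner x (defect C y)"
  unfolding defect_def
  by (rule root_selfadjoint[OF contraction_adj_C]) (simp add: inner_adjoint adjoint_inner_left)

lemma inner_codefect: "inner (codefect C x) y = inner x (codefect C y)"
  unfolding codefect_def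
  by (rule root_selfadjoint[OF contraction_C_adj]) (simp add: inner_adjoint adjoint_inner_left)

text \<open>The mixed terms cancel because \<open>C (defect C x) = codefect C (C x)\<close>.\<close>

lemma Halmos_isometry:
  "(norm (C x + codefect C y))\<^sup>2 + (norm (defect C x - adjoint C y))\<^sup>2 = (norm x)\<^sup>2 + (norm y)\<^sup>2"
proof -
  have 1: "inner (C x) (C x) + inner (defect C x) (defect C x) = inner x x"
    by (simp add: inner_defect defect_defect inner_adjoint inner_diff_right)
  have 2: "inner (codefect C y) (codefect C y) + inner (adjoint C y) (adjoint C y) = inner y y"
    by (simp add: inner_codefect codefect_codefect adjoint_inner_left inner_diff_right)
  have 3: "inner (C x) (codefect C y) = inner (defect C x) (adjoint C y)"
    using inner_codefect[of "C x" y] inner_adjoint[of "defect C x" y] by (simp add: C_defect)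
  have "inner (C x + codefect C y) (C x + codefect C y) =
      inner (C x) (C x) + 2 * inner (C x) (codefect C y) + inner (codefect C y) (codefect C y)"
    by (simp only: inner_add_left inner_add_right) (simp add: inner_commute[of "codefect C y" "C x"])
  moreover have "inner (defect C x - adjoint C y) (defect C x - adjoint C y) =
      inner (defect C x) (defect C x) - 2 * inner (defect C x) (adjoint C y) + inner (adjoint C y) (adjoint C y)"
    by (simp only: inner_diff_left inner_diff_right) (simp add: inner_commute[of "adjoint C y" "defect C x"])
  ultimately show ?thesis
    unfolding power2_norm_eq_inner using 1 2 3 by linarith
qed

lemma schaeffer_linear: "linear (schaeffer C)"
proof
  fix k l :: "'h schaeffer_space" and r :: real
  obtain a x b where k: "k = (a, x, b)" by (cases k)
  obtain a' x' b' where l: "l = (a', x', b')" by (cases l)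
  have "defect C (x + x') - adjoint C (l2_hd a + l2_hd a') =
      (defect C x - adjoint C (l2_hd a)) + (defect C x' - adjoint C (l2_hd a'))"
    by (simp add: linear_add[OF linear_adj_C] linear_add[OF linear_defect])
  then show "schaeffer C (k + l) = schaeffer C k + schaeffer C l"
    by (simp add: k l schaeffer_def l2_tl_add entry_simps linear_add[OF linear_C]
        linear_add[OF linear_codefect] l2_cons_add)
  have "defect C (r *\<^sub>R x) - adjoint C (r *\<^sub>R l2_hd a) = r *\<^sub>R (defect C x - adjoint C (l2_hd a))"
    by (simp add: linear_scale[OF linear_adj_C] linear_scale[OF linear_defect] scaleR_diff_right)
  then show "schaeffer C (r *\<^sub>R k) = r *\<^sub>R schaeffer C k"
    by (simp add: k schaeffer_def l2_tl_scaleR entry_simps linear_scale[OF linear_C]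
        linear_scale[OF linear_codefect] scaleR_add_right l2_cons_scaleR)
qed

lemma schaeffer_isometric: "norm (schaeffer C k) = norm k"
proof -
  obtain a x b where k: "k = (a, x, b)" by (cases k)
  have "(norm (schaeffer C k))\<^sup>2 = (norm k)\<^sup>2"
    using Halmos_isometry[of x "l2_hd a"] norm_l2_tl[of a]
    by (simp add: k schaeffer_def norm_Pair norm_l2_cons)
  then show ?thesis by (rule power2_eq_imp_eq) simp_all
qed

lemma schaeffer_schaeffer_inv: "schaeffer C (schaeffer_inv C k) = k"
proof -
  obtain a x b where k: "k = (a, x, b)" by (cases k)
  show ?thesis
    by (simp add: k schaeffer_def schaeffer_inv_def linear_add[OF linear_C] linear_diff[OF linear_codefect]
        linear_add[OF linear_defect] linear_diff[OF linear_adj_C] C_defect adj_codefect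
        codefect_codefect defect_defect)
qed

lemma schaeffer_inv_schaeffer: "schaeffer_inv C (schaeffer C k) = k"
proof -
  obtain a x b where k: "k = (a, x, b)" by (cases k)
  show ?thesis
    by (simp add: k schaeffer_def schaeffer_inv_def linear_diff[OF linear_C] linear_add[OF linear_codefect]
        linear_diff[OF linear_defect] linear_add[OF linear_adj_C] C_defect adj_codefect
        codefect_codefect defect_defect)
qed

text \<open>In a fixed triple, \<open>a\<close> is a constant sequence and hence zero; then \<open>x\<close> is fixed under \<open>C\<close>, and
  \<open>b\<close> is constant, too.\<close>

lemma fixpoint_free_unitary_schaeffer:
  assumes fp: "\<And>x. C x = x \<Longrightarrow> x = 0"
  shows "fixpoint_free_unitary (schaeffer C) (schaeffer_inv C)"
proof (rule fixpoint_free_unitary.intro)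
  fix k :: "'h schaeffer_space"
  assume eq: "schaeffer C k = k"
  obtain a x b where k: "k = (a, x, b)" by (cases k)
  have "a = 0" using eq by (intro l2_tl_fixpoint) (simp add: k schaeffer_def)
  then have hd: "l2_hd a = 0" by (simp add: entry_simps)
  have "x = 0"
    using eq by (intro fp) (simp add: k schaeffer_def hd linear_0[OF linear_codefect])
  have "l2_cons 0 b = b"
    using eq by (simp add: k schaeffer_def hd \<open>x = 0\<close> linear_0[OF linear_defect] linear_0[OF linear_adj_C])
  then have "l2_tl b = b" using l2_tl_cons[of 0 b] by simp
  then have "b = 0" by (rule l2_tl_fixpoint)
  with \<open>a = 0\<close> \<open>x = 0\<close> show "k = 0" by (simp add: k zero_prod_def)
qed (fact schaeffer_linear schaeffer_isometric schaeffer_schaeffer_inv schaeffer_inv_schaeffer)+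

lemma schaeffer_complex_linear:
  assumes Cc: "\<And>c x. C (scaleC c x) = scaleC c (C x)"
  shows "schaeffer C (scaleC c k) = scaleC c (schaeffer C k)"
proof -
  have adj: "adjoint C (scaleC c x) = scaleC c (adjoint C x)" for c x
  proof (rule adjoint_eqI[OF contraction_bounded_linear[OF C]])
    fix y
    have "inner (C y) (scaleC c x) = inner (C (scaleC (cnj c) y)) x"
      using inner_scaleC[of "cnj c" "C y" x] by (simp add: Cc)
    also have "\<dots> = inner (scaleC (cnj c) y) (adjoint C x)" by (rule inner_adjoint)
    also have "\<dots> = inner y (scaleC c (adjoint C x))"
      using inner_scaleC[of "cnj c" y "adjoint C x"] by simp
    finally show "inner (C y) (scaleC c x) = inner y (scaleC c (adjoint C x))" .
  qed
  have D: "defect C (scaleC c x) = scaleC c (defect C x)" for c x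
    unfolding defect_def
    by (rule root_intertwine[OF contraction_adj_C contraction_adj_C bounded_linear_scaleC, symmetric])
      (simp add: Cc adj)
  have D': "codefect C (scaleC c x) = scaleC c (codefect C x)" for c x
    unfolding codefect_def
    by (rule root_intertwine[OF contraction_C_adj contraction_C_adj bounded_linear_scaleC, symmetric])
      (simp add: Cc adj)
  have diff: "scaleC c x - scaleC c y = scaleC c (x - y)" for x y :: 'h
    using linear_diff[OF bounded_linear.linear[OF bounded_linear_scaleC], of c x y] by simp
  obtain a x b where k: "k = (a, x, b)" by (cases k)
  show ?thesis
    by (simp add: k schaeffer_def scaleC_prod_def l2_tl_scaleC scaleC_square_summable.rep_eq
        Cc adj D D' scaleC_add_right diff l2_cons_scaleC)
qed

end

lemma strong_convergence_compose:
  assumes "\<forall>\<^sub>F a in F. contraction (X a)"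
    and X: "\<And>x. ((\<lambda>a. X a x) \<longlongrightarrow> X' x) F" and Y: "\<And>x. ((\<lambda>a. Y a x) \<longlongrightarrow> Y' x) F"
  shows "((\<lambda>a. X a (Y a x)) \<longlongrightarrow> X' (Y' x)) F"
proof -
  have "((\<lambda>a. norm (Y a x - Y' x) + norm (X a (Y' x) - X' (Y' x))) \<longlongrightarrow> 0 + 0) F"
    by (intro tendsto_add tendsto_norm_zero LIM_zero X Y)
  then have "((\<lambda>a. norm (Y a x - Y' x) + norm (X a (Y' x) - X' (Y' x))) \<longlongrightarrow> 0) F" by simp
  then have "((\<lambda>a. X a (Y a x) - X' (Y' x)) \<longlongrightarrow> 0) F"
  proof (rule Lim_null_comparison[rotated])
    show "\<forall>\<^sub>F a in F. norm (X a (Y a x) - X' (Y' x)) \<le> norm (Y a x - Y' x) + norm (X a (Y' x) - X' (Y' x))"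
      using assms(1)
    proof eventually_elim
      case (elim a)
      have "norm (X a (Y a x) - X' (Y' x)) \<le> norm (X a (Y a x) - X a (Y' x)) + norm (X a (Y' x) - X' (Y' x))"
        using norm_triangle_ineq[of "X a (Y a x) - X a (Y' x)" "X a (Y' x) - X' (Y' x)"] by simp
      then show ?case using contraction_diff[OF elim, of "Y a x" "Y' x"] by linarith
    qed
  qed
  then show ?thesis by (rule LIM_zero_cancel)
qed

lemma schaeffer_tendsto:
  fixes C :: "'w \<Rightarrow> 'h::complex_hilbert \<Rightarrow> 'h"
  assumes C: "\<forall>\<^sub>F a in F. contraction (C a)" and C': "contraction C'"
    and lim: "\<And>x. ((\<lambda>a. C a x) \<longlongrightarrow> C' x) F"
    and lim': "\<And>x. ((\<lambda>a. adjoint (C a) x) \<longlongrightarrow> adjoint C' x) F"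
  shows "((\<lambda>a. schaeffer (C a) k) \<longlongrightarrow> schaeffer C' k) F"
    and "((\<lambda>a. schaeffer_inv (C a) k) \<longlongrightarrow> schaeffer_inv C' k) F"
proof -
  have A: "\<forall>\<^sub>F a in F. contraction (adjoint (C a))"
    using C by (rule eventually_mono) (rule contraction_adjoint)
  have D: "((\<lambda>a. defect (C a) x) \<longlongrightarrow> defect C' x) F" for x
    unfolding defect_def
  proof (rule root_strong_convergence)
    show "\<forall>\<^sub>F a in F. contraction (\<lambda>x. adjoint (C a) (C a x))"
      using C by (rule eventually_mono) (rule contraction_adj_C)
  qed (intro contraction_adj_C C' strong_convergence_compose[OF A lim' lim])+
  have D': "((\<lambda>a. codefect (C a) x) \<longlongrightarrow> codefect C' x) F" for x
    unfolding codefect_def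
  proof (rule root_strong_convergence)
    show "\<forall>\<^sub>F a in F. contraction (\<lambda>x. C a (adjoint (C a) x))"
      using C by (rule eventually_mono) (rule contraction_C_adj)
  qed (intro contraction_C_adj C' strong_convergence_compose[OF C lim lim'])+
  obtain a x b where k: "k = (a, x, b)" by (cases k)
  show "((\<lambda>a. schaeffer (C a) k) \<longlongrightarrow> schaeffer C' k) F"
    unfolding k schaeffer_def case_prod_conv
    by (intro tendsto_Pair tendsto_const tendsto_add tendsto_diff l2_cons_tendsto lim lim' D D')
  show "((\<lambda>a. schaeffer_inv (C a) k) \<longlongrightarrow> schaeffer_inv C' k) F"
    unfolding k schaeffer_inv_def case_prod_conv
    by (intro tendsto_Pair tendsto_const tendsto_add tendsto_diff l2_cons_tendsto lim lim' D D')
qed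

definition cogenerator :: "(real \<Rightarrow> 'h \<Rightarrow> 'h) \<Rightarrow> 'h \<Rightarrow> 'h::complex_hilbert" where
  "cogenerator T x = x - 2 *\<^sub>R Laplace T x"

definition dilation_group :: "(real \<Rightarrow> 'h \<Rightarrow> 'h) \<Rightarrow> real \<Rightarrow> 'h schaeffer_space \<Rightarrow> 'h::complex_hilbert schaeffer_space" where
  "dilation_group T = fixpoint_free_unitary.flow (schaeffer (cogenerator T)) (schaeffer_inv (cogenerator T))"

context
  fixes T :: "real \<Rightarrow> 'h::complex_hilbert \<Rightarrow> 'h"
  assumes T: "contraction_semigroup T"
begin

lemma Laplace_dissipative: "dissipative_resolvent (Laplace T)"
  using resolvent_at_one_Laplace[OF T] by (simp add: resolvent_at_one_def)

lemma cogenerator_contraction: "contraction (cogenerator T)"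
  using Laplace_dissipative by (simp add: dissipative_resolvent_def cogenerator_def[abs_def])

lemma dilation_unitary: "fixpoint_free_unitary (schaeffer (cogenerator T)) (schaeffer_inv (cogenerator T))"
proof (rule fixpoint_free_unitary_schaeffer[OF cogenerator_contraction])
  fix x assume "cogenerator T x = x"
  then have "Laplace T x = 0" by (simp add: cogenerator_def)
  then show "x = 0" using Laplace_dissipative by (simp add: dissipative_resolvent_def)
qed

interpretation V: fixpoint_free_unitary "schaeffer (cogenerator T)" "schaeffer_inv (cogenerator T)"
  by (rule dilation_unitary)

lemma dilation_group_eq: "dilation_group T = V.flow"
  by (simp add: dilation_group_def)

lemmas dilation_group_linear = V.flow_linear[folded dilation_group_eq]
lemmas dilation_group_isometric = V.flow_isometric[folded dilation_group_eq]
lemmas dilation_group_0 = V.flow_0[folded dilation_group_eq]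
lemmas dilation_group_add = V.flow_add[folded dilation_group_eq]
lemmas dilation_group_continuous_on = V.flow_continuous_on[folded dilation_group_eq]

lemma dilation_group_resolvent:
  "resolvent_at_one (dilation_group T) (\<lambda>k. (1/2) *\<^sub>R (k - schaeffer (cogenerator T) k))"
  using V.flow_resolvent by (simp add: V.Res_def[abs_def] dilation_group_eq)

lemma dilation_group_reverse_resolvent:
  "resolvent_at_one (\<lambda>t. dilation_group T (- t)) (\<lambda>k. (1/2) *\<^sub>R (k - schaeffer_inv (cogenerator T) k))"
  using V.flow_reverse_resolvent by (simp add: dilation_group_eq)

lemma dilation_group_minus: "dilation_group T t (dilation_group T (- t) k) = k"
  using dilation_group_add[of t "- t" k] by (simp add: dilation_group_0)

lemma dilation_group_inner: "inner (dilation_group T t k) l = inner k (dilation_group T (- t) l)"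
proof -
  have iso: "inner (dilation_group T t x) (dilation_group T t y) = inner x y" for x y
  proof -
    have n: "inner (dilation_group T t z) (dilation_group T t z) = inner z z" for z
      using dilation_group_isometric[of t z] by (simp add: norm_eq_sqrt_inner)
    show ?thesis
      using n[of "x + y"] n[of x] n[of y]
      by (simp add: linear_add[OF dilation_group_linear] inner_add_left inner_add_right inner_commute)
  qed
  from iso[of k "dilation_group T (- t) l"] show ?thesis by (simp add: dilation_group_minus)
qed

lemma dilation_group_complex_linear:
  assumes Tc: "\<And>t c x. t \<ge> 0 \<Longrightarrow> T t (scaleC c x) = scaleC c (T t x)"
  shows "dilation_group T t (scaleC c k) = scaleC c (dilation_group T t k)"
proof -
  have R: "Laplace T (scaleC c x) = scaleC c (Laplace T x)" for c x
    by (rule Laplace_commute[OF T bounded_linear_scaleC, symmetric]) (rule Tc[symmetric])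
  have C: "cogenerator T (scaleC c x) = scaleC c (cogenerator T x)" for c x
    using linear_diff[OF bounded_linear.linear[OF bounded_linear_scaleC], of c x "2 *\<^sub>R Laplace T x"]
    by (simp only: cogenerator_def R scaleC_commutes_scaleR)
  let ?S = "\<lambda>k. (1/2) *\<^sub>R (k - schaeffer (cogenerator T) k)"
  have S: "scaleC c (?S k) = ?S (scaleC c k)" for k :: "'h schaeffer_space"
    using linear_diff[OF bounded_linear.linear[OF bounded_linear_scaleC], of c k "schaeffer (cogenerator T) k"]
    by (simp only: scaleC_commutes_scaleR schaeffer_complex_linear[OF cogenerator_contraction C])
  have pos: "dilation_group T s (scaleC c l) = scaleC c (dilation_group T s l)" if "s \<ge> 0" for s l
  proof (rule resolvent_intertwine[OF dilation_group_resolvent dilation_group_resolvent bounded_linear_scaleC that, symmetric])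
    show "scaleC c (?S (dilation_group T r l)) = ?S (scaleC c (dilation_group T r l))" for r
      by (rule S)
  qed
  show ?thesis
  proof (cases "t \<ge> 0")
    case True
    then show ?thesis by (rule pos)
  next
    case False
    \<comment> \<open>The case of the positive time \<open>- t\<close> is applied to the vector \<open>dilation_group T t k\<close>.\<close>
    have inv: "dilation_group T (- t) (dilation_group T t k) = k"
      by (subst dilation_group_add[symmetric]) (simp add: dilation_group_0)
    have "scaleC c k = dilation_group T (- t) (scaleC c (dilation_group T t k))"
      using False pos[of "- t" "dilation_group T t k"] by (simp add: inv)
    then show ?thesis by (simp only: dilation_group_minus)
  qed
qed

text \<open>On the first component the Schaeffer matrix acts as the backward shift, a contraction without
  nonzero square-summable fixed sequence, so that \<open>resolvent_kernel_invariant\<close> applies.\<close>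

lemma dilation_group_invariant:
  assumes k: "fst k = 0" and t: "t \<ge> 0"
  shows "fst (dilation_group T t k) = 0"
proof (rule resolvent_kernel_invariant[OF dilation_group_resolvent _ bounded_linear_fst _ k t])
  let ?R = "\<lambda>a :: 'h square_summable. (1/2) *\<^sub>R (a - l2_tl a)"
  show "fst ((1/2) *\<^sub>R (k - schaeffer (cogenerator T) k)) = ?R (fst k)" for k
    by (simp add: schaeffer_def case_prod_beta)
  have "norm (?R a) \<le> norm a * 1" for a
  proof -
    have "norm (l2_tl a) \<le> norm a" using contraction_l2_tl unfolding contraction_def by blast
    then show ?thesis using norm_triangle_ineq4[of a "l2_tl a"] by simp
  qed
  moreover have "?R (a + b) = ?R a + ?R b" "?R (r *\<^sub>R a) = r *\<^sub>R ?R a" for a b r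
    by (simp_all add: l2_tl_add l2_tl_scaleR algebra_simps)
  ultimately have "bounded_linear ?R"
    by (intro bounded_linear_intro[where K=1]) auto
  moreover have "a = 0" if "?R a = 0" for a
    using that by (intro l2_tl_fixpoint) simp
  ultimately show "dissipative_resolvent ?R"
    by (simp add: dissipative_resolvent_def contraction_l2_tl)
qed

text \<open>If the first component vanishes, then the Schaeffer matrix acts on the middle one as the cogenerator.
  By \<open>dilation_group_invariant\<close> this is the case along the whole orbit.\<close>

lemma dilation_group_compress:
  assumes k: "fst k = 0" and t: "t \<ge> 0"
  shows "fst (snd (dilation_group T t k)) = T t (fst (snd k))"
proof (rule resolvent_intertwine[OF dilation_group_resolvent resolvent_at_one_Laplace[OF T] _ t])
  show "bounded_linear (\<lambda>k :: 'h schaeffer_space. fst (snd k))"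
    by (rule bounded_linear_compose[OF bounded_linear_fst bounded_linear_snd])
  fix s :: real assume s: "s \<ge> 0"
  have "l2_hd (fst (dilation_group T s k)) = 0"
    using dilation_group_invariant[OF k s] by (simp add: entry_simps)
  then show "fst (snd ((1/2) *\<^sub>R (dilation_group T s k - schaeffer (cogenerator T) (dilation_group T s k)))) =
      Laplace T (fst (snd (dilation_group T s k)))"
    by (simp add: schaeffer_def case_prod_beta linear_0[OF linear_codefect[OF cogenerator_contraction]] cogenerator_def)
qed

lemma adjoint_eq_dilation_group:
  assumes t: "t \<ge> 0"
  shows "adjoint (T t) x = fst (snd (dilation_group T (- t) (0, x, 0)))"
proof (rule adjoint_eqI)
  show "bounded_linear (T t)" by (rule semigroup_bounded_linear[OF T t])
  fix y
  have "inner (T t y) x = inner (fst (snd (dilation_group T t (0, y, 0)))) x"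
    using dilation_group_compress[of "(0, y, 0)" t] t by simp
  also have "\<dots> = inner (dilation_group T t (0, y, 0)) (0, x, 0)"
    by (cases "dilation_group T t (0, y, 0)") simp
  also have "\<dots> = inner (0, y, 0) (dilation_group T (- t) (0, x, 0))"
    by (rule dilation_group_inner)
  also have "\<dots> = inner y (fst (snd (dilation_group T (- t) (0, x, 0))))"
    by (cases "dilation_group T (- t) (0, x, 0)") simp
  finally show "inner (T t y) x = inner y (fst (snd (dilation_group T (- t) (0, x, 0))))" .
qed

end

definition compact_strong_limit ::
  "real set \<Rightarrow> ('w \<Rightarrow> real \<Rightarrow> 'a \<Rightarrow> 'a) \<Rightarrow> (real \<Rightarrow> 'a \<Rightarrow> 'a::real_normed_vector) \<Rightarrow> 'w filter \<Rightarrow> bool" where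
  "compact_strong_limit I f g F \<longleftrightarrow>
     (\<forall>K x e. compact K \<longrightarrow> K \<subseteq> I \<longrightarrow> e > 0 \<longrightarrow> (\<forall>\<^sub>F a in F. \<forall>t\<in>K. norm (f a t x - g t x) < e))"

text \<open>The Laplace integrals are cut off at a time \<open>N\<close> after which they are negligible. The vectors
  may depend on \<open>a\<close>, so that one of them can be chosen as the difference to be estimated; \<open>z a\<close> is
  then its norm.\<close>

lemma Laplace_weak_difference:
  fixes T :: "'w \<Rightarrow> real \<Rightarrow> 'h::complex_hilbert \<Rightarrow> 'h"
  assumes Ta: "\<forall>\<^sub>F a in F. contraction_semigroup (T a)" and T': "contraction_semigroup T'"
    and c: "\<And>N c. N \<ge> 0 \<Longrightarrow> c > 0 \<Longrightarrow>
      \<forall>\<^sub>F a in F. \<forall>s\<in>{0..N}. \<bar>inner (x a) (T a s (y a) - T' s (y a))\<bar> \<le> c * z a"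
    and z: "\<And>a. norm (x a) * norm (y a) \<le> M * z a" "\<And>a. z a \<ge> 0" and M: "M \<ge> 0" and e: "e > 0"
  shows "\<forall>\<^sub>F a in F. \<bar>inner (x a) (Laplace (T a) (y a) - Laplace T' (y a))\<bar> \<le> e * z a"
proof -
  have "((\<lambda>N. 2 * exp (- N) * M) \<longlongrightarrow> 2 * 0 * M) at_top"
    by (intro tendsto_mult tendsto_const filterlim_compose[OF exp_at_bot filterlim_uminus_at_bot_at_top])
  then have "((\<lambda>N. 2 * exp (- N) * M) \<longlongrightarrow> 0) at_top" by simp
  then have "\<forall>\<^sub>F N in at_top. 2 * exp (- N) * M < e / 2"
    by (rule order_tendstoD(2)) (use e in simp)
  then obtain N where N: "N > 0" "2 * exp (- N) * M < e / 2"
    using eventually_happens'[OF trivial_limit_at_top_linorder eventually_conj[OF eventually_gt_at_top[of 0]]]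
    by blast
  have "\<forall>\<^sub>F a in F. \<forall>s\<in>{0..N}. \<bar>inner (x a) (T a s (y a) - T' s (y a))\<bar> \<le> e / (2 * N) * z a"
    using N e by (intro c) auto
  with Ta show ?thesis
  proof eventually_elim
    case (elim a)
    have "\<bar>inner (x a) (Laplace (T a) (y a) - Laplace T' (y a))\<bar> \<le>
        (e / (2 * N) * z a) * N + 2 * exp (- N) * norm (x a) * norm (y a)"
      using elim N by (intro Laplace_difference_bound T') auto
    also have "2 * exp (- N) * norm (x a) * norm (y a) \<le> 2 * exp (- N) * (M * z a)"
      using mult_left_mono[OF z(1)[of a], of "2 * exp (- N)"] by (simp add: mult.assoc)
    also have "\<dots> \<le> e / 2 * z a"
      using mult_right_mono[OF less_imp_le[OF N(2)] z(2)[of a]] by (simp add: mult.assoc)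
    also have "(e / (2 * N) * z a) * N = e / 2 * z a" using N by simp
    finally show ?case by simp
  qed
qed

lemma le_if_square_le:
  fixes c t :: real
  assumes "t * t \<le> c * t" "0 \<le> t" "0 \<le> c"
  shows "t \<le> c"
proof (cases "t = 0")
  case False
  then show ?thesis using assms by (intro mult_right_le_imp_le[of t t c]) auto
qed (use assms in simp)

text \<open>The difference is tested against itself.\<close>

lemma Laplace_tendsto:
  fixes T :: "'w \<Rightarrow> real \<Rightarrow> 'h::complex_hilbert \<Rightarrow> 'h"
  assumes Ta: "\<forall>\<^sub>F a in F. contraction_semigroup (T a)" and T': "contraction_semigroup T'"
    and lim: "compact_strong_limit {0..} T T' F"
  shows "((\<lambda>a. Laplace (T a) y) \<longlongrightarrow> Laplace T' y) F"
proof (rule LIM_zero_cancel, rule tendstoI)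
  fix e :: real assume e: "e > 0"
  let ?x = "\<lambda>a. Laplace (T a) y - Laplace T' y"
  have "\<forall>\<^sub>F a in F. \<bar>inner (?x a) (Laplace (T a) y - Laplace T' y)\<bar> \<le> e / 2 * norm (?x a)"
  proof (rule Laplace_weak_difference[OF Ta T', where M="norm y"])
    fix N c :: real assume N: "N \<ge> 0" and c: "c > 0"
    have "\<forall>\<^sub>F a in F. \<forall>s\<in>{0..N}. norm (T a s y - T' s y) < c"
      using lim c by (simp add: compact_strong_limit_def)
    then show "\<forall>\<^sub>F a in F. \<forall>s\<in>{0..N}. \<bar>inner (?x a) (T a s y - T' s y)\<bar> \<le> c * norm (?x a)"
    proof eventually_elim
      case (elim a)
      show ?case
      proof
        fix s assume s: "s \<in> {0..N}"
        have "\<bar>inner (?x a) (T a s y - T' s y)\<bar> \<le> norm (?x a) * norm (T a s y - T' s y)"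
          by (rule Cauchy_Schwarz_ineq2)
        also have "\<dots> \<le> norm (?x a) * c"
          using elim s by (intro mult_left_mono) (auto intro: less_imp_le)
        finally show "\<bar>inner (?x a) (T a s y - T' s y)\<bar> \<le> c * norm (?x a)" by (simp add: mult.commute)
      qed
    qed
  qed (use e in \<open>auto simp: mult.commute\<close>)
  then show "\<forall>\<^sub>F a in F. dist (?x a) 0 < e"
  proof eventually_elim
    case (elim a)
    have "norm (?x a) * norm (?x a) \<le> e / 2 * norm (?x a)"
      using elim by (simp flip: power2_eq_square power2_norm_eq_inner)
    then have "norm (?x a) \<le> e / 2" by (rule le_if_square_le) (use e in simp_all)
    then show ?case using e by simp
  qed
qed

text \<open>The difference is tested against itself; the semigroups enter only through their matrix
  coefficients, in which they can be moved to the fixed vector \<open>x\<close>.\<close>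

lemma adjoint_Laplace_tendsto:
  fixes T :: "'w \<Rightarrow> real \<Rightarrow> 'h::complex_hilbert \<Rightarrow> 'h"
  assumes Ta: "\<forall>\<^sub>F a in F. contraction_semigroup (T a)" and T': "contraction_semigroup T'"
    and lim: "compact_strong_limit {0..} (\<lambda>a t. adjoint (T a t)) (\<lambda>t. adjoint (T' t)) F"
  shows "((\<lambda>a. adjoint (Laplace (T a)) x) \<longlongrightarrow> adjoint (Laplace T') x) F"
proof (rule LIM_zero_cancel, rule tendstoI)
  fix e :: real assume e: "e > 0"
  let ?y = "\<lambda>a. adjoint (Laplace (T a)) x - adjoint (Laplace T') x"
  have "\<forall>\<^sub>F a in F. \<bar>inner x (Laplace (T a) (?y a) - Laplace T' (?y a))\<bar> \<le> e / 2 * norm (?y a)"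
  proof (rule Laplace_weak_difference[OF Ta T', where M="norm x"])
    fix N c :: real assume N: "N \<ge> 0" and c: "c > 0"
    have "\<forall>\<^sub>F a in F. \<forall>s\<in>{0..N}. norm (adjoint (T a s) x - adjoint (T' s) x) < c"
      using lim c by (simp add: compact_strong_limit_def)
    with Ta show "\<forall>\<^sub>F a in F. \<forall>s\<in>{0..N}. \<bar>inner x (T a s (?y a) - T' s (?y a))\<bar> \<le> c * norm (?y a)"
    proof eventually_elim
      case (elim a)
      show ?case
      proof
        fix s assume s: "s \<in> {0..N}"
        have "inner x (T a s (?y a) - T' s (?y a)) = inner (adjoint (T a s) x - adjoint (T' s) x) (?y a)"
          using adjoint_inner[OF semigroup_bounded_linear[OF elim(1)], of s "?y a" x]
            adjoint_inner[OF semigroup_bounded_linear[OF T'], of s "?y a" x] s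
          by (simp add: inner_diff_left inner_diff_right inner_commute)
        also have "\<bar>\<dots>\<bar> \<le> norm (adjoint (T a s) x - adjoint (T' s) x) * norm (?y a)"
          by (rule Cauchy_Schwarz_ineq2)
        also have "\<dots> \<le> c * norm (?y a)"
          using elim s by (intro mult_right_mono) (auto intro: less_imp_le)
        finally show "\<bar>inner x (T a s (?y a) - T' s (?y a))\<bar> \<le> c * norm (?y a)" .
      qed
    qed
  qed (use e in auto)
  with Ta show "\<forall>\<^sub>F a in F. dist (?y a) 0 < e"
  proof eventually_elim
    case (elim a)
    have bl: "bounded_linear (Laplace (T a))" "bounded_linear (Laplace T')"
      using Laplace_dissipative[OF elim(1)] Laplace_dissipative[OF T'] by (auto simp: dissipative_resolvent_def)
    have "inner x (Laplace (T a) (?y a) - Laplace T' (?y a)) = inner (?y a) (?y a)"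
      using adjoint_inner[OF bl(1), of "?y a" x] adjoint_inner[OF bl(2), of "?y a" x]
      by (simp only: inner_diff_right[of x] inner_commute[of x]) (simp add: inner_diff_left inner_diff_right inner_commute)
    then have "norm (?y a) * norm (?y a) \<le> e / 2 * norm (?y a)"
      using elim(2) by (simp flip: power2_eq_square power2_norm_eq_inner)
    then have "norm (?y a) \<le> e / 2" by (rule le_if_square_le) (use e in simp_all)
    then show ?case using e by simp
  qed
qed

text \<open>Positive times are covered by the Trotter-Kato theorem for the Schaeffer matrices, negative times by
  the same theorem for their inverses.\<close>

theorem dilation_group_limit:
  fixes T :: "'w \<Rightarrow> real \<Rightarrow> 'h::complex_hilbert \<Rightarrow> 'h"
  assumes Ta: "\<forall>\<^sub>F a in F. contraction_semigroup (T a)" and T': "contraction_semigroup T'"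
    and lim: "compact_strong_limit {0..} T T' F"
    and lim': "compact_strong_limit {0..} (\<lambda>a t. adjoint (T a t)) (\<lambda>t. adjoint (T' t)) F"
  shows "compact_strong_limit UNIV (\<lambda>a. dilation_group (T a)) (dilation_group T') F"
proof -
  have C: "\<forall>\<^sub>F a in F. contraction (cogenerator (T a))"
    using Ta by (rule eventually_mono) (rule cogenerator_contraction)
  have Clim: "((\<lambda>a. cogenerator (T a) x) \<longlongrightarrow> cogenerator T' x) F" for x
    unfolding cogenerator_def by (intro tendsto_intros Laplace_tendsto[OF Ta T' lim])
  have adj: "adjoint (cogenerator S) x = x - 2 *\<^sub>R adjoint (Laplace S) x" if S: "contraction_semigroup S"
    for S :: "real \<Rightarrow> 'h \<Rightarrow> 'h" and x
  proof (rule adjoint_eqI[OF contraction_bounded_linear[OF cogenerator_contraction[OF S]]])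
    have "bounded_linear (Laplace S)"
      using Laplace_dissipative[OF S] by (simp add: dissipative_resolvent_def)
    from adjoint_inner[OF this] show "inner (cogenerator S y) x = inner y (x - 2 *\<^sub>R adjoint (Laplace S) x)" for y
      by (simp add: cogenerator_def inner_diff_left inner_diff_right)
  qed
  have "((\<lambda>a. x - 2 *\<^sub>R adjoint (Laplace (T a)) x) \<longlongrightarrow> x - 2 *\<^sub>R adjoint (Laplace T') x) F" for x
    by (intro tendsto_intros adjoint_Laplace_tendsto[OF Ta T' lim'])
  moreover have "\<forall>\<^sub>F a in F. x - 2 *\<^sub>R adjoint (Laplace (T a)) x = adjoint (cogenerator (T a)) x" for x
    using Ta by (rule eventually_mono) (simp add: adj)
  ultimately have Clim': "((\<lambda>a. adjoint (cogenerator (T a)) x) \<longlongrightarrow> adjoint (cogenerator T') x) F" for x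
    unfolding adj[OF T'] by (rule Lim_transform_eventually)
  note V = schaeffer_tendsto[OF C cogenerator_contraction[OF T'] Clim Clim']
  show ?thesis
    unfolding compact_strong_limit_def
  proof (intro allI impI)
    fix K :: "real set" and k :: "'h schaeffer_space" and e :: real
    assume K: "compact K" and e: "e > 0"
    obtain B where "0 < B" "\<forall>t\<in>K. norm t \<le> B"
      using compact_imp_bounded[OF K] unfolding bounded_pos by blast
    then have B: "\<And>t. t \<in> K \<Longrightarrow> \<bar>t\<bar> \<le> B" "B \<ge> 0" by simp_all
    have "\<forall>\<^sub>F a in F. \<forall>t\<in>{0..B}. norm (dilation_group (T a) t k - dilation_group T' t k) < e"
    proof (rule Trotter_Kato[OF dilation_group_resolvent[OF T'] _ _ e B(2)])
      show "\<forall>\<^sub>F a in F. resolvent_at_one (dilation_group (T a)) (\<lambda>k. (1/2) *\<^sub>R (k - schaeffer (cogenerator (T a)) k))"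
        using Ta by (rule eventually_mono) (rule dilation_group_resolvent)
    qed (intro tendsto_intros V)
    moreover have "\<forall>\<^sub>F a in F. \<forall>t\<in>{0..B}. norm (dilation_group (T a) (- t) k - dilation_group T' (- t) k) < e"
    proof (rule Trotter_Kato[OF dilation_group_reverse_resolvent[OF T'] _ _ e B(2)])
      show "\<forall>\<^sub>F a in F. resolvent_at_one (\<lambda>t. dilation_group (T a) (- t)) (\<lambda>k. (1/2) *\<^sub>R (k - schaeffer_inv (cogenerator (T a)) k))"
        using Ta by (rule eventually_mono) (rule dilation_group_reverse_resolvent)
    qed (intro tendsto_intros V)
    ultimately show "\<forall>\<^sub>F a in F. \<forall>t\<in>K. norm (dilation_group (T a) t k - dilation_group T' t k) < e"
    proof eventually_elim
      case (elim a)
      show ?case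
      proof
        fix t assume "t \<in> K"
        then have "t \<in> {0..B} \<or> - t \<in> {0..B}" using B(1)[of t] by auto
        then show "norm (dilation_group (T a) t k - dilation_group T' t k) < e"
        proof
          assume "- t \<in> {0..B}"
          with elim(2) have "norm (dilation_group (T a) (- (- t)) k - dilation_group T' (- (- t)) k) < e" by blast
          then show ?thesis by simp
        qed (use elim(1) in blast)
      qed
    qed
  qed
qed

text \<open>The semigroups and their adjoints are compressions of the groups at positive and negative times,
  respectively, to a space that does not depend on \<open>a\<close>.\<close>

theorem semigroup_limit_from_dilation_group:
  fixes T :: "'w \<Rightarrow> real \<Rightarrow> 'h::complex_hilbert \<Rightarrow> 'h"
  assumes Ta: "\<forall>\<^sub>F a in F. contraction_semigroup (T a)" and T': "contraction_semigroup T'"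
    and lim: "compact_strong_limit UNIV (\<lambda>a. dilation_group (T a)) (dilation_group T') F"
  shows "compact_strong_limit {0..} T T' F"
    and "compact_strong_limit {0..} (\<lambda>a t. adjoint (T a t)) (\<lambda>t. adjoint (T' t)) F"
proof -
  have middle: "norm (fst (snd k) - fst (snd l)) \<le> norm (k - l)" for k l :: "'h schaeffer_space"
  proof -
    have "norm (fst (snd (k - l))) \<le> norm (snd (k - l))"
      by (cases "snd (k - l)") (simp add: norm_fst_le)
    also have "\<dots> \<le> norm (k - l)" by (cases "k - l") (simp add: norm_snd_le)
    finally show ?thesis by simp
  qed
  have lim_K: "\<forall>\<^sub>F a in F. \<forall>t\<in>K. norm (dilation_group (T a) t k - dilation_group T' t k) < e"
    if "compact K" "e > 0" for K k e
    by (rule lim[unfolded compact_strong_limit_def, rule_format, OF that(1) subset_UNIV that(2)])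
  show "compact_strong_limit {0..} T T' F"
    unfolding compact_strong_limit_def
  proof (intro allI impI)
    fix K :: "real set" and x :: 'h and e :: real
    assume K: "compact K" "K \<subseteq> {0..}" and e: "e > 0"
    show "\<forall>\<^sub>F a in F. \<forall>t\<in>K. norm (T a t x - T' t x) < e"
      using Ta lim_K[OF K(1) e, of "(0, x, 0)"]
    proof eventually_elim
      case (elim a)
      show ?case
      proof
        fix t assume t: "t \<in> K"
        then have "t \<ge> 0" using K by auto
        then have "T a t x = fst (snd (dilation_group (T a) t (0, x, 0)))"
          "T' t x = fst (snd (dilation_group T' t (0, x, 0)))"
          using dilation_group_compress[OF elim(1), of "(0, x, 0)" t]
            dilation_group_compress[OF T', of "(0, x, 0)" t] by simp_all
        then show "norm (T a t x - T' t x) < e"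
          using middle[of "dilation_group (T a) t (0, x, 0)" "dilation_group T' t (0, x, 0)"] elim(2) t
          by fastforce
      qed
    qed
  qed
  show "compact_strong_limit {0..} (\<lambda>a t. adjoint (T a t)) (\<lambda>t. adjoint (T' t)) F"
    unfolding compact_strong_limit_def
  proof (intro allI impI)
    fix K :: "real set" and x :: 'h and e :: real
    assume K: "compact K" "K \<subseteq> {0..}" and e: "e > 0"
    have "compact (uminus ` K)" using K(1) by (rule compact_negations)
    from Ta lim_K[OF this e, of "(0, x, 0)"]
    show "\<forall>\<^sub>F a in F. \<forall>t\<in>K. norm (adjoint (T a t) x - adjoint (T' t) x) < e"
    proof eventually_elim
      case (elim a)
      show ?case
      proof
        fix t assume t: "t \<in> K"
        then have "t \<ge> 0" using K by auto
        moreover have "norm (dilation_group (T a) (- t) (0, x, 0) - dilation_group T' (- t) (0, x, 0)) < e"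
          using elim(2) t by blast
        ultimately show "norm (adjoint (T a t) x - adjoint (T' t) x) < e"
          using middle[of "dilation_group (T a) (- t) (0, x, 0)" "dilation_group T' (- t) (0, x, 0)"]
          by (simp add: adjoint_eq_dilation_group[OF elim(1)] adjoint_eq_dilation_group[OF T'])
      qed
    qed
  qed
qed


section \<open>Transport of a Hilbert space along an injection\<close>

text \<open>The copy of a Hilbert space on the range of the injection \<open>j\<close>.\<close>

definition transported_space :: "('k::complex_hilbert \<Rightarrow> 'b) \<Rightarrow> 'b cspace" where
  "transported_space j =
    \<lparr>vecs = range j, vadd = (\<lambda>u v. j (inv j u + inv j v)), vzero = j 0,
     vscale = (\<lambda>c u. j (scaleC c (inv j u))), vinner = (\<lambda>u v. cinner (inv j u) (inv j v))\<rparr>"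

context
  fixes j :: "'k::complex_hilbert \<Rightarrow> 'b"
  assumes j: "inj j"
begin

lemma transported_simps:
  "vecs (transported_space j) = range j"
  "vadd (transported_space j) (j x) (j y) = j (x + y)"
  "vzero (transported_space j) = j 0"
  "vscale (transported_space j) c (j x) = j (scaleC c x)"
  "vinner (transported_space j) (j x) (j y) = cinner x y"
  by (simp_all add: transported_space_def j)

lemma vnorm_transported: "vnorm (transported_space j) (j x) = norm x"
  by (simp add: vnorm_def transported_simps Re_cinner norm_eq_sqrt_inner)

lemma vdist_transported: "vdist (transported_space j) (j x) (j y) = norm (x - y)"
  by (simp add: vdist_def transported_simps vnorm_transported scaleC_minus_one)

lemma complex_hilbert_space_transported: "complex_hilbert_space (transported_space j)"
proof
  fix u v w :: 'b and a b :: complex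
  let ?H = "transported_space j"
  show "vzero ?H \<in> vecs ?H" by (simp add: transported_simps)
  assume "u \<in> vecs ?H"
  then obtain x where u: "u = j x" by (auto simp: transported_simps)
  show "vscale ?H a u \<in> vecs ?H" "vadd ?H u (vzero ?H) = u"
    "vscale ?H (a + b) u = vadd ?H (vscale ?H a u) (vscale ?H b u)"
    "vscale ?H a (vscale ?H b u) = vscale ?H (a * b) u" "vscale ?H 1 u = u" "0 \<le> Re (vinner ?H u u)"
    by (simp_all add: u transported_simps scaleC_add_left scaleC_scaleC scaleC_real_one Re_cinner)
  show "\<exists>v\<in>vecs ?H. vadd ?H u v = vzero ?H"
    by (rule bexI[of _ "j (- x)"]) (simp_all add: u transported_simps)
  show "u = vzero ?H" if "vinner ?H u u = 0"
  proof -
    have "inner x x = 0" using that by (simp add: u transported_simps flip: Re_cinner)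
    then show ?thesis by (simp add: u transported_simps)
  qed
  assume "v \<in> vecs ?H"
  then obtain y where v: "v = j y" by (auto simp: transported_simps)
  show "vadd ?H u v \<in> vecs ?H" "vadd ?H u v = vadd ?H v u"
    "vscale ?H a (vadd ?H u v) = vadd ?H (vscale ?H a u) (vscale ?H a v)"
    "vinner ?H (vscale ?H a u) v = a * vinner ?H u v"
    by (simp_all add: u v transported_simps add.commute scaleC_add_right cinner_scaleC_left)
  show "vinner ?H u v = cnj (vinner ?H v u)"
    using cinner_commute[of x y] by (simp add: u v transported_simps)
  assume "w \<in> vecs ?H"
  then obtain z where w: "w = j z" by (auto simp: transported_simps)
  show "vadd ?H (vadd ?H u v) w = vadd ?H u (vadd ?H v w)"
    "vinner ?H (vadd ?H u v) w = vinner ?H u w + vinner ?H v w"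
    by (simp_all add: u v w transported_simps add.assoc cinner_add_left)
next
  fix \<sigma> :: "nat \<Rightarrow> 'b"
  let ?H = "transported_space j"
  assume "\<And>n. \<sigma> n \<in> vecs ?H"
  then have "\<exists>x. \<sigma> n = j x" for n by (auto simp: transported_simps)
  then obtain x where \<sigma>: "\<And>n. \<sigma> n = j (x n)" by metis
  assume *: "\<And>e. e > 0 \<Longrightarrow> \<exists>N. \<forall>m\<ge>N. \<forall>n\<ge>N. vdist ?H (\<sigma> m) (\<sigma> n) < e"
  have "Cauchy x"
    unfolding Cauchy_def dist_norm using * by (simp add: \<sigma> vdist_transported)
  then obtain l where "x \<longlonglongrightarrow> l"
    using Cauchy_convergent convergent_def by blast
  then have "(\<lambda>n. vdist ?H (\<sigma> n) (j l)) \<longlonglongrightarrow> 0"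
    unfolding \<sigma> vdist_transported by (intro tendsto_norm_zero LIM_zero)
  then show "\<exists>u\<in>vecs ?H. (\<lambda>n. vdist ?H (\<sigma> n) u) \<longlonglongrightarrow> 0"
    by (intro bexI[of _ "j l"]) (simp_all add: transported_simps)
qed

definition transported_op :: "('k \<Rightarrow> 'k) \<Rightarrow> 'b \<Rightarrow> 'b" where
  "transported_op A u = j (A (inv j u))"

lemma transported_op_apply: "transported_op A (j x) = j (A x)"
  by (simp add: transported_op_def j)

lemma transported_op_bounded:
  assumes "linear A" "\<And>x. norm (A x) = norm x" "\<And>c x. A (scaleC c x) = scaleC c (A x)"
  shows "transported_op A \<in> bounded_ops (transported_space j) (transported_space j)"
  unfolding bounded_ops_def
  using assms
  by (auto simp: transported_simps transported_op_apply linear_add vnorm_transported intro: exI[of _ 1])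

end

lemma (in complex_hilbert_space) vinner_right_ext:
  assumes z: "z \<in> vecs H" "z' \<in> vecs H" and eq: "\<And>x. x \<in> vecs H \<Longrightarrow> vinner H x z = vinner H x z'"
  shows "z = z'"
proof -
  let ?d = "vadd H z (vscale H (-1) z')"
  have m: "vscale H (-1) z' \<in> vecs H" and d: "?d \<in> vecs H"
    using z by (auto intro: add_closed scale_closed)
  have "vinner H z w = vinner H z' w" if "w \<in> vecs H" for w
    using eq[OF that] that z by (metis inner_commute)
  then have "vinner H ?d ?d = 0"
    using z m d by (simp add: inner_add_left inner_scale_left)
  then have "?d = vzero H" using d by (rule inner_eq_zero[rotated])
  then have "vadd H ?d z' = vadd H z' (vzero H)"
    using z zero_closed by (simp add: add_commute)
  moreover have "vadd H ?d z' = z"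
    using z m by (metis add_assoc add_commute add_minus add_zero)
  ultimately show ?thesis using z by (simp add: add_zero)
qed

lemma (in complex_hilbert_space) adj_eqI:
  assumes "z \<in> vecs H" "\<And>x. x \<in> vecs H \<Longrightarrow> vinner K (A x) y = vinner H x z"
  shows "adj H K A y = z"
  unfolding adj_def
proof (rule the_equality)
  fix z' assume "z' \<in> vecs H \<and> (\<forall>x\<in>vecs H. vinner K (A x) y = vinner H x z')"
  then show "z' = z" using assms by (intro vinner_right_ext) auto
qed (use assms in auto)

text \<open>This translates the suprema in the topology \<open>kSOT\<close> into uniform estimates.\<close>

lemma SUP_ennreal_tendsto_zero_iff:
  assumes "\<And>a t. 0 \<le> d a t"
  shows "((\<lambda>a. SUP t\<in>K. ennreal (d a t)) \<longlongrightarrow> 0) F \<longleftrightarrow> (\<forall>e>0. \<forall>\<^sub>F a in F. \<forall>t\<in>K. d a t < e)"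
proof
  assume L: "((\<lambda>a. SUP t\<in>K. ennreal (d a t)) \<longlongrightarrow> 0) F"
  show "\<forall>e>0. \<forall>\<^sub>F a in F. \<forall>t\<in>K. d a t < e"
  proof (intro allI impI)
    fix e :: real assume e: "e > 0"
    have "\<forall>\<^sub>F a in F. (SUP t\<in>K. ennreal (d a t)) < ennreal e"
      using order_tendstoD(2)[OF L, of "ennreal e"] e by simp
    then show "\<forall>\<^sub>F a in F. \<forall>t\<in>K. d a t < e"
    proof eventually_elim
      case (elim a)
      show ?case
      proof
        fix t assume "t \<in> K"
        then have "ennreal (d a t) \<le> (SUP t\<in>K. ennreal (d a t))" by (rule SUP_upper)
        also note elim
        finally have "ennreal (d a t) < ennreal e" .
        then show "d a t < e" using assms by (simp add: ennreal_less_iff)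
      qed
    qed
  qed
next
  assume R: "\<forall>e>0. \<forall>\<^sub>F a in F. \<forall>t\<in>K. d a t < e"
  show "((\<lambda>a. SUP t\<in>K. ennreal (d a t)) \<longlongrightarrow> 0) F"
  proof (rule order_tendstoI)
    fix e :: ennreal assume "0 < e"
    then obtain c where c: "0 < c" "c < e" using dense by blast
    then obtain r where "c = ennreal r" "0 \<le> r"
      by (cases c) auto
    with c have r: "0 < r" "ennreal r < e" by (auto simp: ennreal_less_zero_iff)
    have "\<forall>\<^sub>F a in F. \<forall>t\<in>K. d a t < r" using R r by blast
    then show "\<forall>\<^sub>F a in F. (SUP t\<in>K. ennreal (d a t)) < e"
    proof eventually_elim
      case (elim a)
      have "(SUP t\<in>K. ennreal (d a t)) \<le> ennreal r"
        by (rule SUP_least, rule ennreal_leI) (use elim in auto)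
      then show ?case using r(2) by (rule order_le_less_trans)
    qed
  qed simp
qed

text \<open>An entry of a triple is recorded as its inner products with all vectors \<open>h\<close>. Which entry is shown
  depends on the length of the list: \<open>x\<close> for length 0, \<open>a\<^sub>n\<close> for length \<open>2 n + 1\<close> and \<open>b\<^sub>n\<close> for
  length \<open>2 n + 2\<close>.\<close>

definition dilation_embedding :: "'h::complex_hilbert schaeffer_space \<Rightarrow> ('w, 'h) dilation_vector" where
  "dilation_embedding = (\<lambda>(a, x, b) (ws, h).
     case length ws of 0 \<Rightarrow> cinner x h
     | Suc n \<Rightarrow> if even n then cinner (entry a (n div 2)) h else cinner (entry b (n div 2)) h)"

lemma cinner_left_ext:
  fixes x y :: "'h::complex_hilbert"
  assumes "\<And>h. cinner x h = cinner y h"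
  shows "x = y"
proof -
  have "inner x h = inner y h" for h
    using assms[of h] by (metis Re_cinner)
  then show ?thesis using vector_eq_rdot[of x y] by simp
qed

lemma inj_dilation_embedding: "inj (dilation_embedding :: 'h::complex_hilbert schaeffer_space \<Rightarrow> ('w, 'h) dilation_vector)"
proof (rule injI)
  fix k l :: "'h schaeffer_space"
  assume eq: "(dilation_embedding k :: ('w, 'h) dilation_vector) = dilation_embedding l"
  obtain a x b where k: "k = (a, x, b)" by (cases k)
  obtain a' x' b' where l: "l = (a', x', b')" by (cases l)
  have at: "dilation_embedding k (replicate n (undefined :: 'w \<times> real), h) =
      dilation_embedding l (replicate n (undefined :: 'w \<times> real), h)" for n h
    using eq by simp
  have "x = x'"
  proof (rule cinner_left_ext)
    show "cinner x h = cinner x' h" for h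
      using at[of 0 h] by (simp add: k l dilation_embedding_def)
  qed
  moreover have "a = a'"
  proof (rule square_summable_eqI, rule cinner_left_ext)
    show "cinner (entry a n) h = cinner (entry a' n) h" for n h
      using at[of "Suc (2 * n)" h] by (simp add: k l dilation_embedding_def)
  qed
  moreover have "b = b'"
  proof (rule square_summable_eqI, rule cinner_left_ext)
    show "cinner (entry b n) h = cinner (entry b' n) h" for n h
      using at[of "Suc (Suc (2 * n))" h] by (simp add: k l dilation_embedding_def)
  qed
  ultimately show "k = l" by (simp add: k l)
qed


section \<open>The dilation and its continuity\<close>

lemma space_of_type_simps:
  "vecs space_of_type = UNIV" "vadd space_of_type = (+)" "vzero space_of_type = 0"
  "vscale space_of_type = scaleC" "vinner space_of_type = cinner"
  by (simp_all add: space_of_type_def)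

lemma linear_if_complex_linear:
  fixes A :: "'a::complex_hilbert \<Rightarrow> 'b::complex_hilbert"
  assumes "\<And>x y. A (x + y) = A x + A y" "\<And>c x. A (scaleC c x) = scaleC c (A x)"
  shows "linear A"
proof
  show "A (r *\<^sub>R x) = r *\<^sub>R A x" for r x
    using assms(2)[of "complex_of_real r" x] by (simp add: scaleC_of_real)
qed (rule assms(1))

lemma bounded_ops_space_of_type:
  "A \<in> bounded_ops space_of_type space_of_type \<longleftrightarrow>
     bounded_linear A \<and> (\<forall>c x. A (scaleC c x) = scaleC c (A x))"
proof
  assume "A \<in> bounded_ops space_of_type space_of_type"
  then have A: "\<And>x y. A (x + y) = A x + A y" "\<And>c x. A (scaleC c x) = scaleC c (A x)"
    and "\<exists>K. \<forall>x. norm (A x) \<le> K * norm x"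
    by (simp_all add: bounded_ops_def space_of_type_simps vnorm_space_of_type)
  then obtain K where K: "\<And>x. norm (A x) \<le> norm x * K"
    by (metis mult.commute)
  have "linear A" using A by (rule linear_if_complex_linear)
  then have "bounded_linear A"
    by (intro bounded_linear_intro[where K=K] K) (simp_all add: linear_add linear_scale)
  with A(2) show "bounded_linear A \<and> (\<forall>c x. A (scaleC c x) = scaleC c (A x))" by simp
next
  assume A: "bounded_linear A \<and> (\<forall>c x. A (scaleC c x) = scaleC c (A x))"
  then have lin: "linear A" by (simp add: bounded_linear.linear)
  obtain K where "\<And>x. norm (A x) \<le> K * norm x"
    using A bounded_linear.bounded[of A] by (metis mult.commute)
  then show "A \<in> bounded_ops space_of_type space_of_type"
    using A lin by (auto simp: bounded_ops_def space_of_type_simps vnorm_space_of_type linear_add)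
qed

lemma contractive_C0_semigroupD:
  fixes T :: "real \<Rightarrow> 'h::complex_hilbert \<Rightarrow> 'h"
  assumes T: "contractive_C0_semigroup space_of_type T"
  shows "contraction_semigroup T"
    and "t \<ge> 0 \<Longrightarrow> T t (scaleC c x) = scaleC c (T t x)"
proof -
  have ops: "\<And>t. t \<ge> 0 \<Longrightarrow> T t \<in> bounded_ops space_of_type space_of_type"
    and T0: "\<And>x. T 0 x = x"
    and Tadd: "\<And>s t x. s \<ge> 0 \<Longrightarrow> t \<ge> 0 \<Longrightarrow> T (s + t) x = T s (T t x)"
    and sc: "strongly_continuous_on {0..} space_of_type T"
    and norm: "\<And>t x. t \<ge> 0 \<Longrightarrow> norm (T t x) \<le> norm x"
    using T by (simp_all add: contractive_C0_semigroup_def space_of_type_simps vnorm_space_of_type)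
  have "continuous_on {0..} (\<lambda>t. T t x)" for x
    using sc unfolding continuous_on_def strongly_continuous_on_def vdist_space_of_type
    by (simp add: space_of_type_simps flip: tendsto_dist_iff)
  moreover have "contraction (T t)" if "t \<ge> 0" for t
    using ops[OF that] norm[OF that]
    by (simp add: bounded_ops_space_of_type contraction_def bounded_linear.linear)
  ultimately show "contraction_semigroup T"
    using T0 Tadd by (simp add: contraction_semigroup_def)
  show "t \<ge> 0 \<Longrightarrow> T t (scaleC c x) = scaleC c (T t x)"
    using ops[of t] by (simp add: bounded_ops_space_of_type)
qed

text \<open>A real adjoint of a complex linear operator is a complex adjoint.\<close>

lemma cinner_adjoint:
  fixes A :: "'a::complex_hilbert \<Rightarrow> 'b::complex_hilbert"
  assumes A: "\<And>x y. inner (A x) y = inner x (B y)" and Ac: "\<And>c x. A (scaleC c x) = scaleC c (A x)"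
  shows "B (scaleC c y) = scaleC c (B y)" and "cinner (A x) y = cinner x (B y)"
proof -
  have B: "B (scaleC c y) = scaleC c (B y)" for c y
  proof (rule vector_eq_ldot[THEN iffD1, rule_format])
    fix x
    have "inner x (B (scaleC c y)) = inner (A x) (scaleC c y)" by (rule A[symmetric])
    also have "\<dots> = inner (A (scaleC (cnj c) x)) y"
      using inner_scaleC[of "cnj c" "A x" y] by (simp add: Ac)
    also have "\<dots> = inner (scaleC (cnj c) x) (B y)" by (rule A)
    also have "\<dots> = inner x (scaleC c (B y))"
      using inner_scaleC[of "cnj c" x "B y"] by simp
    finally show "inner x (B (scaleC c y)) = inner x (scaleC c (B y))" .
  qed
  show "B (scaleC c y) = scaleC c (B y)" by (rule B)
  show "cinner (A x) y = cinner x (B y)"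
    unfolding cinner_eq_Complex A B ..
qed

lemma adj_space_of_type:
  fixes A :: "'h::complex_hilbert \<Rightarrow> 'h"
  assumes A: "A \<in> bounded_ops space_of_type space_of_type"
  shows "adj space_of_type space_of_type A = adjoint A"
proof
  fix y
  have bl: "bounded_linear A" and Ac: "\<And>c x. A (scaleC c x) = scaleC c (A x)"
    using A by (simp_all add: bounded_ops_space_of_type)
  show "adj space_of_type space_of_type A y = adjoint A y"
    by (rule complex_hilbert_space.adj_eqI[OF complex_hilbert_space_space_of_type])
      (simp_all add: space_of_type_simps cinner_adjoint(2)[OF adjoint_inner[OF bl] Ac])
qed

lemma limitin_kSOT_space_of_type:
  fixes f :: "'w \<Rightarrow> real \<Rightarrow> 'h::complex_hilbert \<Rightarrow> 'h"
  assumes g: "g \<in> op_functions (top_of_set I) space_of_type"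
    and f: "\<forall>\<^sub>F a in F. f a \<in> op_functions (top_of_set I) space_of_type"
  shows "limitin (kSOT (top_of_set I) space_of_type) f g F \<longleftrightarrow> compact_strong_limit I f g F"
proof -
  have "((\<lambda>a. SUP t\<in>K. ennreal (vdist space_of_type (f a t x) (g t x))) \<longlongrightarrow> 0) F \<longleftrightarrow>
      (\<forall>e>0. \<forall>\<^sub>F a in F. \<forall>t\<in>K. norm (f a t x - g t x) < e)" for K x
    unfolding vdist_space_of_type dist_norm by (rule SUP_ennreal_tendsto_zero_iff) simp
  then show ?thesis
    unfolding complex_hilbert_space.limitin_kSOT_iff[OF complex_hilbert_space_space_of_type]
      compact_strong_limit_def
    using g f by (auto simp: compactin_subtopology space_of_type_simps)
qed

lemma limitin_kSOT_transported:
  fixes j :: "'k::complex_hilbert \<Rightarrow> 'b"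
  assumes j: "inj j"
    and g: "(\<lambda>t. transported_op j (g t)) \<in> op_functions euclidean (transported_space j)"
    and f: "\<forall>\<^sub>F a in F. (\<lambda>t. transported_op j (f a t)) \<in> op_functions euclidean (transported_space j)"
  shows "limitin (kSOT euclidean (transported_space j)) (\<lambda>a t. transported_op j (f a t))
      (\<lambda>t. transported_op j (g t)) F \<longleftrightarrow> compact_strong_limit UNIV f g F"
proof -
  let ?H = "transported_space j"
  let ?d = "\<lambda>K u a. SUP t\<in>K. ennreal (vdist ?H (transported_op j (f a t) u) (transported_op j (g t) u))"
  have eq: "(?d K (j x) \<longlongrightarrow> 0) F \<longleftrightarrow> (\<forall>e>0. \<forall>\<^sub>F a in F. \<forall>t\<in>K. norm (f a t x - g t x) < e)" for K x
    unfolding transported_op_apply[OF j] vdist_transported[OF j] by (rule SUP_ennreal_tendsto_zero_iff) simp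
  have "(\<forall>K u. compactin euclidean K \<longrightarrow> u \<in> vecs ?H \<longrightarrow> (?d K u \<longlongrightarrow> 0) F) \<longleftrightarrow>
      (\<forall>K x. compact K \<longrightarrow> (?d K (j x) \<longlongrightarrow> 0) F)"
    unfolding compactin_euclidean_iff transported_simps(1)[OF j] by blast
  then show ?thesis
    unfolding complex_hilbert_space.limitin_kSOT_iff[OF complex_hilbert_space_transported[OF j]]
      compact_strong_limit_def eq
    using g f by auto
qed

lemma eventually_atin_topspace: "\<forall>\<^sub>F a in atin X x. a \<in> topspace X"
  by (auto simp: eventually_atin)

text \<open>Both sides are limits along the punctured neighbourhoods of each parameter \<open>w\<close>, uniform on
  compact sets of times, and for these the equivalence is known.\<close>

lemma continuous_map_iff_dilation:
  fixes T :: "'w \<Rightarrow> real \<Rightarrow> 'h::complex_hilbert \<Rightarrow> 'h"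
  assumes T: "\<And>w. w \<in> topspace \<Omega> \<Longrightarrow> contractive_C0_semigroup space_of_type (T w)"
    and j: "inj j"
  shows "continuous_map \<Omega> (kSOT euclidean (transported_space j)) (\<lambda>w t. transported_op j (dilation_group (T w) t)) \<longleftrightarrow>
    continuous_map \<Omega> (kSOT_star (top_of_set {0..}) space_of_type) T"
  unfolding continuous_map_atin
proof (rule ball_cong[OF refl])
  fix w assume w: "w \<in> topspace \<Omega>"
  let ?F = "atin \<Omega> w"
  note semi = contractive_C0_semigroupD(1)[OF T] and clin = contractive_C0_semigroupD(2)[OF T]
  have opT: "T v \<in> op_functions (top_of_set {0..}) space_of_type" if "v \<in> topspace \<Omega>" for v
    using T[OF that] by (auto simp: op_functions_def contractive_C0_semigroup_def)
  have adj_eq: "adj space_of_type space_of_type (T v t) = adjoint (T v t)" if "v \<in> topspace \<Omega>" "t \<ge> 0" for v t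
    using opT[OF that(1)] that(2) by (intro adj_space_of_type) (simp add: op_functions_def)
  have opA: "(\<lambda>t. adj space_of_type space_of_type (T v t)) \<in> op_functions (top_of_set {0..}) space_of_type"
    if v: "v \<in> topspace \<Omega>" for v
  proof -
    have "adjoint (T v t) \<in> bounded_ops space_of_type space_of_type" if t: "t \<ge> 0" for t
      using cinner_adjoint(1)[OF adjoint_inner[OF semigroup_bounded_linear[OF semi[OF v] t]] clin[OF v t]]
        contraction_bounded_linear[OF contraction_adjoint[OF semigroup_contraction[OF semi[OF v] t]]]
      by (simp add: bounded_ops_space_of_type)
    then show ?thesis by (auto simp: op_functions_def adj_eq[OF v])
  qed
  have opU: "(\<lambda>t. transported_op j (dilation_group (T v) t)) \<in> op_functions euclidean (transported_space j)"
    if v: "v \<in> topspace \<Omega>" for v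
    unfolding op_functions_def
  proof (intro CollectI ballI)
    fix t
    show "transported_op j (dilation_group (T v) t) \<in> bounded_ops (transported_space j) (transported_space j)"
      by (rule transported_op_bounded[OF j dilation_group_linear[OF semi[OF v]] dilation_group_isometric[OF semi[OF v]]
            dilation_group_complex_linear[OF semi[OF v] clin[OF v]]])
  qed
  have ev: "\<forall>\<^sub>F a in ?F. P a" if "\<And>v. v \<in> topspace \<Omega> \<Longrightarrow> P v" for P
    using eventually_atin_topspace by (rule eventually_mono) (rule that)
  have adj_limit: "compact_strong_limit {0..} (\<lambda>a t. adj space_of_type space_of_type (T a t))
      (\<lambda>t. adj space_of_type space_of_type (T w t)) ?F \<longleftrightarrow>
    compact_strong_limit {0..} (\<lambda>a t. adjoint (T a t)) (\<lambda>t. adjoint (T w t)) ?F"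
    unfolding compact_strong_limit_def
  proof (intro all_cong1 imp_cong refl eventually_cong)
    show "\<forall>\<^sub>F a in ?F. a \<in> topspace \<Omega>" by (rule eventually_atin_topspace)
    fix K :: "real set" and x :: 'h and e :: real and a
    assume K: "K \<subseteq> {0..}" and a: "a \<in> topspace \<Omega>"
    show "(\<forall>t\<in>K. norm (adj space_of_type space_of_type (T a t) x - adj space_of_type space_of_type (T w t) x) < e) \<longleftrightarrow>
        (\<forall>t\<in>K. norm (adjoint (T a t) x - adjoint (T w t) x) < e)"
      using K by (intro ball_cong refl) (auto simp: adj_eq[OF a] adj_eq[OF w])
  qed
  have "limitin (kSOT euclidean (transported_space j)) (\<lambda>w t. transported_op j (dilation_group (T w) t))
      (\<lambda>t. transported_op j (dilation_group (T w) t)) ?F \<longleftrightarrow>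
    compact_strong_limit UNIV (\<lambda>a. dilation_group (T a)) (dilation_group (T w)) ?F"
    by (rule limitin_kSOT_transported[OF j opU[OF w] ev]) (rule opU)
  also have "\<dots> \<longleftrightarrow> compact_strong_limit {0..} T (T w) ?F \<and>
      compact_strong_limit {0..} (\<lambda>a t. adjoint (T a t)) (\<lambda>t. adjoint (T w t)) ?F"
    using dilation_group_limit[OF ev semi[OF w]] semigroup_limit_from_dilation_group[OF ev semi[OF w]] semi
    by blast
  also have "\<dots> \<longleftrightarrow> limitin (kSOT (top_of_set {0..}) space_of_type) T (T w) ?F \<and>
      limitin (kSOT (top_of_set {0..}) space_of_type)
        (\<lambda>a t. adj space_of_type space_of_type (T a t)) (\<lambda>t. adj space_of_type space_of_type (T w t)) ?F"
    using limitin_kSOT_space_of_type[OF opT[OF w] ev[OF opT]]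
      limitin_kSOT_space_of_type[OF opA[OF w] ev[OF opA]] adj_limit by simp
  also have "\<dots> \<longleftrightarrow> limitin (kSOT_star (top_of_set {0..}) space_of_type) T (T w) ?F"
    by (rule complex_hilbert_space.limitin_kSOT_star_iff[OF complex_hilbert_space_space_of_type opA[OF w], symmetric])
  finally show "limitin (kSOT euclidean (transported_space j)) (\<lambda>w t. transported_op j (dilation_group (T w) t))
      (\<lambda>t. transported_op j (dilation_group (T w) t)) ?F \<longleftrightarrow>
    limitin (kSOT_star (top_of_set {0..}) space_of_type) T (T w) ?F" .
qed

text \<open>The vectors with vanishing first component form a space that is invariant under all dilation groups
  at once, and there each group acts on the middle component as its semigroup. So the product can be
  treated factor by factor.\<close>

lemma word_product_compress:
  fixes T :: "'w \<Rightarrow> real \<Rightarrow> 'h::complex_hilbert \<Rightarrow> 'h"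
  assumes T: "\<And>w. w \<in> W \<Longrightarrow> contraction_semigroup (T w)" and j: "inj j"
    and ws: "set ws \<subseteq> W \<times> {0..}" and k: "fst k = 0"
  shows "\<exists>l. word_product (\<lambda>w t. transported_op j (dilation_group (T w) t)) ws (j k) = j l \<and>
    fst l = 0 \<and> fst (snd l) = word_product T ws (fst (snd k))"
  using ws
proof (induction ws)
  case Nil
  show ?case using k by (intro exI[of _ k]) (simp add: word_product_simps)
next
  case (Cons wt ws)
  obtain w t where wt: "wt = (w, t)" by (cases wt)
  then have w: "contraction_semigroup (T w)" and t: "t \<ge> 0" and "set ws \<subseteq> W \<times> {0..}"
    using Cons.prems T by auto
  then obtain l where l: "word_product (\<lambda>w t. transported_op j (dilation_group (T w) t)) ws (j k) = j l"
      "fst l = 0" "fst (snd l) = word_product T ws (fst (snd k))"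
    using Cons.IH by blast
  show ?case
    by (intro exI[of _ "dilation_group (T w) t l"] conjI)
      (simp_all add: wt word_product_simps l transported_op_apply[OF j]
        dilation_group_invariant[OF w l(2) t] dilation_group_compress[OF w l(2) t])
qed

lemma free_unitary_dilation_transported:
  fixes T :: "'w \<Rightarrow> real \<Rightarrow> 'h::complex_hilbert \<Rightarrow> 'h"
  assumes T: "\<And>w. w \<in> W \<Longrightarrow> contractive_C0_semigroup space_of_type (T w)" and j: "inj j"
  shows "free_unitary_dilation W space_of_type T (transported_space j) (\<lambda>x. j (0, x, 0))
    (\<lambda>w t. transported_op j (dilation_group (T w) t))"
  unfolding free_unitary_dilation_def
proof (intro conjI ballI allI impI)
  let ?H = "transported_space j"
  note semi = contractive_C0_semigroupD(1)[OF T] and clin = contractive_C0_semigroupD(2)[OF T]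
  interpret H: complex_hilbert_space ?H by (rule complex_hilbert_space_transported[OF j])
  show "complex_hilbert_space ?H" by unfold_locales
  have scaleC_0: "scaleC c 0 = (0 :: 'c::complex_hilbert)" for c
    using linear_0[OF bounded_linear.linear[OF bounded_linear_scaleC]] .
  show "isometry_op space_of_type ?H (\<lambda>x. j (0, x, 0))"
    unfolding isometry_op_def bounded_ops_def
    by (auto simp: space_of_type_simps transported_simps[OF j] vnorm_transported[OF j] vnorm_space_of_type
        scaleC_prod_def scaleC_0 norm_Pair intro: exI[of _ 1])
  have cinner_0: "cinner 0 x = 0" for x :: "'h square_summable"
    by (simp add: cinner_eq_Complex complex_eq_iff)
  have adj_r: "adj space_of_type ?H (\<lambda>x. j (0, x, 0)) (j k) = fst (snd k)" for k
    by (rule complex_hilbert_space.adj_eqI[OF complex_hilbert_space_space_of_type])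
      (simp_all add: space_of_type_simps transported_simps[OF j] cinner_prod_def cinner_0)
  {
    fix w assume w: "w \<in> W"
    let ?G = "dilation_group (T w)"
    note G_clin = dilation_group_complex_linear[OF semi[OF w] clin[OF w]]
    have bounded: "transported_op j (?G t) \<in> bounded_ops ?H ?H" for t
      by (rule transported_op_bounded[OF j dilation_group_linear[OF semi[OF w]] dilation_group_isometric[OF semi[OF w]] G_clin])
    have adj_G: "adj ?H ?H (transported_op j (?G t)) (j k) = j (?G (- t) k)" for t k
    proof (rule H.adj_eqI)
      fix u assume "u \<in> vecs ?H"
      then obtain l where u: "u = j l" by (auto simp: transported_simps[OF j])
      show "vinner ?H (transported_op j (?G t) u) (j k) = vinner ?H u (j (?G (- t) k))"
        unfolding u transported_op_apply[OF j] transported_simps(5)[OF j]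
        by (rule cinner_adjoint(2)[OF dilation_group_inner[OF semi[OF w]] G_clin])
    qed (simp add: transported_simps[OF j])
    have minus: "?G (- t) (?G t k) = k" for t k
      using dilation_group_minus[OF semi[OF w], of "- t" k] by simp
    show "unitary_representation ?H (\<lambda>t. transported_op j (?G t))"
      unfolding unitary_representation_def unitary_op_def strongly_continuous_on_def
    proof (intro conjI allI ballI)
      fix s t :: real and u assume "u \<in> vecs ?H"
      then obtain k where u: "u = j k" by (auto simp: transported_simps[OF j])
      show "adj ?H ?H (transported_op j (?G t)) (transported_op j (?G t) u) = u"
        "transported_op j (?G t) (adj ?H ?H (transported_op j (?G t)) u) = u"
        "transported_op j (?G 0) u = u"
        "transported_op j (?G (s + t)) u = transported_op j (?G s) (transported_op j (?G t) u)"
        by (simp_all add: u transported_op_apply[OF j] adj_G minus dilation_group_minus[OF semi[OF w]]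
            dilation_group_0[OF semi[OF w]] dilation_group_add[OF semi[OF w]])
      have "((\<lambda>s. ?G s k) \<longlongrightarrow> ?G t k) (at t within UNIV)"
        using dilation_group_continuous_on[OF semi[OF w], of UNIV k] by (simp add: continuous_on_def)
      then show "((\<lambda>s. vdist ?H (transported_op j (?G s) u) (transported_op j (?G t) u)) \<longlongrightarrow> 0) (at t within UNIV)"
        unfolding u transported_op_apply[OF j] vdist_transported[OF j]
        by (intro tendsto_norm_zero LIM_zero)
    qed (rule bounded)
  next
    fix ws :: "('w \<times> real) list" and x :: 'h
    assume ws: "set ws \<subseteq> W \<times> {0..}"
    have "\<exists>l. word_product (\<lambda>w t. transported_op j (dilation_group (T w) t)) ws (j (0, x, 0)) = j l \<and>
        fst l = 0 \<and> fst (snd l) = word_product T ws (fst (snd (0 :: 'h square_summable, x, 0 :: 'h square_summable)))"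
      by (rule word_product_compress[OF _ j ws]) (simp_all add: semi)
    then obtain l where "word_product (\<lambda>w t. transported_op j (dilation_group (T w) t)) ws (j (0, x, 0)) = j l"
        "fst (snd l) = word_product T ws x"
      by auto
    then show "word_product T ws x = adj space_of_type ?H (\<lambda>x. j (0, x, 0))
        (word_product (\<lambda>w t. transported_op j (dilation_group (T w) t)) ws (j (0, x, 0)))"
      by (simp add: adj_r)
  }
qed

theorem theorem1p12:
  fixes \<Omega> :: "'w topology"
    and T :: "'w \<Rightarrow> real \<Rightarrow> 'h::complex_hilbert \<Rightarrow> 'h"
  assumes "compact_space \<Omega>"
    and "\<And>w. w \<in> topspace \<Omega> \<Longrightarrow> contractive_C0_semigroup space_of_type (T w)"
  shows "\<exists>(H' :: ('w, 'h) dilation_vector cspace) r U.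
           free_unitary_dilation (topspace \<Omega>) space_of_type T H' r U \<and>
           (continuous_map \<Omega> (kSOT euclidean H') U \<longleftrightarrow>
            continuous_map \<Omega> (kSOT_star (top_of_set {0..}) space_of_type) T)"
proof -
  let ?j = "dilation_embedding :: 'h schaeffer_space \<Rightarrow> ('w, 'h) dilation_vector"
  have "free_unitary_dilation (topspace \<Omega>) space_of_type T (transported_space ?j) (\<lambda>x. ?j (0, x, 0))
      (\<lambda>w t. transported_op ?j (dilation_group (T w) t))"
    using assms(2) inj_dilation_embedding by (rule free_unitary_dilation_transported)
  moreover have "continuous_map \<Omega> (kSOT euclidean (transported_space ?j))
      (\<lambda>w t. transported_op ?j (dilation_group (T w) t)) \<longleftrightarrow>
    continuous_map \<Omega> (kSOT_star (top_of_set {0..}) space_of_type) T"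
    using assms(2) inj_dilation_embedding by (rule continuous_map_iff_dilation)
  ultimately show ?thesis by blast
qed

end
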